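(* Consider the facilitated exclusion process on the segment $\{1,\ldots,N\}$ with $k$ particles and parameter $p=1/2$ (so $q=1/2$), and let $T^{N,k}_{\mathrm{seg}}(\epsilon)$ denote its $\epsilon$-mixing time. Let $k=k(N)$ be a sequence of integers satisfying $N/2<k(N)<N$ such that $N-k(N)\to\infty$ and $k(N)-N/2\to\infty$ as $N\to\infty$. Then there exist constants $0<C_1<C_2$, which do not depend on $\epsilon$, such that for all $\epsilon\in(0,1)$ $$ C_{1}\leq\liminf_{N\rightarrow\infty}\frac{T^{N,k}_{\mathrm{seg}}(\epsilon)}{N^{2}\log (N-k)}\leq\limsup_{N\rightarrow\infty}\frac{T^{N,k}_{\mathrm{seg}}(\epsilon)}{N^{2}\log (N-k)}\leq C_{2}. $$
   Context: Facilitated exclusion process (FEP) on the segment. For integers $N\ge 1$ and $N/2<k\le N$ let $\Omega_{N,k}=\{\xi\in\{0,1\}^{N}:\sum_{x=1}^{N}\xi(x)=k\}$; $\xi(x)=1$ means there is a particle at $x$, $\xi(x)=0$ means there is a hole at $x$. Let $p,q\ge 0$ with $p+q=1$. The FEP on the segment $[N]=\{1,\ldots,N\}$ with parameter $p$ is the continuous-time Markov chain on $\Omega_{N,k}$ with generator $$\mathcal{L}f(\xi)=\sum_{x=2}^{N-1}p\,\xi(x)\xi(x-1)(1-\xi(x+1))[f(\xi^{x,x+1})-f(\xi)]+\sum_{x=2}^{N-1}q\,\xi(x)\xi(x+1)(1-\xi(x-1))[f(\xi^{x,x-1})-f(\xi)],$$ where $\xi^{x,y}$ is obtained from $\xi$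 by exchanging the values at $x$ and $y$. The ergodic component is $\mathcal{E}_{N,k}=\{\xi\in\Omega_{N,k}:\xi(x)+\xi(x+1)\ge 1\ \forall x\in\{1,\ldots,N-1\},\ \xi(1)\xi(N)=1\}$. When $p=1/2$ the equilibrium distribution $\mu_{N,k}$ is the uniform distribution on $\mathcal{E}_{N,k}$, regarded as a probability measure on $\Omega_{N,k}$. Let $P_t^{\xi}$ be the law at time $t$ of the FEP started from $\xi\in\Omega_{N,k}$. Set $d_{N,k}(t)=\max_{\xi\in\Omega_{N,k}}\|P_t^{\xi}-\mu_{N,k}\|_{\mathrm{TV}}$ (total variation distance) and $T^{N,k}_{\mathrm{seg}}(\epsilon)=\inf\{t\ge 0: d_{N,k}(t)\le\epsilon\}$. *)

theory Defs
  imports "HOL-Probability.Probability"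
begin

text \<open>A configuration is a map from the segment \<open>{1..N}\<close> to \<open>{0, 1}\<close> (1 = particle,
  0 = hole), extended by \<open>undefined\<close> outside the segment, so that the sets below are finite.\<close>

type_synonym config = "nat \<Rightarrow> nat"

definition Omega :: "nat \<Rightarrow> nat \<Rightarrow> config set" where
  "Omega N k = {\<xi> \<in> {1..N} \<rightarrow>\<^sub>E {0, 1}. (\<Sum>x=1..N. \<xi> x) = k}"

definition exchange :: "config \<Rightarrow> nat \<Rightarrow> nat \<Rightarrow> config" where
  "exchange \<xi> x y = \<xi>(x := \<xi> y, y := \<xi> x)"

definition fep_generator :: "real \<Rightarrow> nat \<Rightarrow> (config \<Rightarrow> real) \<Rightarrow> config \<Rightarrow> real" where
  "fep_generator p N f \<xi> =
     (\<Sum>x=2..N-1. p * real (\<xi> x) * real (\<xi> (x - 1)) * (1 - real (\<xi> (x + 1)))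
                    * (f (exchange \<xi> x (x + 1)) - f \<xi>))
   + (\<Sum>x=2..N-1. (1 - p) * real (\<xi> x) * real (\<xi> (x + 1)) * (1 - real (\<xi> (x - 1)))
                    * (f (exchange \<xi> x (x - 1)) - f \<xi>))"

text \<open>The state space is finite, so the chain with generator \<open>L\<close> has transition semigroup
  \<open>exp (t L)\<close>. The law at time \<open>t\<close> started from \<open>\<xi>\<close> gives \<open>\<eta>\<close> the mass
  \<open>(exp (t L) f) \<xi>\<close>, where \<open>f\<close> is the indicator of \<open>\<eta>\<close>.\<close>

definition fep_law :: "real \<Rightarrow> nat \<Rightarrow> real \<Rightarrow> config \<Rightarrow> config \<Rightarrow> real" where
  "fep_law p N t \<xi> \<eta> =
     (\<Sum>n. t ^ n / fact n * (fep_generator p N ^^ n) (\<lambda>\<zeta>. of_bool (\<zeta> = \<eta>)) \<xi>)"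

definition ergodic_component :: "nat \<Rightarrow> nat \<Rightarrow> config set" where
  "ergodic_component N k =
     {\<xi> \<in> Omega N k. (\<forall>x\<in>{1..N-1}. \<xi> x + \<xi> (x + 1) \<ge> 1) \<and> \<xi> 1 * \<xi> N = 1}"

definition equilibrium :: "nat \<Rightarrow> nat \<Rightarrow> config pmf" where
  "equilibrium N k = pmf_of_set (ergodic_component N k)"

text \<open>Total variation distance of two probability mass functions on a finite set \<open>S\<close>.\<close>

definition tv_dist :: "'a set \<Rightarrow> ('a \<Rightarrow> real) \<Rightarrow> ('a \<Rightarrow> real) \<Rightarrow> real" where
  "tv_dist S P Q = (MAX A\<in>Pow S. \<bar>(\<Sum>\<eta>\<in>A. P \<eta>) - (\<Sum>\<eta>\<in>A. Q \<eta>)\<bar>)"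

text \<open>Both of the following concern the symmetric case \<open>p = 1/2\<close>, in which the equilibrium is
  uniform on the ergodic component. The infimum is taken in the extended reals, so it is
  \<open>\<infinity>\<close> if there is no such \<open>t\<close>.\<close>

definition worst_dist :: "nat \<Rightarrow> nat \<Rightarrow> real \<Rightarrow> real" where
  "worst_dist N k t =
     (MAX \<xi>\<in>Omega N k. tv_dist (Omega N k) (fep_law (1/2) N t \<xi>) (pmf (equilibrium N k)))"

definition T_seg :: "nat \<Rightarrow> nat \<Rightarrow> real \<Rightarrow> ereal" where
  "T_seg N k \<epsilon> = (INF t\<in>{t. 0 \<le> t \<and> worst_dist N k t \<le> \<epsilon>}. ereal t)"

end

theory Submission
  imports Defs "HOL-Real_Asymp.Real_Asymp"
begin

text \<open>Write \<open>m = N - k\<close> for the number of holes and \<open>n = k - 1\<close>; then \<open>n - m = 2k - N - 1\<close>. Call a pair of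
neighbouring sites a bond, put virtual holes at the sites \<open>0\<close> and \<open>N + 1\<close>, and call a bond full if
both its sites are occupied and a trap if both are empty. A jump moves a full bond by two places,
unless it lands on a trap: then the full bond and the trap annihilate. Hence traps are never
created, the number of full bonds minus the number of traps is always \<open>n - m\<close>, and the ergodic
component is the set of configurations without traps. The process thus consists of two phases:
walkers (full bonds) fill immobile traps until none is left; then, reading an ergodic
configuration as the sequence of the distances between consecutive particles, which are \<open>1\<close> or
\<open>2\<close>, one sees the symmetric exclusion process of \<open>m\<close> particles on \<open>n\<close> sites.

The whole argument is about functions, not trajectories. For a finite jump chain with generator
\<open>L\<close> and total jump rate at most \<open>c\<close>, the operator \<open>1 + L / c\<close> is monotone and
\<open>exp (t L) = exp (- c t) exp (c t (1 + L / c))\<close>; so \<open>L V \<le> \<kappa> V\<close> implies \<open>exp (t L) V \<le> exp (\<kappa> t) V\<close>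
for \<open>\<kappa> \<ge> - c\<close> (lemma \<open>P_lyapunov\<close>). All estimates come from a good choice of \<open>V\<close>.

Upper bound. For the transient phase, \<open>V\<close> is the sum over all pairs of a trap and a full bond of a
concave increasing function of their distance, with values between \<open>1\<close> and \<open>2\<close>, divided by
\<open>n - m + 1\<close> (\<open>trap_energy\<close>). It decays at rate \<open>1 / (N + 1)\<^sup>2\<close>, it is at least \<open>1\<close> as long as there
is a trap, because then there are at least \<open>n - m + 1\<close> walkers, and it is at most \<open>2 (m + 1)\<^sup>2\<close>.
So the ergodic component is reached at time of order \<open>N\<^sup>2 log m\<close>. For the exclusion process, two
configurations that differ in the position of one particle are coupled by stirring, with
independent clocks only on the bond between the two discrepancies when these are adjacent; the same
concave function of the distance of the discrepancies contracts at rate \<open>1 / n\<^sup>2\<close>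
(\<open>iter_exchange\<close>). Any two configurations are joined by at most \<open>m\<close> such exchanges, which gives
mixing at time of order \<open>N\<^sup>2 log m\<close> again (\<open>worst_dist_le\<close>).

Lower bound. No single phase is always slow enough. If \<open>n - m > sqrt N\<close>, then \<open>min m (n - m)\<close> is at
least \<open>sqrt m\<close>, and the exclusion process itself needs time of order \<open>N\<^sup>2 log m\<close>: Wilson's method
with the eigenfunction \<open>\<Sum> cos (\<pi> (s - 1/2) / n)\<close> over the occupied sites \<open>s\<close>
(\<open>worst_dist_wilson\<close>). If \<open>n - m \<le> sqrt N\<close>, start from the configuration with all particles on the
left. The number of walkers, initially of order \<open>N\<close>, has to fall to \<open>n - m\<close>, and it decays only at a
rate of order \<open>1 / N\<^sup>2\<close>. This is made precise by a weighted number \<open>f\<close> of walkers with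
\<open>L f \<ge> - C f / N\<^sup>2\<close> and the Lyapunov function \<open>1 / (f + sqrt N)\<close>, whose growth rate is of order
\<open>1 / N\<^sup>2\<close> as well (\<open>worst_dist_transient\<close>).\<close>

section \<open>Finite jump chains and Lyapunov functions\<close>

definition jump_gen :: "'i set \<Rightarrow> ('i \<Rightarrow> 's \<Rightarrow> real) \<Rightarrow> ('i \<Rightarrow> 's \<Rightarrow> 's) \<Rightarrow> ('s \<Rightarrow> real) \<Rightarrow> 's \<Rightarrow> real" where
  "jump_gen I r T f s = (\<Sum>i\<in>I. r i s * (f (T i s) - f s))"

text \<open>The exponential of \<open>t L\<close>, evaluated pointwise; \<open>fep_law\<close> has this form.\<close>

definition semigroup_of :: "(('s \<Rightarrow> real) \<Rightarrow> 's \<Rightarrow> real) \<Rightarrow> real \<Rightarrow> ('s \<Rightarrow> real) \<Rightarrow> 's \<Rightarrow> real" where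
  "semigroup_of L t f s = (\<Sum>n. t ^ n / fact n * (L ^^ n) f s)"

text \<open>In state \<open>s\<close> the move \<open>T i\<close> is made at rate \<open>r i s\<close>; different moves may lead to the same state.
The constant \<open>c\<close> dominates the total jump rate, so that \<open>step\<close> below is the averaging
operator of a discrete-time chain on \<open>S\<close>. Values of functions outside \<open>S\<close> never enter on \<open>S\<close>.\<close>

locale jump_chain =
  fixes S :: "'s set" and I :: "'i set" and r :: "'i \<Rightarrow> 's \<Rightarrow> real"
    and T :: "'i \<Rightarrow> 's \<Rightarrow> 's" and c :: real
  assumes finite_states: "finite S"
    and finite_moves: "finite I"
    and c_pos: "0 < c"
    and rate_nonneg: "\<And>i s. i \<in> I \<Longrightarrow> s \<in> S \<Longrightarrow> 0 \<le> r i s"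
    and rate_sum: "\<And>s. s \<in> S \<Longrightarrow> (\<Sum>i\<in>I. r i s) \<le> c"
    and move_closed: "\<And>i s. i \<in> I \<Longrightarrow> s \<in> S \<Longrightarrow> r i s \<noteq> 0 \<Longrightarrow> T i s \<in> S"
begin

abbreviation gen :: "('s \<Rightarrow> real) \<Rightarrow> 's \<Rightarrow> real" where
  "gen \<equiv> jump_gen I r T"

definition step :: "('s \<Rightarrow> real) \<Rightarrow> 's \<Rightarrow> real" where
  "step f s = f s + gen f s / c"

abbreviation P :: "real \<Rightarrow> ('s \<Rightarrow> real) \<Rightarrow> 's \<Rightarrow> real" where
  "P \<equiv> semigroup_of gen"

lemma step_expand:
  "step f s = (1 - (\<Sum>i\<in>I. r i s) / c) * f s + (\<Sum>i\<in>I. r i s / c * f (T i s))"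
proof -
  have "gen f s = (\<Sum>i\<in>I. r i s * f (T i s)) - (\<Sum>i\<in>I. r i s) * f s"
    by (simp add: jump_gen_def right_diff_distrib sum_subtractf sum_distrib_right)
  then show ?thesis
    by (simp add: step_def diff_divide_distrib left_diff_distrib flip: sum_divide_distrib)
qed

lemma step_mono:
  assumes "\<And>s. s \<in> S \<Longrightarrow> f s \<le> g s" "s \<in> S"
  shows "step f s \<le> step g s"
proof -
  have "r i s / c * f (T i s) \<le> r i s / c * g (T i s)" if "i \<in> I" for i
  proof (cases "r i s = 0")
    case False
    then show ?thesis
      using that assms c_pos rate_nonneg move_closed by (intro mult_left_mono) auto
  qed simp
  moreover have "(\<Sum>i\<in>I. r i s) / c \<le> 1"
    using rate_sum[OF assms(2)] c_pos by simp
  ultimately show ?thesis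
    unfolding step_expand using assms by (intro add_mono sum_mono[of I] mult_left_mono[of "f s"]) auto
qed

lemma step_cong:
  assumes "\<And>s. s \<in> S \<Longrightarrow> f s = g s" "s \<in> S"
  shows "step f s = step g s"
  using step_mono[of f g s] step_mono[of g f s] assms by (simp add: order_antisym)

lemma step_add: "step (\<lambda>s. f s + g s) = (\<lambda>s. step f s + step g s)"
  by (auto simp: fun_eq_iff step_def jump_gen_def algebra_simps sum.distrib sum_subtractf add_divide_distrib
      diff_divide_distrib)

lemma step_scale: "step (\<lambda>s. a * f s) = (\<lambda>s. a * step f s)"
  by (auto simp: fun_eq_iff step_def jump_gen_def algebra_simps sum_distrib_left sum_distrib_right add_divide_distrib
      diff_divide_distrib sum_divide_distrib)

lemma step_const: "step (\<lambda>s. a) = (\<lambda>s. a)"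
  by (auto simp: fun_eq_iff step_def jump_gen_def)

lemma iter_mono:
  assumes "\<And>s. s \<in> S \<Longrightarrow> f s \<le> g s" "s \<in> S"
  shows "(step ^^ j) f s \<le> (step ^^ j) g s"
  using assms(2) by (induction j arbitrary: s) (auto intro!: step_mono simp: assms(1))

lemma iter_add: "(step ^^ j) (\<lambda>s. f s + g s) = (\<lambda>s. (step ^^ j) f s + (step ^^ j) g s)"
  by (induction j) (simp_all add: step_add)

lemma iter_scale: "(step ^^ j) (\<lambda>s. a * f s) = (\<lambda>s. a * (step ^^ j) f s)"
  by (induction j) (simp_all add: step_scale)

lemma iter_const: "(step ^^ j) (\<lambda>s. a) = (\<lambda>s. a)"
  by (induction j) (simp_all add: step_const)

lemma iter_bounded:
  "\<exists>M. \<forall>j. \<forall>s\<in>S. \<bar>(step ^^ j) f s\<bar> \<le> M"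
proof -
  define M where "M = (\<Sum>s\<in>S. \<bar>f s\<bar>)"
  have M: "\<bar>f s\<bar> \<le> M" if "s \<in> S" for s
    unfolding M_def using that finite_states by (intro member_le_sum) auto
  have "\<bar>(step ^^ j) f s\<bar> \<le> M" if "s \<in> S" for j s
    using iter_mono[of f "\<lambda>_. M" s j] iter_mono[of "\<lambda>_. -M" f s j] that M
    by (auto simp: iter_const abs_le_iff minus_le_iff)
  then show ?thesis by blast
qed

text \<open>Since \<open>gen = c (step - 1)\<close> and \<open>step\<close> commutes with the identity, this is the binomial theorem.\<close>

lemma gen_power_binomial:
  "(gen ^^ n) f s = c ^ n * (\<Sum>j\<le>n. real (n choose j) * (-1) ^ (n - j) * (step ^^ j) f s)"
proof (induction n arbitrary: s)
  case (Suc n)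
  let ?g = "\<lambda>j. (step ^^ j) f" and ?b = "\<lambda>j. real (n choose j) * (-1) ^ (n - j)"
  have gs: "gen u s = c * (step u s - u s)" for u s
    using c_pos by (simp add: step_def)
  have lin: "step (\<lambda>s. c ^ n * (\<Sum>j\<le>n. ?b j * ?g j s)) s
     = c ^ n * (\<Sum>j\<le>n. ?b j * ?g (Suc j) s)" for s
  proof -
    have *: "step (\<lambda>s. \<Sum>j\<in>A. ?b j * ?g j s)
        = (\<lambda>s. \<Sum>j\<in>A. ?b j * ?g (Suc j) s)" if "finite A" for A
      using that by induction (simp_all add: step_const step_add step_scale)
    show ?thesis by (simp add: step_scale *)
  qed
  have "(gen ^^ Suc n) f s = c * (step ((gen ^^ n) f) s - (gen ^^ n) f s)"
    by (simp add: gs)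
  also have "(gen ^^ n) f = (\<lambda>s. c ^ n * (\<Sum>j\<le>n. ?b j * ?g j s))"
    by (simp add: fun_eq_iff Suc.IH)
  also have "c * (step \<dots> s - \<dots> s) = c ^ Suc n *
     ((\<Sum>j\<le>n. ?b j * ?g (Suc j) s)
       - (\<Sum>j\<le>n. ?b j * ?g j s))"
    unfolding lin by (simp add: algebra_simps)
  also have "(\<Sum>j\<le>n. ?b j * ?g (Suc j) s)
       - (\<Sum>j\<le>n. ?b j * ?g j s)
     = (\<Sum>j\<le>Suc n. real (Suc n choose j) * (-1) ^ (Suc n - j) * ?g j s)"
  proof -
    have "(\<Sum>j\<le>Suc n. real (Suc n choose j) * (-1) ^ (Suc n - j) * ?g j s)
      = (-1) ^ Suc n * ?g 0 s + (\<Sum>j\<le>n. (real (n choose j) + real (n choose Suc j)) * (-1) ^ (n - j) * ?g (Suc j) s)"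
      by (subst sum.atMost_Suc_shift) simp
    also have "\<dots> = (\<Sum>j\<le>n. ?b j * ?g (Suc j) s)
       + ((-1) ^ Suc n * ?g 0 s + (\<Sum>j\<le>n. real (n choose Suc j) * (-1) ^ (n - j) * ?g (Suc j) s))"
      by (simp add: algebra_simps sum.distrib)
    also have "(-1) ^ Suc n * ?g 0 s + (\<Sum>j\<le>n. real (n choose Suc j) * (-1) ^ (n - j) * ?g (Suc j) s)
        = (\<Sum>j\<le>Suc n. real (n choose j) * (-1) ^ (Suc n - j) * ?g j s)"
      by (subst sum.atMost_Suc_shift) simp
    also have "\<dots> = (\<Sum>j\<le>n. real (n choose j) * (-1) ^ (Suc n - j) * ?g j s)"
      by simp
    also have "\<dots> = - (\<Sum>j\<le>n. ?b j * ?g j s)"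
      by (simp add: Suc_diff_le flip: sum_negf)
    finally show ?thesis by simp
  qed
  finally show ?case .
qed simp

lemma iter_series_summable:
  assumes "s \<in> S"
  shows "summable (\<lambda>j. norm ((c * t) ^ j / fact j * (step ^^ j) f s))"
proof -
  obtain M where M: "\<And>j s. s \<in> S \<Longrightarrow> \<bar>(step ^^ j) f s\<bar> \<le> M"
    using iter_bounded by blast
  have s: "summable (\<lambda>j. M * (\<bar>c * t\<bar> ^ j / fact j))"
    using summable_exp_generic[of "\<bar>c * t\<bar>"] by (intro summable_mult) (simp add: divide_inverse mult.commute scaleR_conv_of_real)
  show ?thesis
  proof (rule summable_comparison_test'[OF s, of 0])
    fix j
    have "\<bar>(c * t) ^ j / fact j\<bar> * \<bar>(step ^^ j) f s\<bar> \<le> \<bar>(c * t) ^ j / fact j\<bar> * M"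
      using M[OF assms] by (intro mult_left_mono) auto
    then show "norm (norm ((c * t) ^ j / fact j * (step ^^ j) f s)) \<le> M * (\<bar>c * t\<bar> ^ j / fact j)"
      by (simp add: abs_mult power_abs mult.commute)
  qed
qed

text \<open>By the previous lemma the terms of \<open>exp (t gen)\<close> are those of the Cauchy product of \<open>exp (c t step)\<close>
and \<open>exp (- c t)\<close>. This form of the semigroup has nonnegative coefficients for \<open>t \<ge> 0\<close>, so
monotonicity and all bounds on the iterates of \<open>step\<close> pass to continuous time.\<close>

lemma uniformization:
  assumes "s \<in> S"
  shows "(\<lambda>n. t ^ n / fact n * (gen ^^ n) f s) sums
    (exp (- (c * t)) * (\<Sum>j. (c * t) ^ j / fact j * (step ^^ j) f s))"
proof -
  let ?a = "\<lambda>j. (c * t) ^ j / fact j * (step ^^ j) f s"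
  let ?b = "\<lambda>j. (- (c * t)) ^ j /\<^sub>R fact j"
  have "t ^ n / fact n * (gen ^^ n) f s = (\<Sum>i\<le>n. ?a i * ?b (n - i))" for n
  proof -
    have "t ^ n / fact n * (gen ^^ n) f s
      = (\<Sum>j\<le>n. (c * t) ^ n / fact n * (real (n choose j) * (-1) ^ (n - j) * (step ^^ j) f s))"
      by (simp add: gen_power_binomial power_mult_distrib sum_distrib_left mult.assoc mult.left_commute mult.commute)
    also have "\<dots> = (\<Sum>i\<le>n. ?a i * ?b (n - i))"
    proof (rule sum.cong)
      fix j assume "j \<in> {..n}"
      then have j: "j \<le> n" by simp
      have "(c * t) ^ n = (c * t) ^ j * (c * t) ^ (n - j)"
        using j by (simp flip: power_add)
      moreover have "(- (c * t)) ^ (n - j) = (-1) ^ (n - j) * (c * t) ^ (n - j)"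
        by (rule power_minus)
      moreover have "real (n choose j) / fact n = 1 / (fact j * fact (n - j))"
        using binomial_fact[OF j, where 'a=real] by simp
      ultimately show "(c * t) ^ n / fact n * (real (n choose j) * (-1) ^ (n - j) * (step ^^ j) f s)
         = ?a j * ?b (n - j)"
        using j by (simp add: field_simps)
    qed simp
    finally show ?thesis .
  qed
  moreover have "(\<lambda>n. \<Sum>i\<le>n. ?a i * ?b (n - i)) sums ((\<Sum>j. ?a j) * (\<Sum>j. ?b j))"
    using summable_norm_exp[of "- (c * t)"]
    by (intro Cauchy_product_sums iter_series_summable assms) auto
  ultimately show ?thesis
    by (simp add: exp_def mult.commute)
qed

lemma P_eq:
  assumes "s \<in> S"
  shows "P t f s = exp (- (c * t)) * (\<Sum>j. (c * t) ^ j / fact j * (step ^^ j) f s)"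
  using sums_unique[OF uniformization[OF assms]] by (simp add: semigroup_of_def)

lemma exp_series: "(\<lambda>j. x ^ j / fact j * a) sums (exp (x::real) * a)"
  using sums_mult2[OF exp_converges[of x], of a] by (simp add: divide_inverse mult.commute)

lemma P_mono:
  assumes "\<And>s. s \<in> S \<Longrightarrow> f s \<le> g s" "s \<in> S" "0 \<le> t"
  shows "P t f s \<le> P t g s"
proof -
  have "(\<Sum>j. (c * t) ^ j / fact j * (step ^^ j) f s) \<le> (\<Sum>j. (c * t) ^ j / fact j * (step ^^ j) g s)"
    using assms c_pos iter_mono
    by (intro suminf_le mult_left_mono summable_norm_cancel[OF iter_series_summable]) auto
  then show ?thesis using P_eq assms(2) by simp
qed

lemma P_add: "s \<in> S \<Longrightarrow> P t (\<lambda>s. f s + g s) s = P t f s + P t g s"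
  by (simp only: P_eq iter_add distrib_left
      suminf_add[OF summable_norm_cancel[OF iter_series_summable] summable_norm_cancel[OF iter_series_summable], symmetric])

lemma P_scale:
  assumes "s \<in> S"
  shows "P t (\<lambda>s. a * f s) s = a * P t f s"
proof -
  have "(\<Sum>j. (c * t) ^ j / fact j * (a * (step ^^ j) f s)) = (\<Sum>j. a * ((c * t) ^ j / fact j * (step ^^ j) f s))"
    by (simp add: mult.left_commute)
  also have "\<dots> = a * (\<Sum>j. (c * t) ^ j / fact j * (step ^^ j) f s)"
    by (intro suminf_mult summable_norm_cancel[OF iter_series_summable] assms)
  finally show ?thesis
    by (simp only: P_eq[OF assms] iter_scale mult.left_commute)
qed

lemma P_const:
  assumes "s \<in> S"
  shows "P t (\<lambda>s. a) s = a"
proof -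
  have "(\<Sum>j. (c * t) ^ j / fact j * a) = exp (c * t) * a"
    using exp_series by (simp add: sums_iff)
  then show ?thesis
    by (simp only: P_eq[OF assms] iter_const) (simp flip: mult.assoc exp_add)
qed

lemma P_sum:
  assumes "s \<in> S" "finite A"
  shows "P t (\<lambda>s. \<Sum>i\<in>A. f i s) s = (\<Sum>i\<in>A. P t (f i) s)"
  using assms(2) by induction (simp_all add: P_add P_const assms(1))

text \<open>Geometric decay of the iterates becomes exponential decay of the semigroup; the constant \<open>b\<close> is
what the iterates converge to.\<close>

lemma P_le_of_iter_le:
  assumes "\<And>j. (step ^^ j) f s \<le> a * \<rho> ^ j + b" "s \<in> S" "0 \<le> t"
  shows "P t f s \<le> a * exp (- (c * (1 - \<rho>) * t)) + b"
proof -
  have e: "(\<lambda>j. (c * t) ^ j / fact j * (a * \<rho> ^ j + b)) sums (exp (c * t * \<rho>) * a + exp (c * t) * b)"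
    using sums_add[OF exp_series[of "c * t * \<rho>" a] exp_series[of "c * t" b]]
    by (simp add: algebra_simps power_mult_distrib add_divide_distrib)
  have "(\<Sum>j. (c * t) ^ j / fact j * (step ^^ j) f s) \<le> (\<Sum>j. (c * t) ^ j / fact j * (a * \<rho> ^ j + b))"
    using assms c_pos e
    by (intro suminf_le mult_left_mono summable_norm_cancel[OF iter_series_summable]) (auto simp: sums_iff)
  also have "\<dots> = exp (c * t * \<rho>) * a + exp (c * t) * b"
    using e by (simp add: sums_iff)
  finally have "P t f s \<le> exp (- (c * t)) * (exp (c * t * \<rho>) * a + exp (c * t) * b)"
    using P_eq[OF assms(2)] by simp
  also have "\<dots> = a * exp (- (c * (1 - \<rho>) * t)) + b"
    by (simp add: algebra_simps flip: exp_add)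
  finally show ?thesis .
qed

text \<open>The hypothesis says \<open>step V \<le> (1 + \<kappa> / c) V\<close>, and this can be iterated because \<open>step\<close> is monotone and the
factor is nonnegative. The function \<open>V\<close> may change sign.\<close>

lemma iter_lyapunov:
  assumes V: "\<And>s. s \<in> S \<Longrightarrow> gen V s \<le> \<kappa> * V s" and "- c \<le> \<kappa>" "s \<in> S"
  shows "(step ^^ j) V s \<le> (1 + \<kappa> / c) ^ j * V s"
  using assms(3)
proof (induction j arbitrary: s)
  case (Suc j)
  have nn: "0 \<le> 1 + \<kappa> / c"
    using assms(2) c_pos by (simp add: field_simps)
  have "(step ^^ Suc j) V s \<le> step (\<lambda>s. (1 + \<kappa> / c) ^ j * V s) s"
    using Suc by (auto intro: step_mono)
  also have "\<dots> = (1 + \<kappa> / c) ^ j * (V s + gen V s / c)"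
    by (simp add: step_scale step_def)
  also have "\<dots> \<le> (1 + \<kappa> / c) ^ j * (V s + (\<kappa> * V s) / c)"
    using V Suc.prems c_pos nn by (intro mult_left_mono add_left_mono divide_right_mono) auto
  finally show ?case by (simp add: algebra_simps)
qed simp

lemma P_lyapunov:
  assumes "\<And>s. s \<in> S \<Longrightarrow> gen V s \<le> \<kappa> * V s" "- c \<le> \<kappa>" "s \<in> S" "0 \<le> t"
  shows "P t V s \<le> exp (\<kappa> * t) * V s"
  using P_le_of_iter_le[of V s "V s" "1 + \<kappa> / c" 0 t] iter_lyapunov[of V \<kappa>] assms c_pos
  by (simp add: mult.commute)

lemma P_eigenfunction:
  assumes V: "\<And>s. s \<in> S \<Longrightarrow> gen V s = \<kappa> * V s" and "- c \<le> \<kappa>" "s \<in> S" "0 \<le> t"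
  shows "P t V s = exp (\<kappa> * t) * V s"
proof (rule antisym)
  show "P t V s \<le> exp (\<kappa> * t) * V s"
    using assms by (intro P_lyapunov) auto
  have "gen (\<lambda>s. - 1 * V s) s = - 1 * gen V s" for s
    unfolding jump_gen_def sum_distrib_left by (simp add: algebra_simps)
  then have "P t (\<lambda>s. - 1 * V s) s \<le> exp (\<kappa> * t) * (- 1 * V s)"
    using assms by (intro P_lyapunov) auto
  then show "exp (\<kappa> * t) * V s \<le> P t V s"
    unfolding P_scale[OF assms(3)] by simp
qed

end

section \<open>The ergodic component as an exclusion process\<close>

definition ssep_states :: "nat \<Rightarrow> nat \<Rightarrow> nat set set" where
  "ssep_states n m = {S. S \<subseteq> {1..n} \<and> card S = m}"

abbreviation transp :: "nat \<Rightarrow> nat \<Rightarrow> nat" where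
  "transp i \<equiv> Transposition.transpose i (Suc i)"

text \<open>The symmetric exclusion process in its stirring form: the contents of two neighbouring sites are
exchanged. Exchanges that change nothing are included, which makes every \<open>swap_at i\<close> a bijection of
the state space, so the uniform distribution is invariant (\<open>ssep_gen_invariant\<close>).\<close>

definition swap_at :: "nat \<Rightarrow> nat set \<Rightarrow> nat set" where
  "swap_at i S = transp i ` S"

lemma finite_ssep_states: "finite (ssep_states n m)"
  by (rule finite_subset[of _ "Pow {1..n}"]) (auto simp: ssep_states_def)

lemma swap_at_states:
  assumes "i \<in> {1..<n}" "S \<in> ssep_states n m"
  shows "swap_at i S \<in> ssep_states n m"
proof -
  have "card (swap_at i S) = card S"
    unfolding swap_at_def by (intro card_image inj_on_subset[OF inj_transpose]) auto
  moreover have "swap_at i S \<subseteq> {1..n}"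
    using assms by (auto simp: swap_at_def ssep_states_def Transposition.transpose_def)
  ultimately show ?thesis using assms by (simp add: ssep_states_def)
qed

lemma bij_swap_at:
  assumes "i \<in> {1..<n}"
  shows "bij_betw (swap_at i) (ssep_states n m) (ssep_states n m)"
proof (rule bij_betw_byWitness[where f' = "swap_at i"])
  show "\<forall>S\<in>ssep_states n m. swap_at i (swap_at i S) = S"
    by (simp add: swap_at_def image_image)
  show "\<forall>S\<in>ssep_states n m. swap_at i (swap_at i S) = S"
    by (simp add: swap_at_def image_image)
qed (use swap_at_states[OF assms] in auto)

lemma mem_swap_at: "x \<in> swap_at i S \<longleftrightarrow> transp i x \<in> S"
  unfolding swap_at_def by (metis image_iff transpose_involutory)

lemma swap_at_id: "(i \<in> S \<longleftrightarrow> Suc i \<in> S) \<Longrightarrow> swap_at i S = S"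
  by (auto simp: set_eq_iff mem_swap_at Transposition.transpose_def)

lemma swap_at_out: "i \<in> S \<Longrightarrow> Suc i \<notin> S \<Longrightarrow> swap_at i S = insert (Suc i) (S - {i})"
  by (auto simp: set_eq_iff mem_swap_at Transposition.transpose_def)

lemma swap_at_in: "i \<notin> S \<Longrightarrow> Suc i \<in> S \<Longrightarrow> swap_at i S = insert i (S - {Suc i})"
  by (auto simp: set_eq_iff mem_swap_at Transposition.transpose_def)

definition ssep_gen :: "nat \<Rightarrow> (nat set \<Rightarrow> real) \<Rightarrow> nat set \<Rightarrow> real" where
  "ssep_gen n = jump_gen {1..<n} (\<lambda>_ _. 1/2) swap_at"

lemma ssep_gen_sum: "ssep_gen n u S = (\<Sum>i\<in>{1..<n}. 1/2 * (u (swap_at i S) - u S))"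
  by (simp add: ssep_gen_def jump_gen_def)

lemma ssep_gen_invariant: "(\<Sum>S\<in>ssep_states n m. ssep_gen n u S) = 0"
proof -
  have "(\<Sum>S\<in>ssep_states n m. u (swap_at i S)) = (\<Sum>S\<in>ssep_states n m. u S)" if "i \<in> {1..<n}" for i
    using sum.reindex_bij_betw[OF bij_swap_at[OF that], of u m] by simp
  then show ?thesis
    unfolding ssep_gen_sum
    by (subst sum.swap) (simp add: sum_subtractf flip: sum_divide_distrib)
qed

lemma jump_chain_ssep:
  assumes "n \<le> N" "0 < N"
  shows "jump_chain (ssep_states n m) {1..<n} (\<lambda>_ _. 1/2) swap_at (real N)"
  using assms by unfold_locales (auto simp: finite_ssep_states swap_at_states)

text \<open>An ergodic configuration has particles at both ends, and the distance of consecutive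
particles is \<open>1\<close> or \<open>2\<close>. Let \<open>S\<close> be the set of those \<open>i\<close> for which particle \<open>i\<close> is
at distance \<open>2\<close> from particle \<open>i - 1\<close>, where particles are numbered from \<open>0\<close>. Then particle \<open>i\<close>
sits at the following site.\<close>

definition site :: "nat set \<Rightarrow> nat \<Rightarrow> nat" where
  "site S i = Suc (i + card (S \<inter> {1..i}))"

lemma site_0 [simp]: "site S 0 = 1"
  by (simp add: site_def)

lemma site_Suc: "site S (Suc i) = site S i + (if Suc i \<in> S then 2 else 1)"
proof -
  have "S \<inter> {1..Suc i} = (if Suc i \<in> S then insert (Suc i) (S \<inter> {1..i}) else S \<inter> {1..i})"
    by (auto simp: atLeastAtMostSuc_conv)
  then show ?thesis by (simp add: site_def)
qed

lemma site_strict_mono: "strict_mono (site S)"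
  by (rule strict_monoI_Suc) (simp add: site_Suc)

lemma site_less_iff [simp]: "site S i < site S j \<longleftrightarrow> i < j"
  using site_strict_mono by (simp add: strict_mono_less)

lemma site_le_iff [simp]: "site S i \<le> site S j \<longleftrightarrow> i \<le> j"
  using site_strict_mono by (simp add: strict_mono_less_eq)

lemma site_eq_iff [simp]: "site S i = site S j \<longleftrightarrow> i = j"
  using site_strict_mono by (simp add: strict_mono_eq)

lemma site_last: "S \<in> ssep_states n m \<Longrightarrow> site S n = Suc (n + m)"
  by (auto simp: site_def ssep_states_def Int_absorb2)

definition decode :: "nat \<Rightarrow> nat \<Rightarrow> nat set \<Rightarrow> config" where
  "decode n m S = (\<lambda>x\<in>{1..Suc (n + m)}. if x \<in> site S ` {0..n} then 1 else 0)"

lemma site_range: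
  assumes "S \<in> ssep_states n m" "i \<le> n"
  shows "1 \<le> site S i" "site S i \<le> Suc (n + m)"
proof -
  show "1 \<le> site S i" by (simp add: site_def)
  show "site S i \<le> Suc (n + m)"
    using assms(2) by (simp flip: site_last[OF assms(1)])
qed

lemma site_no_gap: "1 \<le> x \<Longrightarrow> x < site S i \<Longrightarrow> x \<in> site S ` {0..i} \<or> Suc x \<in> site S ` {0..i}"
proof (induction i)
  case (Suc i)
  have "x < site S i \<or> x = site S i \<or> Suc x = site S (Suc i)"
    using Suc.prems unfolding site_Suc by (cases "Suc i \<in> S") (simp_all, linarith+)
  then consider "x < site S i" | "x = site S i" | "Suc x = site S (Suc i)" by blast
  then show ?case
    using Suc.IH Suc.prems(1) by cases (simp_all add: atLeast0_atMost_Suc, blast)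
qed simp

lemma decode_ergodic:
  assumes S: "S \<in> ssep_states n m"
  shows "decode n m S \<in> ergodic_component (Suc (n + m)) (Suc n)"
proof -
  let ?N = "Suc (n + m)"
  have r: "site S ` {0..n} \<subseteq> {1..?N}"
    using site_range[OF S] by auto
  have "(\<Sum>x=1..?N. decode n m S x) = (\<Sum>x=1..?N. if x \<in> site S ` {0..n} then 1 else 0)"
    by (intro sum.cong) (auto simp: decode_def)
  also have "\<dots> = card ({1..?N} \<inter> site S ` {0..n})"
    by (subst sum.inter_restrict[symmetric]) auto
  also have "\<dots> = card (site S ` {0..n})"
    using r by (simp add: Int_absorb1)
  also have "\<dots> = Suc n"
    by (subst card_image) (auto simp: inj_on_def)
  finally have sum: "(\<Sum>x=1..?N. decode n m S x) = Suc n" .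
  have "decode n m S \<in> {1..?N} \<rightarrow>\<^sub>E {0, 1}"
    by (auto simp: decode_def)
  then have O: "decode n m S \<in> Omega ?N (Suc n)"
    using sum by (simp add: Omega_def)
  have "1 \<in> site S ` {0..n}"
    by (rule image_eqI[of _ _ 0]) auto
  moreover have "?N \<in> site S ` {0..n}"
    by (rule image_eqI[of _ _ n]) (auto simp: site_last[OF S])
  ultimately have ends: "decode n m S 1 * decode n m S ?N = 1"
    by (simp add: decode_def)
  have "decode n m S x + decode n m S (x + 1) \<ge> 1" if "x \<in> {1..?N - 1}" for x
    using that site_no_gap[of x S n] site_last[OF S] by (auto simp: decode_def)
  then show ?thesis
    using O ends by (simp add: ergodic_component_def)
qed

lemma site_next:
  assumes "i < n"
  shows "site S i + 1 \<in> site S ` {0..n} \<longleftrightarrow> Suc i \<notin> S"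
proof (cases "Suc i \<in> S")
  case True
  have "site S l \<noteq> site S i + 1" for l
  proof
    assume "site S l = site S i + 1"
    then have "site S i < site S l" "site S l < site S (Suc i)"
      using True by (auto simp: site_Suc)
    then show False by simp
  qed
  then show ?thesis using True by force
next
  case False
  then have "site S i + 1 = site S (Suc i)" by (simp add: site_Suc)
  moreover have "Suc i \<in> {0..n}" using assms by auto
  ultimately show ?thesis using False by blast
qed

text \<open>The inner particle \<open>i\<close> sees a particle on its left iff the distance to particle \<open>i - 1\<close> is \<open>1\<close>, and
likewise on its right; so it can jump iff exactly one of \<open>i\<close>, \<open>i + 1\<close> is in \<open>S\<close>.\<close>

lemma decode_at_site:
  assumes S: "S \<in> ssep_states n m" and i: "i \<in> {1..<n}"
  shows "decode n m S (site S i) = 1"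
    "decode n m S (site S i - 1) = of_bool (i \<notin> S)"
    "decode n m S (site S i + 1) = of_bool (Suc i \<notin> S)"
    "2 \<le> site S i" "site S i \<le> n + m"
proof -
  obtain j where j: "i = Suc j" using i by (cases i) auto
  have p1: "site S j \<ge> 1" "site S (Suc i) \<le> Suc (n + m)"
    using site_range[OF S, of j] site_range[OF S, of "Suc i"] i j by auto
  have si: "site S i = site S j + (if i \<in> S then 2 else 1)"
    using site_Suc[of S j] j by simp
  have ss: "site S (Suc i) = site S i + (if Suc i \<in> S then 2 else 1)"
    by (rule site_Suc)
  show "2 \<le> site S i" "site S i \<le> n + m"
    using p1 si ss by (auto split: if_splits)
  then show "decode n m S (site S i) = 1"
    using i by (auto simp: decode_def)
  have "site S i - 1 \<in> site S ` {0..n} \<longleftrightarrow> i \<notin> S"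
  proof (cases "i \<in> S")
    case True
    then show ?thesis using site_next[of j n S] si i j by simp
  next
    case False
    then have "site S i - 1 = site S j" using si by simp
    moreover have "j \<in> {0..n}" using i j by auto
    ultimately show ?thesis using False by blast
  qed
  then show "decode n m S (site S i - 1) = of_bool (i \<notin> S)"
    using \<open>2 \<le> site S i\<close> \<open>site S i \<le> n + m\<close> by (auto simp: decode_def)
  have "site S i + 1 \<in> site S ` {0..n} \<longleftrightarrow> Suc i \<notin> S"
    using i by (intro site_next) auto
  then show "decode n m S (site S i + 1) = of_bool (Suc i \<notin> S)"
    using \<open>site S i \<le> n + m\<close> by (auto simp: decode_def)
qed

text \<open>Exchanging the distances before and after particle \<open>i\<close> moves this particle only.\<close>

lemma site_swap_at:
  assumes "i \<ge> 1"
  shows "i \<in> S \<Longrightarrow> Suc i \<notin> S \<Longrightarrow> site (swap_at i S) j = (if j = i then site S i - 1 else site S j)"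
    and "i \<notin> S \<Longrightarrow> Suc i \<in> S \<Longrightarrow> site (swap_at i S) j = (if j = i then site S i + 1 else site S j)"
proof -
  assume a: "i \<in> S" "Suc i \<notin> S"
  have s: "j \<in> swap_at i S \<longleftrightarrow> j \<noteq> i \<and> (j = Suc i \<or> j \<in> S)" for j
    using a by (auto simp: swap_at_out)
  show "site (swap_at i S) j = (if j = i then site S i - 1 else site S j)"
  proof (induction j)
    case (Suc j)
    have "1 \<le> site S j" by (simp add: site_def)
    then show ?case unfolding site_Suc Suc s using a assms site_Suc[of S j] by auto
  qed (use assms in simp)
next
  assume a: "i \<notin> S" "Suc i \<in> S"
  have s: "j \<in> swap_at i S \<longleftrightarrow> j \<noteq> Suc i \<and> (j = i \<or> j \<in> S)" for j
    using a by (auto simp: swap_at_in)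
  show "site (swap_at i S) j = (if j = i then site S i + 1 else site S j)"
  proof (induction j)
    case (Suc j)
    have "1 \<le> site S j" by (simp add: site_def)
    then show ?case unfolding site_Suc Suc s using a assms site_Suc[of S j] by auto
  qed (use assms in simp)
qed

lemma decode_swap_at_aux:
  assumes S: "S \<in> ssep_states n m" and i: "i \<in> {1..<n}"
    and q: "q \<notin> site S ` {0..n}" "q \<in> {1..Suc (n + m)}"
    and pq: "\<And>j. site (swap_at i S) j = (if j = i then q else site S j)"
  shows "decode n m (swap_at i S) = exchange (decode n m S) (site S i) q"
proof -
  have im: "x \<in> site (swap_at i S) ` {0..n} \<longleftrightarrow> x = q \<or> (x \<noteq> site S i \<and> x \<in> site S ` {0..n})" for x
    using i unfolding image_iff pq by (auto; force)
  have neq: "q \<noteq> site S i" using q i by force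
  have "site S i \<in> site S ` {0..n}" "site S i \<in> {1..Suc (n + m)}"
    using i site_range[OF S, of i] by auto
  then show ?thesis
    using q neq unfolding decode_def im exchange_def fun_eq_iff by auto
qed

lemma decode_swap_at:
  assumes S: "S \<in> ssep_states n m" and i: "i \<in> {1..<n}"
  shows "i \<in> S \<Longrightarrow> Suc i \<notin> S \<Longrightarrow> decode n m (swap_at i S) = exchange (decode n m S) (site S i) (site S i - 1)"
    and "i \<notin> S \<Longrightarrow> Suc i \<in> S \<Longrightarrow> decode n m (swap_at i S) = exchange (decode n m S) (site S i) (site S i + 1)"
proof -
  note p = decode_at_site[OF S i]
  assume a: "i \<in> S" "Suc i \<notin> S"
  have "site S i - 1 \<notin> site S ` {0..n}"
    using p(2,4,5) a by (auto simp: decode_def split: if_splits)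
  then show "decode n m (swap_at i S) = exchange (decode n m S) (site S i) (site S i - 1)"
    using p i a by (intro decode_swap_at_aux S site_swap_at) auto
next
  note p = decode_at_site[OF S i]
  assume a: "i \<notin> S" "Suc i \<in> S"
  have "site S i + 1 \<notin> site S ` {0..n}"
    using p(3,4,5) a by (auto simp: decode_def split: if_splits)
  then show "decode n m (swap_at i S) = exchange (decode n m S) (site S i) (site S i + 1)"
    using p i a by (intro decode_swap_at_aux S site_swap_at) auto
qed

text \<open>The two end particles never move. For the particle \<open>i\<close> between them, the possible jump of the FEP
is the exchange of its two distances, at the same rate \<open>1/2\<close>.\<close>

lemma fep_generator_decode:
  assumes S: "S \<in> ssep_states n m"
  shows "fep_generator (1/2) (Suc (n + m)) f (decode n m S) = ssep_gen n (\<lambda>S. f (decode n m S)) S"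
proof -
  let ?N = "Suc (n + m)" and ?\<xi> = "decode n m S"
  let ?t = "\<lambda>x. 1/2 * real (?\<xi> x) * real (?\<xi> (x - 1)) * (1 - real (?\<xi> (x + 1))) * (f (exchange ?\<xi> x (x + 1)) - f ?\<xi>)
       + 1/2 * real (?\<xi> x) * real (?\<xi> (x + 1)) * (1 - real (?\<xi> (x - 1))) * (f (exchange ?\<xi> x (x - 1)) - f ?\<xi>)"
  have sub: "site S ` {1..<n} \<subseteq> {2..?N - 1}"
    using decode_at_site(4,5)[OF S] by auto
  have zero: "?t x = 0" if "x \<in> {2..?N - 1} - site S ` {1..<n}" for x
  proof -
    have "x \<notin> site S ` {0..n}"
    proof
      assume "x \<in> site S ` {0..n}"
      then obtain i where i: "x = site S i" "i \<le> n" by auto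
      moreover have "i \<noteq> 0" "i \<noteq> n"
        using i that site_last[OF S] by (auto intro: gr0I)
      ultimately show False using that by auto
    qed
    then have "?\<xi> x = 0" using that by (auto simp: decode_def)
    then show ?thesis by simp
  qed
  have "fep_generator (1/2) ?N f ?\<xi> = (\<Sum>x=2..?N - 1. ?t x)"
    by (simp add: fep_generator_def sum.distrib)
  also have "\<dots> = (\<Sum>x\<in>site S ` {1..<n}. ?t x)"
    using sub zero by (intro sum.mono_neutral_right) auto
  also have "\<dots> = (\<Sum>i\<in>{1..<n}. ?t (site S i))"
    by (subst sum.reindex) (auto simp: inj_on_def)
  also have "\<dots> = (\<Sum>i\<in>{1..<n}. 1/2 * (f (decode n m (swap_at i S)) - f ?\<xi>))"
  proof (rule sum.cong)
    fix i assume i: "i \<in> {1..<n}"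
    note p = decode_at_site[OF S i]
    consider "i \<in> S \<longleftrightarrow> Suc i \<in> S" | "i \<in> S" "Suc i \<notin> S" | "i \<notin> S" "Suc i \<in> S" by blast
    then show "?t (site S i) = 1/2 * (f (decode n m (swap_at i S)) - f ?\<xi>)"
    proof cases
      case 1
      then show ?thesis unfolding p by (simp add: swap_at_id)
    next
      case 2
      then show ?thesis unfolding p decode_swap_at(1)[OF S i 2] by simp
    next
      case 3
      then show ?thesis unfolding p decode_swap_at(2)[OF S i 3] by simp
    qed
  qed simp
  finally show ?thesis by (simp add: ssep_gen_sum)
qed

lemma sorted_list_of_strict_mono:
  fixes e :: "nat \<Rightarrow> nat"
  assumes "strict_mono e"
  shows "sorted_list_of_set (e ` {0..n}) = map e [0..<Suc n]"
proof -
  have "sorted_wrt (<) (map e [0..<Suc n])"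
    using assms by (auto simp: sorted_wrt_iff_nth_less strict_mono_def nth_append)
  moreover have "set (map e [0..<Suc n]) = e ` {0..n}"
    by (simp only: set_map set_upt atLeastLessThanSuc_atLeastAtMost)
  ultimately show ?thesis
    using sorted_list_of_set_unique[of "e ` {0..n}" "map e [0..<Suc n]"]
    by (metis finite_atLeastAtMost finite_imageI sorted_list_of_set.set_sorted_key_list_of_set
        strict_sorted_equal strict_sorted_list_of_set)
qed

lemma decode_inj: "inj_on (decode n m) (ssep_states n m)"
proof (rule inj_onI)
  fix S S' assume S: "S \<in> ssep_states n m" and S': "S' \<in> ssep_states n m"
    and eq: "decode n m S = decode n m S'"
  have r: "site U ` {0..n} = {x \<in> {1..Suc (n + m)}. decode n m U x = 1}" if "U \<in> ssep_states n m" for U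
    using site_range[OF that] by (auto simp: decode_def)
  have "map (site S) [0..<Suc n] = map (site S') [0..<Suc n]"
    using r[OF S] r[OF S'] eq by (simp only: flip: sorted_list_of_strict_mono[OF site_strict_mono])
  then have p: "site S i = site S' i" if "i \<le> n" for i
    using that by (auto simp: map_eq_conv simp del: upt_Suc)
  have "i \<in> S \<longleftrightarrow> i \<in> S'" if i: "i \<in> {1..n}" for i
  proof -
    obtain j where "i = Suc j" using i by (cases i) auto
    then show ?thesis
      using site_Suc[of S j] site_Suc[of S' j] p[of i] p[of j] i by (auto split: if_splits)
  qed
  then show "S = S'"
    using S S' unfolding ssep_states_def by blast
qed

text \<open>The increasing enumeration \<open>e\<close> of the occupied sites starts at \<open>1\<close>, ends at the last site, and has
increments \<open>1\<close> or \<open>2\<close> since two neighbouring sites are never both empty. The set \<open>S\<close> of the indices with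
increment \<open>2\<close> has \<open>site S = e\<close>.\<close>

lemma decode_surj:
  assumes \<xi>: "\<xi> \<in> ergodic_component (Suc (n + m)) (Suc n)"
  shows "\<exists>S\<in>ssep_states n m. decode n m S = \<xi>"
proof -
  let ?N = "Suc (n + m)"
  define Q where "Q = {x \<in> {1..?N}. \<xi> x = 1}"
  define e where "e = (\<lambda>i. sorted_list_of_set Q ! i)"
  have \<xi>E: "\<xi> \<in> {1..?N} \<rightarrow>\<^sub>E {0, 1}" and \<xi>s: "(\<Sum>x=1..?N. \<xi> x) = Suc n"
    and adj: "\<And>x. x \<in> {1..?N-1} \<Longrightarrow> \<xi> x + \<xi> (x + 1) \<ge> 1" and ends: "\<xi> 1 * \<xi> ?N = 1"
    using \<xi> by (auto simp: ergodic_component_def Omega_def)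
  have fin: "finite Q" by (simp add: Q_def)
  have v: "\<xi> x = of_bool (x \<in> Q)" if "x \<in> {1..?N}" for x
    using that PiE_mem[OF \<xi>E that] by (auto simp: Q_def)
  have "(\<Sum>x=1..?N. \<xi> x) = (\<Sum>x=1..?N. if x \<in> Q then 1 else 0)"
    using v by (intro sum.cong) auto
  also have "\<dots> = card ({1..?N} \<inter> Q)"
    by (subst sum.inter_restrict[symmetric]) auto
  also have "{1..?N} \<inter> Q = Q" by (auto simp: Q_def)
 finally have card: "card Q = Suc n" using \<xi>s by simp
  have len: "length (sorted_list_of_set Q) = Suc n" using card by simp
  have eQ: "e i \<in> Q" if "i \<le> n" for i
    using nth_mem[of i "sorted_list_of_set Q"] len that fin by (simp add: e_def)
  have ex: "\<exists>i\<le>n. e i = x" if "x \<in> Q" for x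
    using that fin len by (metis e_def in_set_conv_nth less_Suc_eq_le set_sorted_list_of_set)
  have mono: "e i < e j" if "i < j" "j \<le> n" for i j
    using that len sorted_wrt_nth_less[OF strict_sorted_list_of_set[of Q], of i j] by (simp add: e_def)
  have mono': "e i \<le> e j \<Longrightarrow> i \<le> j" if "i \<le> n" "j \<le> n" for i j
    using mono[of j i] that by linarith
  have le: "e i \<le> e j" if "i \<le> j" "j \<le> n" for i j
    using mono[of i j] that by (cases "i = j") auto
  have "1 \<in> Q" "?N \<in> Q"
    using ends v[of 1] v[of ?N] by (cases "1 \<in> Q"; cases "?N \<in> Q"; simp)+
  obtain i0 i1 where i01: "i0 \<le> n" "e i0 = 1" "i1 \<le> n" "e i1 = ?N"
    using ex \<open>1 \<in> Q\<close> \<open>?N \<in> Q\<close> by blast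
  have e0: "e 0 = 1" and en: "e n = ?N"
    using le[of 0 i0] le[of i1 n] eQ[of 0] eQ[of n] i01 by (auto simp: Q_def)
  have gap: "e (Suc i) = e i + 1 \<or> e (Suc i) = e i + 2" if "i < n" for i
  proof (rule ccontr)
    assume c: "\<not> ?thesis"
    moreover have "e i < e (Suc i)" using mono[of i "Suc i"] that by simp
    ultimately have big: "e (Suc i) > e i + 2" by auto
    have no: "x \<notin> Q" if "e i < x" "x < e (Suc i)" for x
    proof
      assume "x \<in> Q"
      then obtain j where j: "j \<le> n" "e j = x" using ex by blast
      then have "i < j" "j < Suc i"
        using that le[of j i] le[of "Suc i" j] \<open>i < n\<close> by (meson leD leI less_imp_le_nat)+
      then show False by simp
    qed
    have "e i + 1 \<in> {1..?N - 1}"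
      using big eQ[of "Suc i"] that by (auto simp: Q_def)
    then show False
      using adj[of "e i + 1"] v[of "e i + 1"] v[of "e i + 2"] no[of "e i + 1"] no[of "e i + 2"] big by auto
  qed
  define S where "S = {i \<in> {1..n}. e i = e (i - 1) + 2}"
  have pe: "i \<le> n \<Longrightarrow> site S i = e i" for i
  proof (induction i)
    case (Suc i)
    then show ?case using gap[of i] by (auto simp: site_Suc S_def)
  qed (simp add: e0)
  have "S \<inter> {1..n} = S" by (auto simp: S_def)
  then have "card S = m"
    using pe[of n] en by (simp add: site_def)
  then have "S \<in> ssep_states n m"
    by (auto simp: ssep_states_def S_def)
  moreover have "decode n m S = \<xi>"
  proof -
    have "site S ` {0..n} = e ` {0..n}" using pe by auto
    also have "\<dots> = Q" using ex eQ by fastforce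
    finally show ?thesis
      using v \<xi>E by (auto simp: decode_def fun_eq_iff PiE_def extensional_def)
  qed
  ultimately show ?thesis by blast
qed

lemma decode_bij: "bij_betw (decode n m) (ssep_states n m) (ergodic_component (Suc (n + m)) (Suc n))"
  using decode_inj decode_surj decode_ergodic unfolding bij_betw_def by blast

section \<open>Mixing of the exclusion process\<close>

text \<open>A parabola that increases from \<open>1\<close> at \<open>d = 0\<close> to \<open>2\<close> at \<open>d = M\<close>, with constant second difference
\<open>- 2 / M\<^sup>2\<close>. As a cost of the distance \<open>d\<close> of two walkers that meet it is used with cost \<open>0\<close> at
distance \<open>0\<close>; thanks to the jump from \<open>0\<close> to \<open>1\<close> it bounds the indicator that they have not
met, up to a factor \<open>2\<close> independent of \<open>M\<close>.\<close>

definition profile :: "real \<Rightarrow> real \<Rightarrow> real" where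
  "profile M d = 1 + 2 * d / M - (d / M)\<^sup>2"

lemma profile_bounds:
  assumes "0 \<le> d" "d \<le> M" "0 < M"
  shows "1 \<le> profile M d" "profile M d \<le> 2"
proof -
  have e: "profile M d = 1 + (d / M) * (2 - d / M)" "profile M d = 2 - (1 - d / M)\<^sup>2"
    by (simp_all add: profile_def power2_eq_square algebra_simps)
  have "0 \<le> d / M" "d / M \<le> 1" using assms by auto
  then have "0 \<le> (d / M) * (2 - d / M)" by (intro mult_nonneg_nonneg) auto
  then show "1 \<le> profile M d" using e(1) by linarith
  show "profile M d \<le> 2" using e(2) by simp
qed

lemma profile_increment:
  "M \<noteq> 0 \<Longrightarrow> profile M (d + h) - profile M d = h * (2 * M - 2 * d - h) / M\<^sup>2"
  by (simp add: profile_def power2_eq_square field_simps)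

lemma profile_mono:
  assumes "d \<le> e" "e \<le> M" "0 < M"
  shows "profile M d \<le> profile M e"
proof -
  have "0 \<le> (e - d) * (2 * M - 2 * d - (e - d)) / M\<^sup>2"
    using assms by (intro divide_nonneg_nonneg mult_nonneg_nonneg) auto
  then have "profile M d \<le> profile M (d + (e - d))"
    using profile_increment[of M d "e - d"] assms(3) by (simp del: add_diff_cancel add_diff_cancel_left' diff_add_cancel)
  then show ?thesis by simp
qed

lemma profile_second_difference:
  "M \<noteq> 0 \<Longrightarrow> profile M (d + 1) + profile M (d - 1) - 2 * profile M d = - 2 / M\<^sup>2"
  by (simp add: profile_def power2_eq_square field_simps)

text \<open>Two discrepancies at \<open>a < b\<close> are moved by stirring. Only the bonds adjacent to \<open>a\<close> or \<open>b\<close> change their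
distance. If \<open>b > a + 1\<close>, it goes up and down by one at the same rate, up to the moves that are
missing at the ends of the segment and would increase it. If \<open>b = a + 1\<close>, the bond between them is
removed from the sum and replaced by coalescence at twice the rate of a single bond; since
\<open>profile n 0 > 0\<close>, this is better than a move to distance \<open>0\<close> at that cost. In both cases the drift
is at most twice the second difference of the profile.\<close>

lemma ssep_pair_drift:
  fixes a b n :: nat
  assumes ab: "1 \<le> a" "a < b" "b \<le> n"
  defines "d \<equiv> real (b - a)"
  defines "J \<equiv> {1..<n} - (if b = Suc a then {a} else {})"
  defines "\<delta> \<equiv> \<lambda>i. real (transp i b - transp i a)"
  shows "(\<Sum>i\<in>J. profile n (\<delta> i) - profile n d) - (if b = Suc a then 2 * profile n d else 0)
           \<le> - 4 / (real n)\<^sup>2"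
proof -
  define p where "p = profile n (d + 1) - profile n d"
  define q where "q = profile n (d - 1) - profile n d"
  have n: "0 < real n" using ab by simp
  have d: "d = real b - real a" "1 \<le> d" "d \<le> real n - 1"
    using ab by (auto simp: d_def of_nat_diff)
  note \<delta> = \<delta>_def d(1) Transposition.transpose_def of_nat_diff
  have p0: "0 \<le> p"
    using profile_mono[of d "d + 1" n] d n by (simp add: p_def)
  have pq: "p + q = - 2 / (real n)\<^sup>2"
    using profile_second_difference[of n d] n by (simp add: p_def q_def)
  have p_sum: "(\<Sum>i\<in>J. if i = x then p else 0) \<le> p" for x
    using p0 by (simp add: J_def)
  show ?thesis
  proof (cases "b = Suc a")
    case False
    then have d2: "2 \<le> b - a" using ab by simp
    have J: "J = {1..<n}" using False by (simp add: J_def)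
    have "profile n (\<delta> i) - profile n d
        = (if i = a - 1 then p else 0) + (if i = b then p else 0) + (if i = a then q else 0) + (if i = b - 1 then q else 0)"
      if "i \<in> J" for i
    proof -
      consider "Suc i = a" | "i = a" | "Suc i = b" | "i = b" | "i \<notin> {a, b}" "Suc i \<notin> {a, b}" by auto
      then show ?thesis
      proof cases
        case 1
        then have "\<delta> i = d + 1" using d2 by (auto simp: \<delta>)
        then show ?thesis using 1 d2 by (auto simp: p_def)
      next
        case 2
        then have "\<delta> i = d - 1" using d2 by (auto simp: \<delta>)
        then show ?thesis using 2 d2 ab by (auto simp: q_def)
      next
        case 3
        then have "\<delta> i = d - 1" using d2 by (auto simp: \<delta>)
        then show ?thesis using 3 d2 ab by (auto simp: q_def)
      next
        case 4
        then have "\<delta> i = d + 1" using d2 by (auto simp: \<delta>)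
        then show ?thesis using 4 d2 ab by (auto simp: p_def)
      next
        case 5
        then have "\<delta> i = d" by (auto simp: \<delta>_def d_def Transposition.transpose_def)
        then show ?thesis using 5 d2 ab by auto
      qed
    qed
    then have "(\<Sum>i\<in>J. profile n (\<delta> i) - profile n d)
        = (\<Sum>i\<in>J. if i = a - 1 then p else 0) + (\<Sum>i\<in>J. if i = b then p else 0)
          + (\<Sum>i\<in>J. if i = a then q else 0) + (\<Sum>i\<in>J. if i = b - 1 then q else 0)"
      by (subst sum.distrib[symmetric])+ (rule sum.cong[OF refl])
    also have "\<dots> \<le> p + p + q + q"
    proof -
      have "a \<in> J" "b - 1 \<in> J" using ab d2 by (auto simp: J)
      moreover have "finite J" by (simp add: J)
      ultimately have "(\<Sum>i\<in>J. if i = a then q else 0) = q" "(\<Sum>i\<in>J. if i = b - 1 then q else 0) = q"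
        by simp_all
      then show ?thesis using p_sum[of "a - 1"] p_sum[of b] by linarith
    qed
    finally show ?thesis
      using pq False by simp
  next
    case True
    have d1: "d = 1" using True by (simp add: d_def)
    have "profile n (\<delta> i) - profile n d = (if i = a - 1 then p else 0) + (if i = b then p else 0)"
      if "i \<in> J" for i
    proof -
      have "i \<noteq> a" using that True by (simp add: J_def)
      then consider "Suc i = a" | "i = b" | "i \<notin> {a, b}" "Suc i \<notin> {a, b}" using True by auto
      then show ?thesis
      proof cases
        case 1
        then have "\<delta> i = d + 1" using True by (auto simp: \<delta>)
        then show ?thesis using 1 True by (auto simp: p_def)
      next
        case 2
        then have "\<delta> i = d + 1" using True by (auto simp: \<delta>)
        then show ?thesis using 2 True ab by (auto simp: p_def)
      next
        case 3
        then have "\<delta> i = d" by (auto simp: \<delta>_def d_def Transposition.transpose_def)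
        then show ?thesis using 3 True ab by auto
      qed
    qed
    then have "(\<Sum>i\<in>J. profile n (\<delta> i) - profile n d)
        = (\<Sum>i\<in>J. if i = a - 1 then p else 0) + (\<Sum>i\<in>J. if i = b then p else 0)"
      by (subst sum.distrib[symmetric])+ (rule sum.cong[OF refl])
    also have "\<dots> \<le> p + p"
      using p_sum[of "a - 1"] p_sum[of b] by simp
    finally have "(\<Sum>i\<in>J. profile n (\<delta> i) - profile n d) \<le> 2 * p" by simp
    moreover have "q = 1 - profile n d"
      using d1 by (simp add: q_def) (simp add: profile_def)
    ultimately show ?thesis
      using pq True by simp
  qed
qed

locale ssep_chain =
  fixes n m N :: nat
  assumes n_pos: "1 \<le> n" and n_le: "n \<le> N"

sublocale ssep_chain \<subseteq> jump_chain "ssep_states n m" "{1..<n}" "\<lambda>_ _. 1/2" swap_at "real N"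
  using n_pos n_le by (intro jump_chain_ssep) auto

context ssep_chain
begin

abbreviation X :: "nat set set" where "X \<equiv> ssep_states n m"

lemma step_ssep: "step u S = u S + (\<Sum>i\<in>{1..<n}. u (swap_at i S) - u S) / (2 * real N)"
  unfolding step_def jump_gen_def by (simp flip: sum_divide_distrib)

text \<open>Path coupling. Apply \<open>step\<close> to both configurations and compare bond by bond: the difference for the
exchange of bond \<open>i\<close> is again the difference between two configurations with one discrepancy pair,
at the transposed positions. The exception is the bond between adjacent discrepancies, whose
exchange interchanges the two configurations; it enters with a minus sign and so cancels
part of the undisturbed difference. It remains to insert the drift of the profile.\<close>

lemma iter_exchange:
  assumes osc: "\<And>S S'. S \<in> X \<Longrightarrow> S' \<in> X \<Longrightarrow> \<bar>u S - u S'\<bar> \<le> 1"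
    and "1 \<le> a" "a < b" "b \<le> n" "a \<notin> Z" "b \<notin> Z" "insert a Z \<in> X" "insert b Z \<in> X"
  shows "\<bar>(step ^^ j) u (insert a Z) - (step ^^ j) u (insert b Z)\<bar>
           \<le> (1 - 1 / ((real n)\<^sup>2 * real N)) ^ j * profile n (real (b - a))"
  using assms(2-)
proof (induction j arbitrary: a b Z)
  case 0
  have "1 \<le> profile n (real (b - a))"
    using 0 n_pos by (intro profile_bounds) auto
  then show ?case using osc[of "insert a Z" "insert b Z"] 0 by simp
next
  case (Suc j)
  note ab = Suc.prems
  let ?\<rho> = "1 - 1 / ((real n)\<^sup>2 * real N)"
  let ?A = "insert a Z" and ?B = "insert b Z"
  define v where "v = (step ^^ j) u"
  define R where "R = ?\<rho> ^ j"
  define d where "d = real (b - a)"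
  define w where "w = 1 / (2 * real N)"
  define D where "D = v ?A - v ?B"
  define E where "E = (\<lambda>i. v (swap_at i ?A) - v (swap_at i ?B))"
  define J where "J = {1..<n} - (if b = Suc a then {a} else {})"
  define \<kappa> where "\<kappa> = 1 - w * (real n - 1) - (if b = Suc a then w else 0)"
  let ?\<delta> = "\<lambda>i. real (transp i b - transp i a)"
  have Np: "0 < real N" "1 \<le> real n" "real n \<le> real N" using n_pos n_le by auto
  have w: "0 < w" "w * real n \<le> 1" using Np by (auto simp: w_def field_simps)
  \<comment> \<open>there are at most \<open>n - 1\<close> bonds, so one more unit of rate is left for the minus sign\<close>
  have \<kappa>0: "0 \<le> \<kappa>"
    using w by (simp add: \<kappa>_def algebra_simps)
  have nn: "1 \<le> (real n)\<^sup>2 * real N"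
  proof -
    have "1 * 1 \<le> (real n)\<^sup>2 * real N"
      using Np by (intro mult_mono one_le_power) auto
    then show ?thesis by simp
  qed
  have \<rho>0: "0 \<le> ?\<rho>" using nn by simp
  have R0: "0 \<le> R" using \<rho>0 by (simp add: R_def)
  have D: "\<bar>D\<bar> \<le> R * profile n d"
    using Suc.IH[OF ab] by (simp add: D_def R_def d_def v_def)
  have E: "\<bar>E i\<bar> \<le> R * profile n (?\<delta> i)" if "i \<in> J" for i
  proof -
    have i: "i \<in> {1..<n}" "\<not> (i = a \<and> b = Suc a)"
      using that by (auto simp: J_def split: if_splits)
    have im: "swap_at i ?A = insert (transp i a) (swap_at i Z)" "swap_at i ?B = insert (transp i b) (swap_at i Z)"
      by (auto simp: swap_at_def)
    show ?thesis
      unfolding E_def im v_def R_def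
    proof (rule Suc.IH)
      show "transp i a \<notin> swap_at i Z" "transp i b \<notin> swap_at i Z"
        using ab by (auto simp: mem_swap_at)
      show "insert (transp i a) (swap_at i Z) \<in> X" "insert (transp i b) (swap_at i Z) \<in> X"
        using swap_at_states[OF i(1)] ab unfolding im[symmetric] by auto
    qed (use ab i in \<open>auto simp: Transposition.transpose_def\<close>)
  qed
  \<comment> \<open>exchanging the contents of the bond turns each of the two configurations into the other\<close>
  have adj: "E a = - D" if "b = Suc a"
  proof -
    have "swap_at a ?A = ?B" "swap_at a ?B = ?A"
      using ab that by (auto simp: swap_at_out swap_at_in)
    then show ?thesis by (simp add: E_def D_def)
  qed
  have "(step ^^ Suc j) u ?A - (step ^^ Suc j) u ?B = D + w * (\<Sum>i\<in>{1..<n}. E i - D)"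
  proof -
    have e: "(step ^^ Suc j) u X = v X + w * (\<Sum>i\<in>{1..<n}. v (swap_at i X) - v X)" for X
      by (simp only: funpow.simps o_apply v_def step_ssep w_def) simp
    have "(\<Sum>i\<in>{1..<n}. E i - D) = (\<Sum>i\<in>{1..<n}. v (swap_at i ?A) - v ?A) - (\<Sum>i\<in>{1..<n}. v (swap_at i ?B) - v ?B)"
      by (simp only: sum_subtractf[symmetric] E_def D_def) (simp add: algebra_simps)
    then show ?thesis by (simp only: e right_diff_distrib) (simp add: D_def)
  qed
  also have "(\<Sum>i\<in>{1..<n}. E i - D) = (\<Sum>i\<in>J. E i) - (real n - 1) * D - (if b = Suc a then D else 0)"
  proof -
    have "(\<Sum>i\<in>{1..<n}. E i) = (\<Sum>i\<in>J. E i) - (if b = Suc a then D else 0)"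
      using ab adj by (auto simp: J_def sum_diff1)
    then show ?thesis using n_pos by (simp add: sum_subtractf of_nat_diff)
  qed
  also have "D + w * \<dots> = \<kappa> * D + w * (\<Sum>i\<in>J. E i)"
    by (simp add: \<kappa>_def algebra_simps)
  finally have "\<bar>(step ^^ Suc j) u ?A - (step ^^ Suc j) u ?B\<bar> = \<bar>\<kappa> * D + w * (\<Sum>i\<in>J. E i)\<bar>" by simp
  also have "\<dots> \<le> \<kappa> * \<bar>D\<bar> + w * (\<Sum>i\<in>J. \<bar>E i\<bar>)"
  proof -
    have "\<bar>\<kappa> * D + w * (\<Sum>i\<in>J. E i)\<bar> \<le> \<bar>\<kappa> * D\<bar> + \<bar>w * (\<Sum>i\<in>J. E i)\<bar>"
      by (rule abs_triangle_ineq)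
    also have "\<dots> = \<kappa> * \<bar>D\<bar> + w * \<bar>\<Sum>i\<in>J. E i\<bar>"
      using \<kappa>0 w by (simp add: abs_mult)
    also have "\<dots> \<le> \<kappa> * \<bar>D\<bar> + w * (\<Sum>i\<in>J. \<bar>E i\<bar>)"
      using w by (intro add_left_mono mult_left_mono sum_abs) auto
    finally show ?thesis .
  qed
  also have "\<dots> \<le> \<kappa> * (R * profile n d) + w * (\<Sum>i\<in>J. R * profile n (?\<delta> i))"
    using \<kappa>0 w D E by (intro add_mono mult_left_mono sum_mono) auto
  also have "\<dots> = R * (profile n d + w * ((\<Sum>i\<in>J. profile n (?\<delta> i) - profile n d) - (if b = Suc a then 2 * profile n d else 0)))"
  proof -
    have "real (card J) = real n - 1 - (if b = Suc a then 1 else 0)"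
      using ab n_pos by (auto simp: J_def of_nat_diff)
    then have "(\<Sum>i\<in>J. profile n (?\<delta> i) - profile n d)
       = (\<Sum>i\<in>J. profile n (?\<delta> i)) - (real n - 1 - (if b = Suc a then 1 else 0)) * profile n d"
      by (simp add: sum_subtractf)
    then show ?thesis
      by (simp only: sum_distrib_left[symmetric]) (simp add: \<kappa>_def algebra_simps)
  qed
  also have "\<dots> \<le> R * (profile n d + w * (- 4 / (real n)\<^sup>2))"
    using ssep_pair_drift[OF ab(1-3)] R0 w
    by (intro mult_left_mono add_left_mono) (auto simp: J_def d_def)
  also have "\<dots> \<le> R * (?\<rho> * profile n d)"
  proof -
    have "profile n d \<le> 2"
      using ab n_pos by (intro profile_bounds) (auto simp: d_def)
    then have "profile n d / ((real n)\<^sup>2 * real N) \<le> 2 / ((real n)\<^sup>2 * real N)"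
      by (intro divide_right_mono) auto
    moreover have "w * (- 4 / (real n)\<^sup>2) = - 2 / ((real n)\<^sup>2 * real N)"
      by (simp add: w_def)
    ultimately have "profile n d + w * (- 4 / (real n)\<^sup>2) \<le> ?\<rho> * profile n d"
      by (simp add: algebra_simps)
    then show ?thesis using R0 by (intro mult_left_mono)
  qed
  finally show ?case by (simp add: R_def d_def mult_ac)
qed

text \<open>Two sets of the same size are joined by a path of \<open>card (S - S')\<close> exchanges of one element.\<close>

lemma exchange_path:
  assumes ex: "\<And>Z a b. 1 \<le> a \<Longrightarrow> a < b \<Longrightarrow> b \<le> n \<Longrightarrow> a \<notin> Z \<Longrightarrow> b \<notin> Z \<Longrightarrow>
      insert a Z \<in> X \<Longrightarrow> insert b Z \<in> X \<Longrightarrow>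
      \<bar>v (insert a Z) - v (insert b Z)\<bar> \<le> K"
    and S: "S \<in> X" and S': "S' \<in> X"
  shows "\<bar>v S - v S'\<bar> \<le> real (card (S - S')) * K"
  using S
proof (induction "card (S - S')" arbitrary: S)
  case 0
  have fin: "finite S" "finite S'"
    using 0 S' finite_subset[of _ "{1..n}"] by (auto simp: ssep_states_def)
  then have "S \<subseteq> S'" using 0 by auto
  then have "S = S'" using fin 0 S' by (intro card_subset_eq) (auto simp: ssep_states_def)
  then show ?case by simp
next
  case (Suc l)
  have fin: "finite S" "finite S'" and c: "card S = m" "card S' = m" and sub: "S \<subseteq> {1..n}" "S' \<subseteq> {1..n}"
    using Suc.prems S' finite_subset[of _ "{1..n}"] by (auto simp: ssep_states_def)
  obtain a where a: "a \<in> S" "a \<notin> S'"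
  proof -
    have "card (S - S') > 0" using Suc.hyps(2) by linarith
    then have "S - S' \<noteq> {}" by (auto simp only: card.empty)
    then show ?thesis using that by blast
  qed
  have "\<not> S' \<subseteq> S"
    using card_subset_eq[of S S'] fin c a by auto
  then obtain b where b: "b \<in> S'" "b \<notin> S" by auto
  define Z where "Z = S - {a}"
  have SZ: "insert a Z = S" using a by (auto simp: Z_def)
  have Z: "a \<notin> Z" "b \<notin> Z" using b by (auto simp: Z_def)
  have in2: "insert b Z \<in> X"
  proof -
    have "card (insert b Z) = Suc (card Z)" using b fin by (simp add: Z_def)
    also have "\<dots> = card S" using a fin card_Suc_Diff1[of S a] by (simp add: Z_def)
    finally show ?thesis using sub b c by (auto simp: ssep_states_def Z_def)
  qed
  have "insert b Z - S' = S - S' - {a}" using a b by (auto simp: Z_def)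
  then have l: "l = card (insert b Z - S')"
    using Suc.hyps(2) a fin by simp
  have range: "1 \<le> a" "a \<le> n" "1 \<le> b" "b \<le> n" "a \<noteq> b" using a b sub by auto
  have "\<bar>v (insert a Z) - v (insert b Z)\<bar> \<le> K"
  proof (cases "a < b")
    case True
    then show ?thesis using range in2 Suc.prems SZ Z by (intro ex) simp_all
  next
    case False
    then have "\<bar>v (insert b Z) - v (insert a Z)\<bar> \<le> K"
      using range in2 Suc.prems SZ Z by (intro ex) simp_all
    then show ?thesis by linarith
  qed
  moreover have "\<bar>v (insert b Z) - v S'\<bar> \<le> real l * K"
    using Suc.hyps(1)[OF l in2] l by simp
  ultimately show ?case
    unfolding SZ Suc.hyps(2)[symmetric] by (simp add: algebra_simps)
qed

lemma iter_osc:
  assumes osc: "\<And>S S'. S \<in> X \<Longrightarrow> S' \<in> X \<Longrightarrow> \<bar>u S - u S'\<bar> \<le> 1"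
    and S: "S \<in> X" and S': "S' \<in> X"
  shows "\<bar>(step ^^ j) u S - (step ^^ j) u S'\<bar> \<le> 2 * real m * (1 - 1 / ((real n)\<^sup>2 * real N)) ^ j"
proof -
  let ?\<rho> = "1 - 1 / ((real n)\<^sup>2 * real N)"
  have "1 * 1 \<le> (real n)\<^sup>2 * real N"
    using n_pos n_le by (intro mult_mono one_le_power) auto
  then have \<rho>: "0 \<le> ?\<rho>" by simp
  have "\<bar>(step ^^ j) u S - (step ^^ j) u S'\<bar> \<le> real (card (S - S')) * (2 * ?\<rho> ^ j)"
  proof (rule exchange_path[OF _ S S'])
    fix Z a b
    assume ab: "1 \<le> a" "a < b" "b \<le> n" "a \<notin> Z" "b \<notin> Z" "insert a Z \<in> X" "insert b Z \<in> X"
    have "\<bar>(step ^^ j) u (insert a Z) - (step ^^ j) u (insert b Z)\<bar> \<le> ?\<rho> ^ j * profile n (real (b - a))"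
      by (rule iter_exchange[OF osc ab])
    also have "\<dots> \<le> ?\<rho> ^ j * 2"
      using ab \<rho> n_pos by (intro mult_left_mono profile_bounds) auto
    finally show "\<bar>(step ^^ j) u (insert a Z) - (step ^^ j) u (insert b Z)\<bar> \<le> 2 * ?\<rho> ^ j" by simp
  qed
  also have "\<dots> \<le> real m * (2 * ?\<rho> ^ j)"
  proof -
    have "card (S - S') \<le> card S"
      using S finite_subset[of S "{1..n}"] by (intro card_mono) (auto simp: ssep_states_def)
    then have "card (S - S') \<le> m" using S by (simp add: ssep_states_def)
    then show ?thesis using \<rho> by (intro mult_right_mono) auto
  qed
  finally show ?thesis by simp
qed

lemma sum_iter: "(\<Sum>S\<in>X. (step ^^ j) u S) = (\<Sum>S\<in>X. u S)"
proof (induction j)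
  case (Suc j)
  have "(\<Sum>S\<in>X. step ((step ^^ j) u) S)
    = (\<Sum>S\<in>X. (step ^^ j) u S) + (\<Sum>S\<in>X. ssep_gen n ((step ^^ j) u) S) / real N"
    unfolding step_def ssep_gen_def by (simp add: sum.distrib sum_divide_distrib)
  then show ?case using Suc by (simp add: ssep_gen_invariant)
qed simp

text \<open>The mean over the state space is invariant under \<open>step\<close>, so the oscillation of the iterates bounds their distance
from it.\<close>

lemma iter_mixing:
  assumes osc: "\<And>S S'. S \<in> X \<Longrightarrow> S' \<in> X \<Longrightarrow> \<bar>u S - u S'\<bar> \<le> 1"
    and S: "S \<in> X"
  shows "\<bar>(step ^^ j) u S - (\<Sum>S\<in>X. u S) / card (X)\<bar>
            \<le> 2 * real m * (1 - 1 / ((real n)\<^sup>2 * real N)) ^ j"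
proof -
  let ?b = "2 * real m * (1 - 1 / ((real n)\<^sup>2 * real N)) ^ j"
  have c: "0 < real (card X)" using S finite_ssep_states[of n m] by (auto simp: card_gt_0_iff)
  have "card X * \<bar>(step ^^ j) u S - (\<Sum>S\<in>X. u S) / card X\<bar>
     = \<bar>card X * (step ^^ j) u S - (\<Sum>S\<in>X. (step ^^ j) u S)\<bar>"
  proof -
    have "\<bar>card X * (step ^^ j) u S - (\<Sum>S\<in>X. (step ^^ j) u S)\<bar> = \<bar>card X * ((step ^^ j) u S - (\<Sum>S\<in>X. u S) / card X)\<bar>"
      using c by (simp only: sum_iter) (simp add: algebra_simps)
    then show ?thesis by (simp add: abs_mult)
  qed
  also have "\<dots> = \<bar>\<Sum>S'\<in>X. (step ^^ j) u S - (step ^^ j) u S'\<bar>"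
    by (simp add: sum_subtractf)
  also have "\<dots> \<le> (\<Sum>S'\<in>X. ?b)"
    using iter_osc[OF osc S] by (intro order_trans[OF sum_abs] sum_mono) auto
  also have "\<dots> = card X * ?b" by simp
  finally show ?thesis using c by simp
qed

end

section \<open>Occupied and empty bonds\<close>

definition fep_moves :: "nat \<Rightarrow> (nat + nat) set" where
  "fep_moves N = {2..N-1} <+> {2..N-1}"

definition fep_rate :: "nat + nat \<Rightarrow> config \<Rightarrow> real" where
  "fep_rate i \<xi> = (case i of
      Inl x \<Rightarrow> 1/2 * real (\<xi> x) * real (\<xi> (x - 1)) * (1 - real (\<xi> (x + 1)))
    | Inr x \<Rightarrow> 1/2 * real (\<xi> x) * real (\<xi> (x + 1)) * (1 - real (\<xi> (x - 1))))"

definition fep_move :: "nat + nat \<Rightarrow> config \<Rightarrow> config" where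
  "fep_move i \<xi> = (case i of Inl x \<Rightarrow> exchange \<xi> x (x + 1) | Inr x \<Rightarrow> exchange \<xi> x (x - 1))"

lemma fep_generator_jump_gen: "fep_generator (1/2) N = jump_gen (fep_moves N) fep_rate fep_move"
  by (simp add: fun_eq_iff fep_generator_def jump_gen_def fep_moves_def sum.Plus fep_rate_def fep_move_def)

lemma Omega_values: "\<xi> \<in> Omega N k \<Longrightarrow> x \<in> {1..N} \<Longrightarrow> \<xi> x = 0 \<or> \<xi> x = 1"
  by (auto simp: Omega_def PiE_def Pi_def)

lemma Omega_neighbours:
  assumes "\<xi> \<in> Omega N k" "x \<in> {2..N-1}"
  shows "\<xi> x = 0 \<or> \<xi> x = 1" "\<xi> (x - 1) = 0 \<or> \<xi> (x - 1) = 1" "\<xi> (x + 1) = 0 \<or> \<xi> (x + 1) = 1"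
proof -
  have m: "x \<in> {1..N}" "x - 1 \<in> {1..N}" "x + 1 \<in> {1..N}" using assms(2) by auto
  show "\<xi> x = 0 \<or> \<xi> x = 1" "\<xi> (x - 1) = 0 \<or> \<xi> (x - 1) = 1" "\<xi> (x + 1) = 0 \<or> \<xi> (x + 1) = 1"
    by (rule Omega_values[OF assms(1) m(1)] Omega_values[OF assms(1) m(2)] Omega_values[OF assms(1) m(3)])+
qed

lemma finite_Omega: "finite (Omega N k)"
  by (rule finite_subset[of _ "{1..N} \<rightarrow>\<^sub>E {0, 1}"]) (auto simp: Omega_def intro: finite_PiE)

lemma exchange_Omega:
  assumes "\<xi> \<in> Omega N k" "x \<in> {1..N}" "y \<in> {1..N}"
  shows "exchange \<xi> x y \<in> Omega N k"
proof -
  have e: "exchange \<xi> x y = \<xi> \<circ> Transposition.transpose x y"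
    by (auto simp: exchange_def fun_eq_iff Transposition.transpose_def)
  have "(\<Sum>z=1..N. exchange \<xi> x y z) = (\<Sum>z=1..N. \<xi> z)"
    unfolding e using sum.permute[OF permutes_swap_id[OF assms(2,3)], of \<xi>] by simp
  moreover have "exchange \<xi> x y \<in> {1..N} \<rightarrow>\<^sub>E {0, 1}"
    using assms by (auto simp: exchange_def Omega_def PiE_def Pi_def extensional_def)
  ultimately show ?thesis using assms(1) by (simp add: Omega_def)
qed

lemma jump_chain_fep:
  assumes "1 \<le> N"
  shows "jump_chain (Omega N k) (fep_moves N) fep_rate fep_move (real N)"
proof
  show "finite (Omega N k)" by (rule finite_Omega)
  show "finite (fep_moves N)" by (simp add: fep_moves_def)
  show "0 < real N" using assms by simp
  fix \<xi> assume \<xi>: "\<xi> \<in> Omega N k"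
  have r: "0 \<le> fep_rate i \<xi> \<and> fep_rate i \<xi> \<le> 1/2" if i: "i \<in> fep_moves N" for i
  proof -
    obtain x where x: "x \<in> {2..N-1}" and ix: "i = Inl x \<or> i = Inr x"
      using i by (auto simp: fep_moves_def)
    show ?thesis
      using Omega_neighbours(1)[OF \<xi> x] Omega_neighbours(2)[OF \<xi> x] Omega_neighbours(3)[OF \<xi> x] ix
      unfolding fep_rate_def by (elim disjE) simp_all
  qed
  show "0 \<le> fep_rate i \<xi>" if "i \<in> fep_moves N" for i
    using r that by blast
  have "(\<Sum>i\<in>fep_moves N. fep_rate i \<xi>) \<le> (\<Sum>i\<in>fep_moves N. 1/2)"
    using r by (intro sum_mono) blast
  also have "\<dots> \<le> real N"
    by (simp add: fep_moves_def card_Plus)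
  finally show "(\<Sum>i\<in>fep_moves N. fep_rate i \<xi>) \<le> real N" .
  show "fep_move i \<xi> \<in> Omega N k" if i: "i \<in> fep_moves N" for i
  proof -
    obtain x where x: "x \<in> {1..N}" "x - 1 \<in> {1..N}" "x + 1 \<in> {1..N}" and ix: "i = Inl x \<or> i = Inr x"
      using i by (force simp: fep_moves_def)
    then show ?thesis
      by (auto simp only: fep_move_def sum.case intro!: exchange_Omega \<xi>)
  qed
qed

text \<open>Occupation number, extended by holes at \<open>0\<close> and beyond \<open>N\<close>. With this convention a hole at one
of the ends of the segment is part of a trap, just as two neighbouring holes are. The bond
\<open>x\<close> joins the sites \<open>x\<close> and \<open>x + 1\<close>.\<close>

definition occ :: "nat \<Rightarrow> config \<Rightarrow> nat \<Rightarrow> real" where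
  "occ N \<xi> x = (if x \<in> {1..N} then real (\<xi> x) else 0)"

definition full :: "nat \<Rightarrow> config \<Rightarrow> nat \<Rightarrow> real" where
  "full N \<xi> x = occ N \<xi> x * occ N \<xi> (x + 1)"

definition trap :: "nat \<Rightarrow> config \<Rightarrow> nat \<Rightarrow> real" where
  "trap N \<xi> x = (1 - occ N \<xi> x) * (1 - occ N \<xi> (x + 1))"

lemma occ_cases: "\<xi> \<in> Omega N k \<Longrightarrow> occ N \<xi> x = 0 \<or> occ N \<xi> x = 1"
  using Omega_values[of \<xi> N k x] by (auto simp: occ_def)

lemma full_cases: "\<xi> \<in> Omega N k \<Longrightarrow> full N \<xi> x = 0 \<or> full N \<xi> x = 1"
  using occ_cases[of \<xi> N k x] occ_cases[of \<xi> N k "x + 1"] by (auto simp: full_def)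

lemma trap_cases: "\<xi> \<in> Omega N k \<Longrightarrow> trap N \<xi> x = 0 \<or> trap N \<xi> x = 1"
  using occ_cases[of \<xi> N k x] occ_cases[of \<xi> N k "x + 1"] by (auto simp: trap_def)

lemma full_ends [simp]: "full N \<xi> 0 = 0" "full N \<xi> N = 0"
  by (simp_all add: full_def occ_def)

lemma sum_occ:
  assumes "\<xi> \<in> Omega N k"
  shows "(\<Sum>x\<le>N. occ N \<xi> x) = real k" "(\<Sum>x\<le>N. occ N \<xi> (x + 1)) = real k"
proof -
  have "(\<Sum>x\<le>N. occ N \<xi> x) = (\<Sum>x\<in>{1..N}. real (\<xi> x))"
    by (intro sum.mono_neutral_cong_right) (auto simp: occ_def)
  moreover have "(\<Sum>x\<le>N. occ N \<xi> (x + 1)) = (\<Sum>x\<le>Suc N. occ N \<xi> x)"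
    by (subst sum.atMost_Suc_shift) (simp add: occ_def)
  moreover have "occ N \<xi> (Suc N) = 0" by (simp add: occ_def)
  moreover have "(\<Sum>x\<in>{1..N}. real (\<xi> x)) = real k"
    using assms by (simp add: Omega_def flip: of_nat_sum)
  ultimately show "(\<Sum>x\<le>N. occ N \<xi> x) = real k" "(\<Sum>x\<le>N. occ N \<xi> (x + 1)) = real k"
    by simp_all
qed

text \<open>For occupation numbers \<open>o\<close> and \<open>o'\<close> we have \<open>o o' - (1 - o) (1 - o') = o + o' - 1\<close>, and the right-hand
side sums to a constant.\<close>

lemma sum_full_minus_trap:
  assumes "\<xi> \<in> Omega N k"
  shows "(\<Sum>x\<le>N. full N \<xi> x) - (\<Sum>x\<le>N. trap N \<xi> x) = 2 * real k - real N - 1"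
proof -
  have "(\<Sum>x\<le>N. full N \<xi> x) - (\<Sum>x\<le>N. trap N \<xi> x) = (\<Sum>x\<le>N. occ N \<xi> x + occ N \<xi> (x + 1) - 1)"
    by (subst sum_subtractf[symmetric], intro sum.cong refl) (simp add: full_def trap_def algebra_simps)
  then show ?thesis
    using sum_occ[OF assms] by (simp add: sum_subtractf sum.distrib)
qed

lemma sum_trap_le:
  assumes "\<xi> \<in> Omega N k"
  shows "(\<Sum>x\<le>N. trap N \<xi> x) \<le> real N + 1 - real k"
proof -
  have "trap N \<xi> x \<le> 1 - occ N \<xi> x" for x
    using occ_cases[OF assms, of x] occ_cases[OF assms, of "x + 1"] by (auto simp: trap_def)
  then have "(\<Sum>x\<le>N. trap N \<xi> x) \<le> (\<Sum>x\<le>N. 1 - occ N \<xi> x)" by (intro sum_mono)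
  then show ?thesis using sum_occ[OF assms] by (simp add: sum_subtractf)
qed

lemma ergodic_iff_no_trap:
  assumes \<xi>: "\<xi> \<in> Omega N k" and N: "1 \<le> N"
  shows "\<xi> \<in> ergodic_component N k \<longleftrightarrow> (\<forall>x\<le>N. trap N \<xi> x = 0)"
proof
  assume E: "\<xi> \<in> ergodic_component N k"
  show "\<forall>x\<le>N. trap N \<xi> x = 0"
  proof (intro allI impI)
    fix x assume "x \<le> N"
    then have "x = 0 \<or> x = N \<or> x \<in> {1..N-1}" by auto
    then consider "x = 0" | "x = N" | "x \<in> {1..N-1}" by blast
    then show "trap N \<xi> x = 0"
    proof cases
      case 3
      then have "1 \<le> \<xi> x + \<xi> (x + 1)" using E by (auto simp: ergodic_component_def)
      moreover have m: "x \<in> {1..N}" "x + 1 \<in> {1..N}" using 3 by auto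
      ultimately show ?thesis using Omega_values[OF \<xi> m(1)] Omega_values[OF \<xi> m(2)]
        unfolding trap_def occ_def by auto
    next
      case 1
      have "\<xi> 1 = 1" using E by (simp add: ergodic_component_def)
      then show ?thesis using 1 N by (simp add: trap_def occ_def)
    next
      case 2
      have "\<xi> N = 1" using E by (simp add: ergodic_component_def)
      then show ?thesis using 2 N by (simp add: trap_def occ_def)
    qed
  qed
next
  assume h: "\<forall>x\<le>N. trap N \<xi> x = 0"
  have "\<xi> x + \<xi> (x + 1) \<ge> 1" if "x \<in> {1..N-1}" for x
  proof (rule ccontr)
    assume "\<not> ?thesis"
    then have "\<xi> x = 0" "\<xi> (x + 1) = 0" by auto
    then have "trap N \<xi> x = 1" using that by (auto simp: trap_def occ_def)
    then show False using h that by auto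
  qed
  moreover have "\<xi> 1 = 1" "\<xi> N = 1"
    using h[rule_format, of 0] h[rule_format, of N] N by (simp_all add: trap_def occ_def)
  ultimately show "\<xi> \<in> ergodic_component N k"
    using \<xi> by (simp add: ergodic_component_def)
qed

definition right_jump :: "nat \<Rightarrow> config \<Rightarrow> nat \<Rightarrow> bool" where
  "right_jump N \<xi> x \<longleftrightarrow> x \<in> {2..N-1} \<and> \<xi> x = 1 \<and> \<xi> (x - 1) = 1 \<and> \<xi> (x + 1) = 0"

definition left_jump :: "nat \<Rightarrow> config \<Rightarrow> nat \<Rightarrow> bool" where
  "left_jump N \<xi> x \<longleftrightarrow> x \<in> {2..N-1} \<and> \<xi> x = 1 \<and> \<xi> (x + 1) = 1 \<and> \<xi> (x - 1) = 0"

lemma right_jumpD: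
  assumes "right_jump N \<xi> x"
  shows "x \<in> {2..N-1}" "\<xi> x = 1" "\<xi> (x - 1) = 1" "\<xi> (x + 1) = 0"
  using assms by (auto simp: right_jump_def)

lemma left_jumpD:
  assumes "left_jump N \<xi> x"
  shows "x \<in> {2..N-1}" "\<xi> x = 1" "\<xi> (x + 1) = 1" "\<xi> (x - 1) = 0"
  using assms by (auto simp: left_jump_def)

lemma jump_Omega:
  assumes "\<xi> \<in> Omega N k"
  shows "right_jump N \<xi> x \<Longrightarrow> exchange \<xi> x (x + 1) \<in> Omega N k"
    and "left_jump N \<xi> x \<Longrightarrow> exchange \<xi> x (x - 1) \<in> Omega N k"
  using assms by (auto simp: right_jump_def left_jump_def intro!: exchange_Omega)

text \<open>The full bond \<open>x - 1\<close> disappears. The bond \<open>x + 1\<close> becomes full if site \<open>x + 2\<close> is occupied;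
otherwise it was a trap and ceases to be one.\<close>

lemma right_move_effect:
  assumes jump: "right_jump N \<xi> x"
  shows "full N (exchange \<xi> x (x + 1)) y = full N \<xi> y - of_bool (y = x - 1) + occ N \<xi> (x + 2) * of_bool (y = x + 1)"
    and "trap N (exchange \<xi> x (x + 1)) y = trap N \<xi> y - (1 - occ N \<xi> (x + 2)) * of_bool (y = x + 1)"
proof -
  note x = right_jumpD(1)[OF jump] and v = right_jumpD(2-4)[OF jump]
  have o: "occ N (exchange \<xi> x (x + 1)) z = (if z = x then 0 else if z = x + 1 then 1 else occ N \<xi> z)" for z
    using x v by (auto simp: occ_def exchange_def)
  have o3: "occ N \<xi> x = 1" "occ N \<xi> (x - 1) = 1" "occ N \<xi> (x + 1) = 0"
    using x v by (auto simp: occ_def)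
  obtain w where w: "x = Suc w" using x by (cases x) auto
  have o4: "occ N \<xi> w = 1" "occ N \<xi> (Suc w) = 1" "occ N \<xi> (Suc (Suc w)) = 0" using o3 by (simp_all add: w)
  consider "y = w" | "y = Suc w" | "y = Suc (Suc w)" | "y \<noteq> w" "y \<noteq> Suc w" "y \<noteq> Suc (Suc w)" by blast
  then show "full N (exchange \<xi> x (x + 1)) y = full N \<xi> y - of_bool (y = x - 1) + occ N \<xi> (x + 2) * of_bool (y = x + 1)"
    "trap N (exchange \<xi> x (x + 1)) y = trap N \<xi> y - (1 - occ N \<xi> (x + 2)) * of_bool (y = x + 1)"
    unfolding full_def trap_def o unfolding w by (cases; simp add: o4)+
qed

lemma left_move_effect:
  assumes jump: "left_jump N \<xi> x"
  shows "full N (exchange \<xi> x (x - 1)) y = full N \<xi> y - of_bool (y = x) + occ N \<xi> (x - 2) * of_bool (y = x - 2)"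
    and "trap N (exchange \<xi> x (x - 1)) y = trap N \<xi> y - (1 - occ N \<xi> (x - 2)) * of_bool (y = x - 2)"
proof -
  note x = left_jumpD(1)[OF jump] and v = left_jumpD(2-4)[OF jump]
  have o: "occ N (exchange \<xi> x (x - 1)) z = (if z = x then 0 else if z = x - 1 then 1 else occ N \<xi> z)" for z
    using x v by (auto simp: occ_def exchange_def)
  have o3: "occ N \<xi> x = 1" "occ N \<xi> (x - 1) = 0" "occ N \<xi> (x + 1) = 1"
    using x v by (auto simp: occ_def)
  obtain w where w: "x = Suc (Suc w)" using x by (cases x; cases "x - 1") auto
  have o4: "occ N \<xi> (Suc w) = 0" "occ N \<xi> (Suc (Suc w)) = 1" "occ N \<xi> (Suc (Suc (Suc w))) = 1" using o3 by (simp_all add: w)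
  consider "y = w" | "y = Suc w" | "y = Suc (Suc w)" | "y \<noteq> w" "y \<noteq> Suc w" "y \<noteq> Suc (Suc w)" by blast
  then show "full N (exchange \<xi> x (x - 1)) y = full N \<xi> y - of_bool (y = x) + occ N \<xi> (x - 2) * of_bool (y = x - 2)"
    "trap N (exchange \<xi> x (x - 1)) y = trap N \<xi> y - (1 - occ N \<xi> (x - 2)) * of_bool (y = x - 2)"
    unfolding full_def trap_def o unfolding w by (cases; simp add: o4)+
qed

lemma trap_move_le:
  assumes \<xi>: "\<xi> \<in> Omega N k"
  shows "right_jump N \<xi> x \<Longrightarrow> trap N (exchange \<xi> x (x + 1)) j \<le> trap N \<xi> j"
    and "left_jump N \<xi> x \<Longrightarrow> trap N (exchange \<xi> x (x - 1)) j \<le> trap N \<xi> j"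
proof -
  assume jump: "right_jump N \<xi> x"
  note x = right_jumpD(1)[OF jump] and v = right_jumpD(2-4)[OF jump]
  have "occ N \<xi> (x + 2) \<le> 1" using occ_cases[OF \<xi>, of "x + 2"] by auto
  then show "trap N (exchange \<xi> x (x + 1)) j \<le> trap N \<xi> j"
    unfolding right_move_effect(2)[OF jump] by simp
next
  assume jump: "left_jump N \<xi> x"
  note x = left_jumpD(1)[OF jump] and v = left_jumpD(2-4)[OF jump]
  have "occ N \<xi> (x - 2) \<le> 1" using occ_cases[OF \<xi>, of "x - 2"] by auto
  then show "trap N (exchange \<xi> x (x - 1)) j \<le> trap N \<xi> j"
    unfolding left_move_effect(2)[OF jump] by simp
qed

definition pair_sum :: "nat \<Rightarrow> (int \<Rightarrow> real) \<Rightarrow> config \<Rightarrow> real" where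
  "pair_sum N \<phi> \<xi> = (\<Sum>a\<le>N. full N \<xi> a * \<phi> (int a))"

lemma sum_of_bool_eq: "finite A \<Longrightarrow> a \<in> A \<Longrightarrow> (\<Sum>y\<in>A. f y * (c * of_bool (y = a))) = f a * (c::real)"
  by (subst sum.remove[of A a]) auto

lemma pair_sum_right_move:
  assumes jump: "right_jump N \<xi> x"
  shows "pair_sum N \<phi> (exchange \<xi> x (x + 1))
     = pair_sum N \<phi> \<xi> - \<phi> (int x - 1) + occ N \<xi> (x + 2) * \<phi> (int x + 1)"
proof -
  note x = right_jumpD(1)[OF jump] and v = right_jumpD(2-4)[OF jump]
  have "pair_sum N \<phi> (exchange \<xi> x (x + 1)) = pair_sum N \<phi> \<xi> - (\<Sum>y\<le>N. \<phi> (int y) * (1 * of_bool (y = x - 1)))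
     + (\<Sum>y\<le>N. \<phi> (int y) * (occ N \<xi> (x + 2) * of_bool (y = x + 1)))"
    unfolding pair_sum_def right_move_effect[OF jump]
    by (simp add: algebra_simps sum.distrib sum_subtractf)
  then show ?thesis
    using x by (subst (asm) (1 2) sum_of_bool_eq) (auto simp: of_nat_diff add.commute)
qed

lemma pair_sum_left_move:
  assumes jump: "left_jump N \<xi> x"
  shows "pair_sum N \<phi> (exchange \<xi> x (x - 1))
     = pair_sum N \<phi> \<xi> - \<phi> (int x) + occ N \<xi> (x - 2) * \<phi> (int x - 2)"
proof -
  note x = left_jumpD(1)[OF jump] and v = left_jumpD(2-4)[OF jump]
  have "pair_sum N \<phi> (exchange \<xi> x (x - 1)) = pair_sum N \<phi> \<xi> - (\<Sum>y\<le>N. \<phi> (int y) * (1 * of_bool (y = x)))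
     + (\<Sum>y\<le>N. \<phi> (int y) * (occ N \<xi> (x - 2) * of_bool (y = x - 2)))"
    unfolding pair_sum_def left_move_effect[OF jump]
    by (simp add: algebra_simps sum.distrib sum_subtractf)
  then show ?thesis
    using x by (subst (asm) (1 2) sum_of_bool_eq) (auto simp: of_nat_diff)
qed

text \<open>With \<open>\<alpha>\<close> the indicator of the full bonds, \<open>right_rate \<alpha> x\<close> indicates that \<open>x - 1\<close> is the last bond of a run of full bonds,
which is the situation in which the particle at \<open>x\<close> jumps to the right. Similarly,
\<open>left_rate \<alpha> x\<close> indicates that \<open>x\<close> is the first bond of a run.\<close>

definition right_rate :: "(nat \<Rightarrow> real) \<Rightarrow> nat \<Rightarrow> real" where
  "right_rate \<alpha> x = \<alpha> (x - 1) * (1 - \<alpha> x)"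

definition left_rate :: "(nat \<Rightarrow> real) \<Rightarrow> nat \<Rightarrow> real" where
  "left_rate \<alpha> x = \<alpha> x * (1 - \<alpha> (x - 1))"

lemma fep_generator_le:
  assumes \<xi>: "\<xi> \<in> Omega N k"
    and R: "\<And>x. right_jump N \<xi> x \<Longrightarrow>
       G (exchange \<xi> x (x + 1)) - G \<xi> \<le> R x"
    and L: "\<And>x. left_jump N \<xi> x \<Longrightarrow>
       G (exchange \<xi> x (x - 1)) - G \<xi> \<le> L x"
  shows "fep_generator (1/2) N G \<xi>
    \<le> 1/2 * (\<Sum>x=2..N-1. right_rate (full N \<xi>) x * R x + left_rate (full N \<xi>) x * L x)"
proof -
  let ?A = "\<lambda>x. 1/2 * real (\<xi> x) * real (\<xi> (x - 1)) * (1 - real (\<xi> (x + 1))) * (G (exchange \<xi> x (x + 1)) - G \<xi>)"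
    and ?B = "\<lambda>x. 1/2 * real (\<xi> x) * real (\<xi> (x + 1)) * (1 - real (\<xi> (x - 1))) * (G (exchange \<xi> x (x - 1)) - G \<xi>)"
  have t: "?A x \<le> 1/2 * (right_rate (full N \<xi>) x * R x)" "?B x \<le> 1/2 * (left_rate (full N \<xi>) x * L x)"
    if x: "x \<in> {2..N-1}" for x
  proof -
    note Omega_neighbours[OF \<xi> x]
    moreover have "right_rate (full N \<xi>) x = real (\<xi> (x - 1)) * real (\<xi> x) * (1 - real (\<xi> x) * real (\<xi> (x + 1)))"
      "left_rate (full N \<xi>) x = real (\<xi> x) * real (\<xi> (x + 1)) * (1 - real (\<xi> (x - 1)) * real (\<xi> x))"
      using x by (auto simp: right_rate_def left_rate_def full_def occ_def)
    ultimately show "?A x \<le> 1/2 * (right_rate (full N \<xi>) x * R x)" "?B x \<le> 1/2 * (left_rate (full N \<xi>) x * L x)"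
      using R[of x] L[of x] x by (auto simp: right_jump_def left_jump_def)
  qed
  have "fep_generator (1/2) N G \<xi> \<le> (\<Sum>x=2..N-1. 1/2 * (right_rate (full N \<xi>) x * R x)) + (\<Sum>x=2..N-1. 1/2 * (left_rate (full N \<xi>) x * L x))"
    unfolding fep_generator_def using t by (intro add_mono sum_mono) auto
  then show ?thesis
    by (simp add: sum.distrib sum_distrib_left distrib_left)
qed

text \<open>Twice the contribution of the particle at \<open>x\<close> to the drift of the sum of \<open>\<phi>\<close> over the full bonds, when no
trap is hit.\<close>

definition run_drift :: "(nat \<Rightarrow> real) \<Rightarrow> (int \<Rightarrow> real) \<Rightarrow> nat \<Rightarrow> real" where
  "run_drift \<alpha> \<phi> x = right_rate \<alpha> x * (\<phi> (int x + 1) - \<phi> (int x - 1))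
     + left_rate \<alpha> x * (\<phi> (int x - 2) - \<phi> (int x))"

text \<open>Summation by parts. Put \<open>G i = \<phi> (i + 2) - \<phi> i\<close>. A run of full bonds from \<open>a\<close> to \<open>b\<close> contributes
\<open>G b - G (a - 2)\<close> to the left-hand side, and this is the sum of the increments of \<open>G\<close> over
\<open>i = a - 1, \<dots>, b\<close>, that is, over those \<open>i\<close> for which \<open>i\<close> or \<open>i + 1\<close> belongs to the run. So the drift of
a sum over the full bonds only involves second differences of \<open>\<phi>\<close>.\<close>

lemma run_sum:
  fixes \<alpha> :: "nat \<Rightarrow> real" and \<phi> :: "int \<Rightarrow> real"
  shows "(\<Sum>x=1..N. run_drift \<alpha> \<phi> x)
    = (\<Sum>i<N. (\<phi> (int i + 2) - \<phi> (int i + 1) - \<phi> (int i) + \<phi> (int i - 1)) * (\<alpha> i + \<alpha> (Suc i) - \<alpha> i * \<alpha> (Suc i)))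
      + \<alpha> 0 * (\<phi> 1 - \<phi> (-1)) - \<alpha> N * (\<phi> (int N + 1) - \<phi> (int N - 1))"
proof (induction N)
  case (Suc N)
  have a: "int (Suc N) + 1 = int N + 2" "int (Suc N) - 1 = int N" "int (Suc N) - 2 = int N - 1" "int (Suc N) = int N + 1"
    by auto
  show ?case
    unfolding sum.lessThan_Suc sum.cl_ivl_Suc using Suc unfolding a
    by (simp add: run_drift_def right_rate_def left_rate_def algebra_simps)
qed simp

text \<open>The jumps at \<open>x = 1\<close> and \<open>x = N\<close>, which would leave the segment, do not exist; they account for the
two boundary terms.\<close>

lemma run_sum_interior:
  fixes \<alpha> :: "nat \<Rightarrow> real" and \<phi> :: "int \<Rightarrow> real"
  assumes "2 \<le> N" "\<alpha> 0 = 0" "\<alpha> N = 0"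
  shows "(\<Sum>x=2..N-1. run_drift \<alpha> \<phi> x)
    = (\<Sum>i<N. (\<phi> (int i + 2) - \<phi> (int i + 1) - \<phi> (int i) + \<phi> (int i - 1)) * (\<alpha> i + \<alpha> (Suc i) - \<alpha> i * \<alpha> (Suc i)))
      - \<alpha> 1 * (\<phi> (-1) - \<phi> 1) - \<alpha> (N - 1) * (\<phi> (int N + 1) - \<phi> (int N - 1))"
proof -
  obtain M where M: "N = Suc (Suc M)" using assms(1) by (metis add_2_eq_Suc le_Suc_ex)
  have "{1..N} = insert 1 (insert N {2..N-1})" using assms(1) by auto
  then have "(\<Sum>x=1..N. run_drift \<alpha> \<phi> x)
    = \<alpha> 1 * (\<phi> (-1) - \<phi> 1) + \<alpha> (N - 1) * (\<phi> (int N + 1) - \<phi> (int N - 1)) +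
     (\<Sum>x=2..N-1. run_drift \<alpha> \<phi> x)"
    using assms M by (simp add: run_drift_def right_rate_def left_rate_def)
  then show ?thesis using run_sum[of \<alpha> \<phi> N] assms by simp
qed

section \<open>Filling the traps\<close>

text \<open>The cost of a full bond at \<open>p\<close>, seen from a trap at \<open>j\<close>. It is kinked at \<open>j\<close>, but
full bonds stay away from the kink (\<open>trap_full_apart\<close>).\<close>

definition trap_profile :: "nat \<Rightarrow> nat \<Rightarrow> int \<Rightarrow> real" where
  "trap_profile N j p = profile (real N + 1) \<bar>of_int p - real j\<bar>"

lemma trap_profile_bounds:
  assumes "j \<le> N" "a \<le> N"
  shows "1 \<le> trap_profile N j (int a)" "trap_profile N j (int a) \<le> 2"
proof -
  have "0 \<le> \<bar>real a - real j\<bar>" "\<bar>real a - real j\<bar> \<le> real N + 1"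
    using assms by auto
  from profile_bounds[OF this] show "1 \<le> trap_profile N j (int a)" "trap_profile N j (int a) \<le> 2"
    by (simp_all add: trap_profile_def)
qed

lemma trap_profile_curvature:
  assumes "int i + 2 \<le> int j \<or> int j \<le> int i - 1"
  shows "trap_profile N j (int i + 2) - trap_profile N j (int i + 1) - trap_profile N j (int i) + trap_profile N j (int i - 1)
     = - 4 / (real N + 1)\<^sup>2"
proof -
  let ?M = "real N + 1"
  have *: "profile ?M (e + 2) - profile ?M (e + 1) - profile ?M e + profile ?M (e - 1) = - 4 / ?M\<^sup>2" for e
    using profile_second_difference[of ?M e] profile_second_difference[of ?M "e + 1"]
    by (simp add: add.assoc)
  consider "real i + 2 \<le> real j" | "real j \<le> real i - 1" using assms by linarith
  then show ?thesis
  proof cases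
    case 1
    then have e: "\<bar>real_of_int (int i + 2) - real j\<bar> = (real j - real i - 1) - 1" "\<bar>real_of_int (int i + 1) - real j\<bar> = real j - real i - 1"
      "\<bar>real_of_int (int i) - real j\<bar> = (real j - real i - 1) + 1" "\<bar>real_of_int (int i - 1) - real j\<bar> = (real j - real i - 1) + 2"
      by auto
    show ?thesis using *[of "real j - real i - 1"] unfolding trap_profile_def e by linarith
  next
    case 2
    then have e: "\<bar>real_of_int (int i + 2) - real j\<bar> = (real i - real j) + 2" "\<bar>real_of_int (int i + 1) - real j\<bar> = (real i - real j) + 1"
      "\<bar>real_of_int (int i) - real j\<bar> = (real i - real j)" "\<bar>real_of_int (int i - 1) - real j\<bar> = (real i - real j) - 1"
      by auto
    show ?thesis using *[of "real i - real j"] unfolding trap_profile_def e by linarith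
  qed
qed

lemma trap_full_apart:
  assumes \<xi>: "\<xi> \<in> Omega N k" and "trap N \<xi> j = 1" "full N \<xi> i \<noteq> 0"
  shows "i + 2 \<le> j \<or> j + 2 \<le> i"
proof (rule ccontr)
  assume "\<not> ?thesis"
  then consider "i = j" | "Suc i = j" | "i = Suc j" by linarith
  moreover have "occ N \<xi> j = 0" "occ N \<xi> (Suc j) = 0"
    using assms(2) occ_cases[OF \<xi>, of j] occ_cases[OF \<xi>, of "Suc j"] by (auto simp: trap_def)
  moreover have "occ N \<xi> i \<noteq> 0" "occ N \<xi> (Suc i) \<noteq> 0"
    using assms(3) by (auto simp: full_def)
  ultimately show False by cases auto
qed

text \<open>On both sides of the trap the cost is concave with constant curvature, and each full bond \<open>i\<close>
accounts for at least one term of \<open>run_sum\<close>. The missing jumps at the ends of the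
segment would lead away from the trap, so adding them only increases the sum.\<close>

lemma trap_drift:
  assumes \<xi>: "\<xi> \<in> Omega N k" and N: "2 \<le> N" and j: "j \<le> N" "trap N \<xi> j = 1"
  defines "\<phi> \<equiv> trap_profile N j"
  shows "(\<Sum>x=2..N-1. run_drift (full N \<xi>) \<phi> x)
      \<le> - 2 / (real N + 1)\<^sup>2 * pair_sum N \<phi> \<xi>"
proof -
  let ?\<alpha> = "full N \<xi>" and ?M = "real N + 1"
  let ?g = "\<lambda>i. \<phi> (int i + 2) - \<phi> (int i + 1) - \<phi> (int i) + \<phi> (int i - 1)"
  \<comment> \<open>a full bond at 1 lies to the left of the trap, and -1 is farther from the trap than 1\<close>
  have left: "0 \<le> ?\<alpha> 1 * (\<phi> (-1) - \<phi> 1)"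
  proof (cases "?\<alpha> 1 = 0")
    case False
    then have "3 \<le> j" using trap_full_apart[OF \<xi> j(2) False] by linarith
    then have "\<bar>real_of_int 1 - real j\<bar> = real j - 1" "\<bar>real_of_int (-1) - real j\<bar> = real j + 1" by auto
    then have "\<phi> 1 \<le> \<phi> (-1)"
      using j(1) unfolding \<phi>_def trap_profile_def by (auto intro: profile_mono)
    then show ?thesis using full_cases[OF \<xi>, of 1] by auto
  qed simp
  have right: "0 \<le> ?\<alpha> (N - 1) * (\<phi> (int N + 1) - \<phi> (int N - 1))"
  proof (cases "?\<alpha> (N - 1) = 0")
    case False
    then have "j + 2 \<le> N - 1" using trap_full_apart[OF \<xi> j(2) False] j(1) N by linarith
    then have "\<bar>real_of_int (int N - 1) - real j\<bar> = real N - 1 - real j" "\<bar>real_of_int (int N + 1) - real j\<bar> = real N + 1 - real j" by auto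
    then have "\<phi> (int N - 1) \<le> \<phi> (int N + 1)"
      using j(1) unfolding \<phi>_def trap_profile_def by (auto intro: profile_mono)
    then show ?thesis using full_cases[OF \<xi>, of "N - 1"] by auto
  qed simp
  have "(\<Sum>i<N. ?g i * (?\<alpha> i + ?\<alpha> (Suc i) - ?\<alpha> i * ?\<alpha> (Suc i))) \<le> (\<Sum>i<N. - 2 / ?M\<^sup>2 * (?\<alpha> i * \<phi> (int i)))"
  proof (rule sum_mono)
    fix i assume i: "i \<in> {..<N}"
    show "?g i * (?\<alpha> i + ?\<alpha> (Suc i) - ?\<alpha> i * ?\<alpha> (Suc i)) \<le> - 2 / ?M\<^sup>2 * (?\<alpha> i * \<phi> (int i))"
    proof (cases "?\<alpha> i = 0 \<and> ?\<alpha> (Suc i) = 0")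
      case True
      then show ?thesis by simp
    next
      case False
      then have "int i + 2 \<le> int j \<or> int j \<le> int i - 1"
        using trap_full_apart[OF \<xi> j(2), of i] trap_full_apart[OF \<xi> j(2), of "Suc i"] by linarith
      then have g: "?g i = - 4 / ?M\<^sup>2"
        unfolding \<phi>_def by (rule trap_profile_curvature)
      have one: "?\<alpha> i + ?\<alpha> (Suc i) - ?\<alpha> i * ?\<alpha> (Suc i) = 1"
        using False full_cases[OF \<xi>, of i] full_cases[OF \<xi>, of "Suc i"] by auto
      have "?\<alpha> i * \<phi> (int i) \<le> 2"
        using full_cases[OF \<xi>, of i] trap_profile_bounds(2)[of j N i] j(1) i by (auto simp: \<phi>_def)
      then have "2 / ?M\<^sup>2 * (?\<alpha> i * \<phi> (int i)) \<le> 2 / ?M\<^sup>2 * 2"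
        by (intro mult_left_mono) auto
      then show ?thesis unfolding one g by simp
    qed
  qed
  also have "\<dots> = - 2 / ?M\<^sup>2 * pair_sum N \<phi> \<xi>"
  proof -
    have "pair_sum N \<phi> \<xi> = (\<Sum>i<N. ?\<alpha> i * \<phi> (int i))"
      unfolding pair_sum_def lessThan_Suc_atMost[symmetric] by simp
    then show ?thesis by (simp add: sum_distrib_left)
  qed
  finally show ?thesis
    using run_sum_interior[of N ?\<alpha> \<phi>] N left right by simp
qed

text \<open>The denominator is \<open>n - m + 1\<close>, the least possible number of full bonds while there is a trap.\<close>

definition trap_energy :: "nat \<Rightarrow> nat \<Rightarrow> config \<Rightarrow> real" where
  "trap_energy N k \<xi> = (\<Sum>j\<le>N. trap N \<xi> j * pair_sum N (trap_profile N j) \<xi>) / (2 * real k - real N)"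

lemma pair_sum_nonneg:
  assumes "\<xi> \<in> Omega N k" "\<And>a. a \<le> N \<Longrightarrow> 0 \<le> \<phi> (int a)"
  shows "0 \<le> pair_sum N \<phi> \<xi>"
  unfolding pair_sum_def
proof (intro sum_nonneg mult_nonneg_nonneg)
  show "0 \<le> full N \<xi> a" for a using full_cases[OF assms(1), of a] by auto
qed (use assms(2) in auto)

text \<open>A jump replaces the cost at its starting bond by the cost at its target, for every trap; if it hits
a trap, both a full bond and a trap vanish, so the energy is even smaller. Hence the drift is at most the
sum of the drifts of \<open>trap_drift\<close> over the traps.\<close>

lemma trap_energy_drift:
  assumes \<xi>: "\<xi> \<in> Omega N k" and N: "2 \<le> N" and k: "real N < 2 * real k"
  shows "fep_generator (1/2) N (trap_energy N k) \<xi> \<le> - (1 / (real N + 1)\<^sup>2) * trap_energy N k \<xi>"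
proof -
  let ?h = "trap N \<xi>" and ?\<phi> = "trap_profile N" and ?D = "2 * real k - real N"
  define R where "R = (\<lambda>x. (\<Sum>j\<le>N. ?h j * (?\<phi> j (int x + 1) - ?\<phi> j (int x - 1))) / ?D)"
  define L where "L = (\<lambda>x. (\<Sum>j\<le>N. ?h j * (?\<phi> j (int x - 2) - ?\<phi> j (int x))) / ?D)"
  have D: "0 < ?D" using k by simp
  have nonneg: "0 \<le> pair_sum N (?\<phi> j) \<zeta>" if "\<zeta> \<in> Omega N k" "j \<le> N" for \<zeta> j
  proof (rule pair_sum_nonneg[OF that(1)])
    show "0 \<le> ?\<phi> j (int a)" if "a \<le> N" for a
      using trap_profile_bounds(1)[OF \<open>j \<le> N\<close> that] by linarith
  qed
  have h0: "0 \<le> ?h j" for j using trap_cases[OF \<xi>, of j] by auto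
  \<comment> \<open>\<open>q\<close> is 1 if the moved bond is full after the jump and 0 if it filled a trap\<close>
  have change: "trap_energy N k \<zeta> - trap_energy N k \<xi> \<le> (\<Sum>j\<le>N. ?h j * (?\<phi> j b - ?\<phi> j a)) / ?D"
    if \<zeta>: "\<zeta> \<in> Omega N k" and hz: "\<And>j. trap N \<zeta> j \<le> ?h j" and bz: "\<And>j. j \<le> N \<Longrightarrow> 0 \<le> ?\<phi> j b"
      and pz: "\<And>\<phi>. pair_sum N \<phi> \<zeta> = pair_sum N \<phi> \<xi> - \<phi> a + q * \<phi> b" and q: "q \<le> 1" for \<zeta> a b q
  proof -
    have "trap N \<zeta> j * pair_sum N (?\<phi> j) \<zeta> \<le> ?h j * pair_sum N (?\<phi> j) \<xi> + ?h j * (?\<phi> j b - ?\<phi> j a)" if "j \<le> N" for j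
    proof -
      have "trap N \<zeta> j * pair_sum N (?\<phi> j) \<zeta> \<le> ?h j * pair_sum N (?\<phi> j) \<zeta>"
        using hz nonneg[OF \<zeta> that] by (intro mult_right_mono)
      also have "\<dots> \<le> ?h j * (pair_sum N (?\<phi> j) \<xi> - ?\<phi> j a + 1 * ?\<phi> j b)"
        unfolding pz using h0 q bz[OF that] by (intro mult_left_mono add_left_mono mult_right_mono)
      finally show ?thesis by (simp add: algebra_simps)
    qed
    then have "(\<Sum>j\<le>N. trap N \<zeta> j * pair_sum N (?\<phi> j) \<zeta>) \<le> (\<Sum>j\<le>N. ?h j * pair_sum N (?\<phi> j) \<xi> + ?h j * (?\<phi> j b - ?\<phi> j a))"
      by (intro sum_mono) auto
    then show ?thesis
      using D by (simp add: trap_energy_def sum.distrib divide_right_mono flip: diff_divide_distrib)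
  qed
  have "fep_generator (1/2) N (trap_energy N k) \<xi>
     \<le> 1/2 * (\<Sum>x=2..N-1. right_rate (full N \<xi>) x * R x + left_rate (full N \<xi>) x * L x)"
  proof (rule fep_generator_le[OF \<xi>])
    fix x assume jump: "right_jump N \<xi> x"
    note x = right_jumpD(1)[OF jump] and v = right_jumpD(2-4)[OF jump]
    show "trap_energy N k (exchange \<xi> x (x + 1)) - trap_energy N k \<xi> \<le> R x"
      unfolding R_def
    proof (rule change)
      show "exchange \<xi> x (x + 1) \<in> Omega N k" by (rule jump_Omega(1)[OF \<xi> jump])
      show "pair_sum N \<phi> (exchange \<xi> x (x + 1)) = pair_sum N \<phi> \<xi> - \<phi> (int x - 1) + occ N \<xi> (x + 2) * \<phi> (int x + 1)" for \<phi>
        by (rule pair_sum_right_move[OF jump])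
      show "occ N \<xi> (x + 2) \<le> 1" using occ_cases[OF \<xi>, of "x + 2"] by auto
      show "trap N (exchange \<xi> x (x + 1)) j \<le> ?h j" for j by (rule trap_move_le(1)[OF \<xi> jump])
      have x1: "x + 1 \<le> N" "int (x + 1) = int x + 1" using x by auto
      show "0 \<le> ?\<phi> j (int x + 1)" if "j \<le> N" for j
        using trap_profile_bounds(1)[OF that x1(1)] unfolding x1(2) by linarith
    qed
  next
    fix x assume jump: "left_jump N \<xi> x"
    note x = left_jumpD(1)[OF jump] and v = left_jumpD(2-4)[OF jump]
    show "trap_energy N k (exchange \<xi> x (x - 1)) - trap_energy N k \<xi> \<le> L x"
      unfolding L_def
    proof (rule change)
      show "exchange \<xi> x (x - 1) \<in> Omega N k" by (rule jump_Omega(2)[OF \<xi> jump])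
      show "pair_sum N \<phi> (exchange \<xi> x (x - 1)) = pair_sum N \<phi> \<xi> - \<phi> (int x) + occ N \<xi> (x - 2) * \<phi> (int x - 2)" for \<phi>
        by (rule pair_sum_left_move[OF jump])
      show "occ N \<xi> (x - 2) \<le> 1" using occ_cases[OF \<xi>, of "x - 2"] by auto
      show "trap N (exchange \<xi> x (x - 1)) j \<le> ?h j" for j by (rule trap_move_le(2)[OF \<xi> jump])
      have x2: "x - 2 \<le> N" "int (x - 2) = int x - 2" using x by auto
      show "0 \<le> ?\<phi> j (int x - 2)" if "j \<le> N" for j
        using trap_profile_bounds(1)[OF that x2(1)] unfolding x2(2) by linarith
    qed
  qed
  also have "(\<Sum>x=2..N-1. right_rate (full N \<xi>) x * R x + left_rate (full N \<xi>) x * L x)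
     = (\<Sum>j\<le>N. ?h j * (\<Sum>x=2..N-1. run_drift (full N \<xi>) (?\<phi> j) x)) / ?D"
  proof -
    have "right_rate (full N \<xi>) x * R x + left_rate (full N \<xi>) x * L x
      = (\<Sum>j\<le>N. ?h j * run_drift (full N \<xi>) (?\<phi> j) x) / ?D" for x
      unfolding R_def L_def run_drift_def times_divide_eq_right add_divide_distrib[symmetric] sum_distrib_left sum.distrib[symmetric]
      by (intro arg_cong2[where f = "(/)"] sum.cong refl) (simp add: algebra_simps)
    then show ?thesis
      by (simp only: sum_divide_distrib[symmetric] sum_distrib_left sum.swap[of _ "{2..N-1}"])
  qed
  also have "\<dots> \<le> (\<Sum>j\<le>N. ?h j * (- 2 / (real N + 1)\<^sup>2 * pair_sum N (?\<phi> j) \<xi>)) / ?D"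
  proof (intro divide_right_mono sum_mono)
    fix j assume "j \<in> {..N}"
    then show "?h j * (\<Sum>x=2..N-1. run_drift (full N \<xi>) (?\<phi> j) x)
       \<le> ?h j * (- 2 / (real N + 1)\<^sup>2 * pair_sum N (?\<phi> j) \<xi>)"
      using trap_drift[OF \<xi> N, of j] trap_cases[OF \<xi>, of j] by auto
  qed (use D in simp)
  also have "\<dots> = - 2 / (real N + 1)\<^sup>2 * trap_energy N k \<xi>"
    by (simp add: trap_energy_def sum_distrib_left mult_ac flip: sum_divide_distrib)
  finally show ?thesis by simp
qed

text \<open>Let \<open>A\<close> and \<open>B\<close> be the numbers of full bonds and of traps and \<open>D\<close> the denominator. The energy is between
\<open>A B / D\<close> and \<open>2 A B / D\<close>, and \<open>A = B + D - 1\<close>. Thus \<open>A \<ge> D\<close> if \<open>B \<ge> 1\<close>, and \<open>A \<le> B D\<close> in that case;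
moreover \<open>B \<le> m + 1\<close>. This upper bound does not see \<open>n\<close>, which is what allows \<open>log m\<close> instead of
\<open>log N\<close> in the mixing time.\<close>

lemma trap_energy_bounds:
  assumes \<xi>: "\<xi> \<in> Omega N k" and N: "1 \<le> N" and k: "real N < 2 * real k"
  shows "0 \<le> trap_energy N k \<xi>"
    and "\<xi> \<notin> ergodic_component N k \<Longrightarrow> 1 \<le> trap_energy N k \<xi>"
    and "k \<le> N \<Longrightarrow> trap_energy N k \<xi> \<le> 2 * (real N + 1 - real k)\<^sup>2"
proof -
  let ?D = "2 * real k - real N"
  define A where "A = (\<Sum>x\<le>N. full N \<xi> x)"
  define B where "B = (\<Sum>x\<le>N. trap N \<xi> x)"
  have "N + 1 \<le> 2 * k" using k by linarith
  then have "real (N + 1) \<le> real (2 * k)" by (simp only: of_nat_le_iff)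
  then have D: "1 \<le> ?D" by simp
  have AB: "A = B + ?D - 1" using sum_full_minus_trap[OF \<xi>] by (simp add: A_def B_def)
  have p0: "0 \<le> full N \<xi> x" and h0: "0 \<le> trap N \<xi> x" for x
    using full_cases[OF \<xi>, of x] trap_cases[OF \<xi>, of x] by auto
  have A0: "0 \<le> A" and B0: "0 \<le> B" unfolding A_def B_def by (intro sum_nonneg p0 h0)+
  have ps: "A \<le> pair_sum N (trap_profile N j) \<xi>" "pair_sum N (trap_profile N j) \<xi> \<le> 2 * A" if "j \<le> N" for j
  proof -
    have "(\<Sum>a\<le>N. full N \<xi> a * 1) \<le> pair_sum N (trap_profile N j) \<xi>"
      unfolding pair_sum_def using that p0 by (intro sum_mono mult_left_mono trap_profile_bounds) auto
    then show "A \<le> pair_sum N (trap_profile N j) \<xi>" by (simp add: A_def)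
    have "pair_sum N (trap_profile N j) \<xi> \<le> (\<Sum>a\<le>N. full N \<xi> a * 2)"
      unfolding pair_sum_def using that p0 by (intro sum_mono mult_left_mono trap_profile_bounds) auto
    then show "pair_sum N (trap_profile N j) \<xi> \<le> 2 * A" by (simp add: A_def mult.commute sum_distrib_left)
  qed
  have lo: "B * A \<le> (\<Sum>j\<le>N. trap N \<xi> j * pair_sum N (trap_profile N j) \<xi>)"
    unfolding B_def sum_distrib_right using ps h0 by (intro sum_mono mult_left_mono) auto
  have hi: "(\<Sum>j\<le>N. trap N \<xi> j * pair_sum N (trap_profile N j) \<xi>) \<le> B * (2 * A)"
    unfolding B_def sum_distrib_right using ps h0 by (intro sum_mono mult_left_mono) auto
  have "0 \<le> B * A" using A0 B0 by simp
  then show "0 \<le> trap_energy N k \<xi>"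
    unfolding trap_energy_def using lo D by (intro divide_nonneg_pos) linarith+
  have B1: "1 \<le> B" if nz: "B \<noteq> 0"
  proof -
    obtain j where "j \<le> N" "trap N \<xi> j \<noteq> 0" using nz unfolding B_def by (metis atMost_iff sum.neutral)
    then show ?thesis using trap_cases[OF \<xi>, of j] member_le_sum[of j "{..N}" "trap N \<xi>"] h0 by (auto simp: B_def)
  qed
  show "1 \<le> trap_energy N k \<xi>" if nE: "\<xi> \<notin> ergodic_component N k"
  proof -
    obtain j where j: "j \<le> N" "trap N \<xi> j \<noteq> 0"
      using nE ergodic_iff_no_trap[OF \<xi> N] by auto
    then have "trap N \<xi> j = 1" using trap_cases[OF \<xi>, of j] by auto
    then have "1 \<le> B" using j(1) member_le_sum[of j "{..N}" "trap N \<xi>"] h0 by (auto simp: B_def)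
    moreover from this have "?D \<le> A" using AB by simp
    ultimately have "1 * ?D \<le> B * A" using D by (intro mult_mono) auto
    then show ?thesis unfolding trap_energy_def using lo D by (simp add: le_divide_eq)
  qed
  show "trap_energy N k \<xi> \<le> 2 * (real N + 1 - real k)\<^sup>2" if "k \<le> N"
  proof (cases "B = 0")
    case True
    then have "trap_energy N k \<xi> \<le> 0" unfolding trap_energy_def using hi D by (simp add: divide_le_0_iff)
    then show ?thesis by (rule order_trans) simp
  next
    case False
    then have "1 \<le> B" by (rule B1)
    have "A \<le> B * ?D"
    proof -
      have "0 \<le> (B - 1) * (?D - 1)" using \<open>1 \<le> B\<close> D by simp
      then show ?thesis using AB by (simp add: algebra_simps)
    qed
    then have "B * (2 * A) \<le> B * (2 * (B * ?D))"
      using B0 by (intro mult_left_mono) auto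
    then have "trap_energy N k \<xi> \<le> 2 * B\<^sup>2"
      unfolding trap_energy_def using hi D by (simp add: divide_le_eq power2_eq_square mult_ac)
    also have "\<dots> \<le> 2 * (real N + 1 - real k)\<^sup>2"
      using sum_trap_le[OF \<xi>] B0 by (intro mult_left_mono power_mono) (auto simp: B_def)
    finally show ?thesis .
  qed
qed

section \<open>Upper bound for the total variation distance\<close>

text \<open>The parameters are the size \<open>n\<close> and the number \<open>m\<close> of particles of the exclusion process; \<open>m \<le> n\<close> means \<open>2 k > N\<close>.
The exclusion process is run with the same constant \<open>N\<close> as the FEP, so that the operators \<open>step\<close>
of the two chains correspond to each other.\<close>

locale fep_chain =
  fixes n m N k :: nat
  assumes n_pos: "1 \<le> n" and m_le: "m \<le> n" and N_eq: "N = Suc (n + m)" and k_eq: "k = Suc n"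

sublocale fep_chain \<subseteq> F: jump_chain "Omega N k" "fep_moves N" fep_rate fep_move "real N"
  using N_eq by (intro jump_chain_fep) auto

sublocale fep_chain \<subseteq> C: ssep_chain n m N
  using n_pos N_eq by unfold_locales auto

context fep_chain
begin

abbreviation E :: "config set" where "E \<equiv> ergodic_component N k"
abbreviation X :: "nat set set" where "X \<equiv> ssep_states n m"
abbreviation \<Phi> :: "nat set \<Rightarrow> config" where "\<Phi> \<equiv> decode n m"

lemma bij_decode: "bij_betw \<Phi> X E"
  using decode_bij[of n m] by (simp add: N_eq k_eq)

lemma E_subset: "E \<subseteq> Omega N k"
  by (auto simp: ergodic_component_def)

lemma X_nonempty: "X \<noteq> {}"
proof -
  have "{1..m} \<in> X" using m_le by (auto simp: ssep_states_def)
  then show ?thesis by blast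
qed

lemma card_X_pos: "0 < card X"
  using X_nonempty finite_ssep_states[of n m] by (simp add: card_gt_0_iff)

lemma card_E: "card E = card X"
  using bij_decode by (simp add: bij_betw_same_card)

lemma iter_decode: "S \<in> X \<Longrightarrow> (F.step ^^ j) f (\<Phi> S) = (C.step ^^ j) (\<lambda>S. f (\<Phi> S)) S"
proof (induction j arbitrary: S)
  case (Suc j)
  have "F.step u (\<Phi> S) = C.step (\<lambda>S. u (\<Phi> S)) S" for u
    using fep_generator_decode[OF Suc.prems, of u] unfolding F.step_def C.step_def
    by (simp add: N_eq fep_generator_jump_gen ssep_gen_def)
  then have "F.step ((F.step ^^ j) f) (\<Phi> S) = C.step (\<lambda>S. (F.step ^^ j) f (\<Phi> S)) S" .
  also have "\<dots> = C.step ((C.step ^^ j) (\<lambda>S. f (\<Phi> S))) S"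
    by (intro C.step_cong Suc.IH Suc.prems)
  finally show ?case by simp
qed simp

definition equi_prob :: "config set \<Rightarrow> real" where
  "equi_prob A = real (card (A \<inter> E)) / real (card E)"

lemma equi_prob_eq: "equi_prob A = (\<Sum>S\<in>X. of_bool (\<Phi> S \<in> A)) / card X"
proof -
  have "(\<Sum>S\<in>X. of_bool (\<Phi> S \<in> A)) = (\<Sum>\<xi>\<in>E. of_bool (\<xi> \<in> A) :: real)"
    using bij_decode by (rule sum.reindex_bij_betw)
  also have "\<dots> = card (A \<inter> E)"
    using finite_subset[OF E_subset finite_Omega] by (simp add: sum.If_cases of_bool_def Int_commute)
  finally show ?thesis by (simp add: equi_prob_def card_E)
qed

lemma equi_prob_compl: "equi_prob (- A) = 1 - equi_prob A"
proof -
  have "(\<Sum>S\<in>X. of_bool (\<Phi> S \<in> - A)) = (\<Sum>S\<in>X. 1 - of_bool (\<Phi> S \<in> A) :: real)"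
    by (intro sum.cong) auto
  then show ?thesis
    using card_X_pos by (simp add: equi_prob_eq sum_subtractf diff_divide_distrib)
qed

lemma equi_prob_nonneg: "0 \<le> equi_prob A"
  by (simp add: equi_prob_def)

text \<open>Half of the steps are used for each phase. For a start in the ergodic component, the law after \<open>l\<close> steps is within
\<open>2 m \<rho> ^ l\<close> of equilibrium by \<open>iter_mixing\<close>; for any other start the error is at most
\<open>1\<close>, hence at most the trap energy. The mean trap energy after the first \<open>i\<close> steps is at most
\<open>\<rho> ^ i\<close> times the initial one.\<close>

lemma iter_equilibrium_upper:
  assumes \<xi>: "\<xi> \<in> Omega N k"
  shows "(F.step ^^ j) (\<lambda>\<zeta>. of_bool (\<zeta> \<in> A)) \<xi>
    \<le> (4 * real m + 4 * (real m + 1)\<^sup>2) * sqrt (1 - 1 / ((real N + 1)\<^sup>2 * real N)) ^ j + equi_prob A"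
proof -
  define \<rho> where "\<rho> = 1 - 1 / ((real N + 1)\<^sup>2 * real N)"
  define l where "l = j div 2"
  define i where "i = j - l"
  define u :: "config \<Rightarrow> real" where "u = (\<lambda>\<zeta>. of_bool (\<zeta> \<in> A))"
  define V where "V = trap_energy N k"
  have N1: "1 \<le> real N" using N_eq by simp
  have nN: "real n \<le> real N + 1" using N_eq by simp
  have \<rho>14: "1 / ((real N + 1)\<^sup>2 * real N) \<le> 1 / 4"
  proof -
    have "2\<^sup>2 * 1 \<le> (real N + 1)\<^sup>2 * real N"
      using N1 by (intro mult_mono power_mono) auto
    then show ?thesis by (intro divide_left_mono) auto
  qed
  then have \<rho>: "1/4 \<le> \<rho>" "0 \<le> \<rho>" by (auto simp: \<rho>_def)
  have \<rho>1: "\<rho> \<le> 1" using N1 by (simp add: \<rho>_def)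
  have \<rho>n: "0 \<le> 1 - 1 / ((real n)\<^sup>2 * real N)" "1 - 1 / ((real n)\<^sup>2 * real N) \<le> \<rho>"
  proof -
    have "1 * 1 \<le> (real n)\<^sup>2 * real N"
      using n_pos N1 by (intro mult_mono one_le_power) auto
    then show "0 \<le> 1 - 1 / ((real n)\<^sup>2 * real N)" by simp
    have "(real n)\<^sup>2 * real N \<le> (real N + 1)\<^sup>2 * real N"
      using nN by (intro mult_right_mono power_mono) auto
    then show "1 - 1 / ((real n)\<^sup>2 * real N) \<le> \<rho>"
      unfolding \<rho>_def using n_pos N1 by (intro diff_left_mono divide_left_mono mult_pos_pos) auto
  qed
  have k: "real N < 2 * real k" "k \<le> N" using m_le N_eq k_eq by auto
  have mk: "real N + 1 - real k = real m + 1" using N_eq k_eq by simp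
  have ind: "(F.step ^^ l) u \<zeta> \<le> equi_prob A + 2 * real m * \<rho> ^ l + V \<zeta>" if \<zeta>: "\<zeta> \<in> Omega N k" for \<zeta>
  proof (cases "\<zeta> \<in> E")
    case True
    then obtain S where S: "S \<in> X" "\<zeta> = \<Phi> S"
      using bij_decode by (auto simp: bij_betw_def)
    have "\<bar>(C.step ^^ l) (\<lambda>S. u (\<Phi> S)) S - (\<Sum>S\<in>X. u (\<Phi> S)) / card X\<bar> \<le> 2 * real m * (1 - 1 / ((real n)\<^sup>2 * real N)) ^ l"
      by (intro C.iter_mixing S) (auto simp: u_def)
    also have "\<dots> \<le> 2 * real m * \<rho> ^ l"
      using \<rho>n by (intro mult_left_mono power_mono) auto
    finally have "(F.step ^^ l) u \<zeta> \<le> equi_prob A + 2 * real m * \<rho> ^ l"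
      unfolding equi_prob_eq S(2) iter_decode[OF S(1)] by (simp add: u_def abs_le_iff)
    then show ?thesis
      using trap_energy_bounds(1)[OF \<zeta> _ k(1)] N_eq by (simp add: V_def)
  next
    case False
    have "(F.step ^^ l) u \<zeta> \<le> (F.step ^^ l) (\<lambda>_. 1) \<zeta>"
      using \<zeta> by (intro F.iter_mono) (auto simp: u_def)
    also have "\<dots> = 1" by (simp add: F.iter_const)
    also have "1 \<le> V \<zeta>"
      unfolding V_def using False N_eq by (intro trap_energy_bounds(2) \<zeta> k) auto
    finally show ?thesis
      using equi_prob_nonneg[of A] \<rho>(2) by (simp add: add_increasing)
  qed
  have "j = i + l" by (simp add: i_def l_def)
  then have "(F.step ^^ j) u \<xi> = (F.step ^^ i) ((F.step ^^ l) u) \<xi>"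
    by (simp add: funpow_add)
  also have "\<dots> \<le> (F.step ^^ i) (\<lambda>\<zeta>. (equi_prob A + 2 * real m * \<rho> ^ l) + V \<zeta>) \<xi>"
    using ind \<xi> by (intro F.iter_mono) auto
  also have "\<dots> = equi_prob A + 2 * real m * \<rho> ^ l + (F.step ^^ i) V \<xi>"
    by (simp add: F.iter_add F.iter_const)
  also have "(F.step ^^ i) V \<xi> \<le> \<rho> ^ i * V \<xi>"
  proof -
    have "(F.step ^^ i) V \<xi> \<le> (1 + - (1 / (real N + 1)\<^sup>2) / real N) ^ i * V \<xi>"
    proof (rule F.iter_lyapunov)
      show "F.gen V \<zeta> \<le> - (1 / (real N + 1)\<^sup>2) * V \<zeta>" if "\<zeta> \<in> Omega N k" for \<zeta>
        using trap_energy_drift[OF that _ k(1)] n_pos N_eq by (simp add: V_def fep_generator_jump_gen)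
      have "1 \<le> (real N + 1)\<^sup>2" by (rule one_le_power) simp
      then have "1 / (real N + 1)\<^sup>2 \<le> 1" by simp
      then show "- real N \<le> - (1 / (real N + 1)\<^sup>2)" using N1 by linarith
    qed (rule \<xi>)
    then show ?thesis by (simp add: \<rho>_def)
  qed
  also have "\<rho> ^ i * V \<xi> \<le> \<rho> ^ l * (2 * (real m + 1)\<^sup>2)"
  proof (intro mult_mono power_decreasing)
    show "V \<xi> \<le> 2 * (real m + 1)\<^sup>2"
      using trap_energy_bounds(3)[OF \<xi> _ k] N_eq unfolding V_def mk by simp
    show "0 \<le> V \<xi>" using trap_energy_bounds(1)[OF \<xi> _ k(1)] N_eq by (simp add: V_def)
  qed (use \<rho> \<rho>1 in \<open>auto simp: i_def l_def\<close>)
  finally have main: "(F.step ^^ j) u \<xi> \<le> equi_prob A + (2 * real m + 2 * (real m + 1)\<^sup>2) * \<rho> ^ l"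
    by (simp add: algebra_simps)
  \<comment> \<open>for odd \<open>j\<close> the rounding of \<open>j / 2\<close> costs a factor \<open>1 / sqrt \<rho> \<le> 2\<close>\<close>
  have "\<rho> ^ l \<le> 2 * sqrt \<rho> ^ j"
  proof -
    have sq: "\<rho> ^ l = sqrt \<rho> ^ (2 * l)" using \<rho> by (simp add: power_mult)
    have s: "1/2 \<le> sqrt \<rho>" using \<rho> by (intro real_le_rsqrt) (simp add: power2_eq_square)
    consider "j = 2 * l" | "j = Suc (2 * l)" unfolding l_def by linarith
    then show ?thesis
    proof cases
      case 1
      then show ?thesis unfolding sq using \<rho>(2) by simp
    next
      case 2
      have "sqrt \<rho> ^ (2 * l) * 1 \<le> sqrt \<rho> ^ (2 * l) * (2 * sqrt \<rho>)"
        using s \<rho>(2) by (intro mult_left_mono) auto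
      then show ?thesis unfolding sq 2 by (simp add: mult_ac)
    qed
  qed
  then have "(2 * real m + 2 * (real m + 1)\<^sup>2) * \<rho> ^ l \<le> (2 * real m + 2 * (real m + 1)\<^sup>2) * (2 * sqrt \<rho> ^ j)"
    by (intro mult_left_mono) auto
  then show ?thesis using main by (simp add: u_def \<rho>_def algebra_simps)
qed

lemma law_upper:
  assumes \<xi>: "\<xi> \<in> Omega N k" and t: "0 \<le> t"
  shows "F.P t (\<lambda>\<zeta>. of_bool (\<zeta> \<in> A)) \<xi>
    \<le> (4 * real m + 4 * (real m + 1)\<^sup>2) * exp (- t / (2 * (real N + 1)\<^sup>2)) + equi_prob A"
proof -
  let ?\<rho> = "1 - 1 / ((real N + 1)\<^sup>2 * real N)"
  have N1: "1 \<le> real N" using N_eq by simp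
  have "1 * 1 \<le> (real N + 1)\<^sup>2 * real N" using N1 by (intro mult_mono one_le_power) auto
  then have \<rho>: "0 \<le> ?\<rho>" "?\<rho> \<le> 1" by auto
  have "F.P t (\<lambda>\<zeta>. of_bool (\<zeta> \<in> A)) \<xi>
    \<le> (4 * real m + 4 * (real m + 1)\<^sup>2) * exp (- (real N * (1 - sqrt ?\<rho>) * t)) + equi_prob A"
    by (rule F.P_le_of_iter_le[OF iter_equilibrium_upper[OF \<xi>] \<xi> t])
  also have "\<dots> \<le> (4 * real m + 4 * (real m + 1)\<^sup>2) * exp (- t / (2 * (real N + 1)\<^sup>2)) + equi_prob A"
  proof (intro add_right_mono mult_left_mono)
    have "1 - ?\<rho> = (1 - sqrt ?\<rho>) * (1 + sqrt ?\<rho>)"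
      using \<rho> by (simp add: algebra_simps)
    also have "\<dots> \<le> (1 - sqrt ?\<rho>) * 2"
      using \<rho> by (intro mult_left_mono) auto
    finally have "(1 - ?\<rho>) / 2 \<le> 1 - sqrt ?\<rho>" by simp
    then have "real N * ((1 - ?\<rho>) / 2) * t \<le> real N * (1 - sqrt ?\<rho>) * t"
      using t by (intro mult_right_mono mult_left_mono) auto
    moreover have "real N * ((1 - ?\<rho>) / 2) * t = t / (2 * (real N + 1)\<^sup>2)"
      using N1 by (simp add: field_simps)
    ultimately show "exp (- (real N * (1 - sqrt ?\<rho>) * t)) \<le> exp (- t / (2 * (real N + 1)\<^sup>2))"
      by simp
  qed auto
  finally show ?thesis .
qed

lemma P_compl:
  assumes "\<xi> \<in> Omega N k"
  shows "F.P t (\<lambda>\<zeta>. of_bool (\<zeta> \<in> - A)) \<xi> = 1 - F.P t (\<lambda>\<zeta>. of_bool (\<zeta> \<in> A)) \<xi>"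
proof -
  have "F.P t (\<lambda>\<zeta>. of_bool (\<zeta> \<in> - A) + of_bool (\<zeta> \<in> A)) \<xi> = F.P t (\<lambda>_. 1) \<xi>"
    by (intro arg_cong[of _ _ "\<lambda>f. F.P t f \<xi>"] ext) auto
  then show ?thesis
    unfolding F.P_add[OF assms] F.P_const[OF assms] by simp
qed

text \<open>The lower estimate is the upper estimate for the complementary event.\<close>

lemma law_distance:
  assumes \<xi>: "\<xi> \<in> Omega N k" and t: "0 \<le> t"
  shows "\<bar>F.P t (\<lambda>\<zeta>. of_bool (\<zeta> \<in> A)) \<xi> - equi_prob A\<bar>
    \<le> (4 * real m + 4 * (real m + 1)\<^sup>2) * exp (- t / (2 * (real N + 1)\<^sup>2))"
  using law_upper[OF \<xi> t, of A] law_upper[OF \<xi> t, of "- A"]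
  unfolding P_compl[OF \<xi>] equi_prob_compl by (simp add: abs_le_iff)

lemma sum_fep_law:
  assumes \<xi>: "\<xi> \<in> Omega N k" and A: "finite A"
  shows "(\<Sum>\<eta>\<in>A. fep_law (1/2) N t \<xi> \<eta>) = F.P t (\<lambda>\<zeta>. of_bool (\<zeta> \<in> A)) \<xi>"
proof -
  have "(\<lambda>\<zeta>. of_bool (\<zeta> \<in> A)) = (\<lambda>\<zeta>. \<Sum>\<eta>\<in>A. of_bool (\<zeta> = \<eta>) :: real)"
    using A by (intro ext) (simp add: of_bool_def)
  then show ?thesis
    by (simp only: F.P_sum[OF \<xi> A]) (simp add: fep_law_def semigroup_of_def fep_generator_jump_gen)
qed

lemma sum_equilibrium:
  assumes "finite A"
  shows "(\<Sum>\<eta>\<in>A. pmf (equilibrium N k) \<eta>) = equi_prob A"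
proof -
  have E: "finite E" "E \<noteq> {}"
    using finite_subset[OF E_subset finite_Omega] card_E card_X_pos by auto
  have "(\<Sum>\<eta>\<in>A. pmf (equilibrium N k) \<eta>) = (\<Sum>\<eta>\<in>A. indicator E \<eta> / card E)"
    by (simp add: equilibrium_def pmf_of_set[OF E(2,1)])
  moreover have "(\<Sum>\<eta>\<in>A. indicator E \<eta>) = real (card (A \<inter> E))"
    using assms by (simp add: indicator_def of_bool_def sum.If_cases)
  ultimately show ?thesis
    by (simp add: equi_prob_def flip: sum_divide_distrib)
qed

lemma tv_dist_fep:
  assumes \<xi>: "\<xi> \<in> Omega N k"
  shows "tv_dist (Omega N k) (fep_law (1/2) N t \<xi>) (pmf (equilibrium N k))
    = (MAX A\<in>Pow (Omega N k). \<bar>F.P t (\<lambda>\<zeta>. of_bool (\<zeta> \<in> A)) \<xi> - equi_prob A\<bar>)"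
  unfolding tv_dist_def
proof (intro arg_cong[of _ _ Max] image_cong refl)
  fix A assume "A \<in> Pow (Omega N k)"
  then have "finite A" using finite_subset[OF _ finite_Omega[of N k]] by auto
  then show "\<bar>(\<Sum>\<eta>\<in>A. fep_law (1/2) N t \<xi> \<eta>) - (\<Sum>\<eta>\<in>A. pmf (equilibrium N k) \<eta>)\<bar>
      = \<bar>F.P t (\<lambda>\<zeta>. of_bool (\<zeta> \<in> A)) \<xi> - equi_prob A\<bar>"
    by (simp add: sum_fep_law[OF \<xi>] sum_equilibrium)
qed

lemma worst_dist_ge:
  assumes \<xi>: "\<xi> \<in> Omega N k" and A: "A \<subseteq> Omega N k"
  shows "\<bar>F.P t (\<lambda>\<zeta>. of_bool (\<zeta> \<in> A)) \<xi> - equi_prob A\<bar> \<le> worst_dist N k t"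
proof -
  have "\<bar>F.P t (\<lambda>\<zeta>. of_bool (\<zeta> \<in> A)) \<xi> - equi_prob A\<bar> \<le> tv_dist (Omega N k) (fep_law (1/2) N t \<xi>) (pmf (equilibrium N k))"
    unfolding tv_dist_fep[OF \<xi>] using A finite_Omega[of N k] by (intro Max_ge) auto
  also have "\<dots> \<le> worst_dist N k t"
    unfolding worst_dist_def using \<xi> finite_Omega[of N k] by (intro Max_ge) auto
  finally show ?thesis .
qed

lemma worst_dist_le:
  assumes t: "0 \<le> t"
  shows "worst_dist N k t \<le> (4 * real m + 4 * (real m + 1)\<^sup>2) * exp (- t / (2 * (real N + 1)\<^sup>2))"
proof -
  let ?b = "(4 * real m + 4 * (real m + 1)\<^sup>2) * exp (- t / (2 * (real N + 1)\<^sup>2))"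
  have "E \<noteq> {}" using card_E card_X_pos by auto
  then have "Omega N k \<noteq> {}" using E_subset by auto
  moreover have "tv_dist (Omega N k) (fep_law (1/2) N t \<xi>) (pmf (equilibrium N k)) \<le> ?b" if "\<xi> \<in> Omega N k" for \<xi>
    unfolding tv_dist_fep[OF that] using finite_Omega[of N k] law_distance[OF that t]
    by (subst Max_le_iff) auto
  ultimately show ?thesis
    unfolding worst_dist_def using finite_Omega[of N k] by (subst Max_le_iff) auto
qed

end

section \<open>Lower bound from the transient phase\<close>

text \<open>A weight on the bonds that is even in \<open>p\<close>, which makes the left end of the segment reflecting, and
that vanishes for \<open>p \<ge> K\<close>, where the traps will be. Near \<open>K\<close> it is convex, so it satisfies
\<open>\<Delta> \<phi> \<ge> - C \<phi> / K\<^sup>2\<close> even where it is small.\<close>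

definition bump :: "nat \<Rightarrow> int \<Rightarrow> real" where
  "bump K p = (max 0 (1 - (of_int p / real K)\<^sup>2))\<^sup>2"

lemma bump_nonneg: "0 \<le> bump K p"
  by (simp add: bump_def)

lemma bump_zero:
  assumes "int K \<le> p" "0 < K"
  shows "bump K p = 0"
proof -
  have "1 \<le> of_int p / real K" using assms by simp
  then have "1 \<le> (of_int p / real K)\<^sup>2" by (rule one_le_power)
  then show ?thesis by (simp add: bump_def)
qed

lemma bump_le_1: "bump K p \<le> 1"
proof -
  have "max 0 (1 - (of_int p / real K)\<^sup>2) \<le> 1" by simp
  then show ?thesis unfolding bump_def by (intro power_le_one) auto
qed

lemma bump_inside:
  assumes "- int K \<le> p" "p \<le> int K"
  shows "bump K p = (1 - (of_int p / real K)\<^sup>2)\<^sup>2"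
proof -
  have "\<bar>of_int p / real K\<bar> \<le> 1" using assms by (auto simp: divide_le_eq_1 abs_le_iff)
  then have "(of_int p / real K)\<^sup>2 \<le> 1" by (simp add: abs_square_le_1)
  then show ?thesis by (simp add: bump_def)
qed

text \<open>On \<open>{- K .. K}\<close> the bump is the polynomial \<open>(1 - y\<^sup>2)\<^sup>2\<close> of \<open>y = p / K\<close>, with exact second
difference \<open>h\<^sup>2 (12 y\<^sup>2 - 4) + 2 h ^ 4\<close> for \<open>h = 1 / K\<close>. So it can be concave only for \<open>3 y\<^sup>2 < 1\<close>.\<close>

lemma bump_curvature:
  assumes "0 \<le> p" "0 < K"
  shows "0 \<le> bump K (p + 1) - 2 * bump K p + bump K (p - 1)
    \<or> (3 * p\<^sup>2 < int K ^ 2 \<and> - 4 / (real K)\<^sup>2 \<le> bump K (p + 1) - 2 * bump K p + bump K (p - 1))"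
proof (cases "int K \<le> p")
  case True
  then show ?thesis using bump_zero[of K p] bump_nonneg assms by simp
next
  case False
  define h where "h = 1 / real K"
  define y where "y = of_int p * h"
  have b: "bump K (p + 1) = (1 - (y + h)\<^sup>2)\<^sup>2" "bump K p = (1 - y\<^sup>2)\<^sup>2" "bump K (p - 1) = (1 - (y - h)\<^sup>2)\<^sup>2"
    using assms False by (simp_all add: bump_inside y_def h_def add_divide_distrib diff_divide_distrib)
  have e: "bump K (p + 1) - 2 * bump K p + bump K (p - 1) = h\<^sup>2 * (12 * y\<^sup>2 - 4) + 2 * h ^ 4"
    unfolding b by (simp add: power2_eq_square power4_eq_xxxx algebra_simps)
  have h4: "0 \<le> 2 * h ^ 4" by simp
  show ?thesis
  proof (cases "3 * p\<^sup>2 < int K ^ 2")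
    case True
    have "- 4 * h\<^sup>2 \<le> h\<^sup>2 * (12 * y\<^sup>2 - 4)" by (simp add: algebra_simps)
    then have "- 4 * h\<^sup>2 \<le> h\<^sup>2 * (12 * y\<^sup>2 - 4) + 2 * h ^ 4" using h4 by linarith
    moreover have "- 4 * h\<^sup>2 = - 4 / (real K)\<^sup>2" by (simp add: h_def power_divide)
    ultimately show ?thesis using True unfolding e by simp
  next
    case False
    then have "real K ^ 2 \<le> 3 * (of_int p)\<^sup>2"
      by (metis (no_types, opaque_lifting) not_less of_int_le_iff of_int_mult of_int_numeral of_int_of_nat_eq of_int_power)
    then have "1 \<le> 3 * y\<^sup>2" using assms by (simp add: y_def h_def power_divide field_simps)
    then have "0 \<le> h\<^sup>2 * (12 * y\<^sup>2 - 4)" by simp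
    then show ?thesis using h4 unfolding e by simp
  qed
qed

lemma bump_lower:
  assumes "0 \<le> p" "p \<le> q + 1" "0 \<le> q" "3 * q\<^sup>2 < int K ^ 2" "20 \<le> K"
  shows "8 / 30 \<le> bump K p"
proof -
  have qK: "q \<le> int K"
  proof (rule ccontr)
    assume "\<not> q \<le> int K"
    then have "int K ^ 2 \<le> q\<^sup>2" by (intro power_mono) auto
    then show False using assms(4) by (smt (verit) zero_le_power2)
  qed
  have "p\<^sup>2 \<le> (q + 1)\<^sup>2" using assms by (intro power_mono) auto
  then have "3 * p\<^sup>2 \<le> 3 * q\<^sup>2 + 6 * q + 3" by (simp add: power2_eq_square algebra_simps)
  also have "\<dots> \<le> int K ^ 2 + 6 * int K + 3" using assms(4) qK by linarith
  finally have i: "3 * p\<^sup>2 \<le> int K ^ 2 + 6 * int K + 3" .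
  have "real_of_int (3 * p\<^sup>2) \<le> real_of_int (int K ^ 2 + 6 * int K + 3)" using i by (simp only: of_int_le_iff)
  then have r: "3 * (of_int p)\<^sup>2 \<le> (real K)\<^sup>2 + 6 * real K + 3" by simp
  have "20 * real K \<le> real K * real K" using assms(5) by (intro mult_right_mono) auto
  moreover have "20 \<le> real K" using assms(5) by simp
  ultimately have "6 * real K + 3 \<le> 4/10 * (real K)\<^sup>2" unfolding power2_eq_square by linarith
  then have "(of_int p)\<^sup>2 \<le> 47/100 * (real K)\<^sup>2" using r by (simp add: field_simps)
  then have "(of_int p / real K)\<^sup>2 \<le> 47/100" using assms(5) by (simp add: power_divide field_simps)
  then have h: "53/100 \<le> max 0 (1 - (of_int p / real K)\<^sup>2)" by linarith
  have "(53/100)\<^sup>2 \<le> bump K p" unfolding bump_def by (rule power_mono[OF h]) simp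
  moreover have "8 / 30 \<le> (53 / 100 :: real)\<^sup>2" by (simp add: power2_eq_square)
  ultimately show ?thesis by linarith
qed

text \<open>Where one of the two second differences is negative, the bump is bounded below at both \<open>i\<close> and
\<open>i + 1\<close>; elsewhere the right-hand side is nonnegative.\<close>

lemma bump_subsolution:
  assumes "0 \<le> i" "20 \<le> K" "p = i \<or> p = i + 1"
  shows "- 30 / (real K)\<^sup>2 * bump K p \<le> bump K (i + 2) - bump K (i + 1) - bump K i + bump K (i - 1)"
proof -
  let ?d = "\<lambda>q. bump K (q + 1) - 2 * bump K q + bump K (q - 1)"
  have sum: "bump K (i + 2) - bump K (i + 1) - bump K i + bump K (i - 1) = ?d i + ?d (i + 1)"
    by (simp add: add.assoc)
  have neg: "- 30 / (real K)\<^sup>2 * bump K p \<le> 0" using bump_nonneg[of K p] by simp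
  have c: "0 \<le> ?d q \<or> (3 * q\<^sup>2 < int K ^ 2 \<and> - 4 / (real K)\<^sup>2 \<le> ?d q)" if "q = i \<or> q = i + 1" for q
    using that assms by (intro bump_curvature) auto
  show ?thesis
  proof (cases "0 \<le> ?d i \<and> 0 \<le> ?d (i + 1)")
    case True
    then show ?thesis using neg unfolding sum by linarith
  next
    case False
    then obtain q where q: "q = i \<or> q = i + 1" "3 * q\<^sup>2 < int K ^ 2"
      using c[of i] c[of "i + 1"] by blast
    have "8 / 30 \<le> bump K p"
      using assms q by (intro bump_lower[of p q]) auto
    then have "30 / (real K)\<^sup>2 * (8 / 30) \<le> 30 / (real K)\<^sup>2 * bump K p"
      by (intro mult_left_mono) auto
    then have "- 30 / (real K)\<^sup>2 * bump K p \<le> - 8 / (real K)\<^sup>2" by simp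
    also have "- 8 / (real K)\<^sup>2 = - 4 / (real K)\<^sup>2 + - 4 / (real K)\<^sup>2" by simp
    also have "\<dots> \<le> ?d i + ?d (i + 1)"
    proof (rule add_mono)
      have "- 4 / (real K)\<^sup>2 \<le> 0" by simp
      then show "- 4 / (real K)\<^sup>2 \<le> ?d i" "- 4 / (real K)\<^sup>2 \<le> ?d (i + 1)"
        using c[of i] c[of "i + 1"] by linarith+
    qed
    finally show ?thesis unfolding sum .
  qed
qed

lemma bump_lipschitz:
  assumes "0 \<le> p" "0 < K"
  shows "\<bar>bump K (p + 2) - bump K p\<bar> \<le> 8 / real K"
proof (cases "int K \<le> p")
  case True
  then show ?thesis using bump_zero[of K p] bump_zero[of K "p + 2"] assms by simp
next
  case False
  define u where "u = (\<lambda>p::int. max 0 (1 - (of_int p / real K)\<^sup>2))"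
  have u: "0 \<le> u p" "u p \<le> 1" for p by (auto simp: u_def)
  have "\<bar>u (p + 2) - u p\<bar> \<le> \<bar>(of_int (p + 2) / real K)\<^sup>2 - (of_int p / real K)\<^sup>2\<bar>"
    unfolding u_def by linarith
  also have "(of_int (p + 2) / real K)\<^sup>2 - (of_int p / real K)\<^sup>2 = (4 * (of_int p + 1)) / (real K)\<^sup>2"
    by (simp add: power_divide power2_eq_square diff_divide_distrib[symmetric] algebra_simps)
  also have "\<bar>\<dots>\<bar> \<le> (4 * real K) / (real K)\<^sup>2"
  proof -
    have "real_of_int (p + 1) \<le> real_of_int (int K)" using False by (simp only: of_int_le_iff)
    then have "\<bar>4 * (real_of_int p + 1)\<bar> \<le> 4 * real K" using assms by simp
    then show ?thesis by (simp add: divide_right_mono)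
  qed
  also have "\<dots> = 4 / real K" by (simp add: power2_eq_square)
  finally have d: "\<bar>u (p + 2) - u p\<bar> \<le> 4 / real K" .
  have "bump K (p + 2) - bump K p = (u (p + 2) - u p) * (u (p + 2) + u p)"
    by (simp add: bump_def u_def power2_eq_square algebra_simps)
  then have "\<bar>bump K (p + 2) - bump K p\<bar> = \<bar>u (p + 2) - u p\<bar> * (u (p + 2) + u p)"
    using u by (simp add: abs_mult add_nonneg_nonneg)
  also have "\<dots> \<le> 4 / real K * 2"
    using d u[of p] u[of "p + 2"] by (intro mult_mono) auto
  finally show ?thesis by simp
qed

text \<open>Second-order expansion of \<open>1 / (f + B)\<close>, with the denominator of the remainder bounded below by \<open>B\<close>.\<close>

lemma inverse_shift_bound:
  fixes f f' B :: real
  assumes "0 < B" "0 \<le> f" "0 \<le> f'"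
  shows "1 / (f' + B) - 1 / (f + B) \<le> - (f' - f) / (f + B)\<^sup>2 + (f' - f)\<^sup>2 / ((f + B)\<^sup>2 * B)"
proof -
  have p: "0 < f + B" "0 < f' + B" using assms by auto
  have "1 / (f' + B) - 1 / (f + B) = - (f' - f) / (f + B)\<^sup>2 + (f' - f)\<^sup>2 / ((f + B)\<^sup>2 * (f' + B))"
  proof -
    define a b where "a = f + B" and "b = f' + B"
    have ab: "a \<noteq> 0" "b \<noteq> 0" "f' - f = b - a" using p by (auto simp: a_def b_def)
    have "1 / b - 1 / a = - (b - a) / a\<^sup>2 + (b - a)\<^sup>2 / (a\<^sup>2 * b)"
    proof -
      have "1 / b - 1 / a = (a - b) / (a * b)"
        using ab(1,2) by (simp add: diff_divide_distrib)
      also have "\<dots> = (a * (a - b)) / (a\<^sup>2 * b)"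
        using ab(1,2) by (simp add: power2_eq_square)
      also have "a * (a - b) = - (b - a) * b + (b - a)\<^sup>2"
        by (simp add: power2_eq_square algebra_simps)
      also have "(- (b - a) * b + (b - a)\<^sup>2) / (a\<^sup>2 * b) = - (b - a) / a\<^sup>2 + (b - a)\<^sup>2 / (a\<^sup>2 * b)"
        unfolding add_divide_distrib using ab(2) by simp
      finally show ?thesis .
    qed
    then show ?thesis unfolding ab(3) by (simp only: a_def b_def)
  qed
  also have "(f' - f)\<^sup>2 / ((f + B)\<^sup>2 * (f' + B)) \<le> (f' - f)\<^sup>2 / ((f + B)\<^sup>2 * B)"
    using assms p by (intro divide_left_mono mult_left_mono mult_pos_pos) auto
  finally show ?thesis by simp
qed

context fep_chain
begin

text \<open>Traps are never created, so this set is closed under the dynamics. On it, the target of a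
jump that fills a trap has weight \<open>0\<close>, so the weighted number of full bonds changes as if the full
bond had moved there instead of being annihilated.\<close>

definition late_traps :: "config set" where
  "late_traps = {\<xi> \<in> Omega N k. \<forall>j\<le>k. trap N \<xi> j = 0}"

definition pair_mass :: "config \<Rightarrow> real" where
  "pair_mass = pair_sum N (bump k)"

lemma pair_mass_nonneg: "\<xi> \<in> Omega N k \<Longrightarrow> 0 \<le> pair_mass \<xi>"
  unfolding pair_mass_def by (rule pair_sum_nonneg) (auto simp: bump_nonneg)

lemma late_traps_chain: "jump_chain late_traps (fep_moves N) fep_rate fep_move (real N)"
proof unfold_locales
  show "finite late_traps" using finite_Omega[of N k] by (simp add: late_traps_def)
  fix \<xi> assume l: "\<xi> \<in> late_traps"
  then have \<xi>: "\<xi> \<in> Omega N k" by (simp add: late_traps_def)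
  show "(\<Sum>i\<in>fep_moves N. fep_rate i \<xi>) \<le> real N" by (rule F.rate_sum[OF \<xi>])
  fix i assume i: "i \<in> fep_moves N"
  show "0 \<le> fep_rate i \<xi>" by (rule F.rate_nonneg[OF i \<xi>])
  show "fep_move i \<xi> \<in> late_traps" if r: "fep_rate i \<xi> \<noteq> 0"
  proof -
    have O: "fep_move i \<xi> \<in> Omega N k" by (rule F.move_closed[OF i \<xi> r])
    obtain x where x: "x \<in> {2..N-1}" and ix: "i = Inl x \<or> i = Inr x"
      using i by (auto simp: fep_moves_def)
    note v = Omega_neighbours[OF \<xi> x]
    have "trap N (fep_move i \<xi>) j \<le> trap N \<xi> j" for j
      using ix
    proof
      assume "i = Inl x"
      then have "\<xi> x \<noteq> 0" "\<xi> (x - 1) \<noteq> 0" "\<xi> (x + 1) \<noteq> 1" using r by (auto simp: fep_rate_def)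
      then have "\<xi> x = 1" "\<xi> (x - 1) = 1" "\<xi> (x + 1) = 0" using v by metis+
      then have "right_jump N \<xi> x" using x by (simp add: right_jump_def)
      from trap_move_le(1)[OF \<xi> this] show ?thesis unfolding \<open>i = Inl x\<close> fep_move_def sum.case .
    next
      assume "i = Inr x"
      then have "\<xi> x \<noteq> 0" "\<xi> (x + 1) \<noteq> 0" "\<xi> (x - 1) \<noteq> 1" using r by (auto simp: fep_rate_def)
      then have "\<xi> x = 1" "\<xi> (x + 1) = 1" "\<xi> (x - 1) = 0" using v by metis+
      then have "left_jump N \<xi> x" using x by (simp add: left_jump_def)
      from trap_move_le(2)[OF \<xi> this] show ?thesis unfolding \<open>i = Inr x\<close> fep_move_def sum.case .
    qed
    moreover have "trap N \<xi> j = 0" if "j \<le> k" for j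
      using l that unfolding late_traps_def by blast
    ultimately have le0: "trap N (fep_move i \<xi>) j \<le> 0" if "j \<le> k" for j
      using that by metis
    have "trap N (fep_move i \<xi>) j = 0" if "j \<le> k" for j
      using le0[OF that] trap_cases[OF O, of j] by linarith
    then show ?thesis using O unfolding late_traps_def by blast
  qed
qed (rule F.finite_moves F.c_pos)+

lemma pair_mass_changes:
  assumes l: "\<xi> \<in> late_traps"
  shows "right_jump N \<xi> x \<Longrightarrow>
      pair_mass (exchange \<xi> x (x + 1)) - pair_mass \<xi> = bump k (int x + 1) - bump k (int x - 1)"
    and "left_jump N \<xi> x \<Longrightarrow>
      pair_mass (exchange \<xi> x (x - 1)) - pair_mass \<xi> = bump k (int x - 2) - bump k (int x)"
proof -
  have \<xi>: "\<xi> \<in> Omega N k" and late: "\<And>j. j \<le> k \<Longrightarrow> trap N \<xi> j = 0"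
    using l by (auto simp: late_traps_def)
  have k0: "0 < k" by (simp add: k_eq)
  {
    assume jump: "right_jump N \<xi> x"
    note x = right_jumpD(1)[OF jump] and v = right_jumpD(2-4)[OF jump]
    have "occ N \<xi> (x + 2) * bump k (int x + 1) = bump k (int x + 1)"
    proof (cases "occ N \<xi> (x + 2) = 1")
      case False
      then have "trap N \<xi> (x + 1) = 1" using v occ_cases[OF \<xi>, of "x + 2"] by (auto simp: trap_def occ_def)
      then have "k < x + 1" using late[of "x + 1"] by (cases "x + 1 \<le> k") auto
      then have "bump k (int x + 1) = 0" using k0 by (intro bump_zero) auto
      then show ?thesis by simp
    qed simp
    then show "pair_mass (exchange \<xi> x (x + 1)) - pair_mass \<xi> = bump k (int x + 1) - bump k (int x - 1)"
      unfolding pair_mass_def pair_sum_right_move[OF jump] by simp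
  next
    assume jump: "left_jump N \<xi> x"
    note x = left_jumpD(1)[OF jump] and v = left_jumpD(2-4)[OF jump]
    have x2: "int (x - 2) = int x - 2" "Suc (x - 2) = x - 1" using x by auto
    have "occ N \<xi> (x - 2) * bump k (int x - 2) = bump k (int x - 2)"
    proof (cases "occ N \<xi> (x - 2) = 1")
      case False
      then have "trap N \<xi> (x - 2) = 1" using v occ_cases[OF \<xi>, of "x - 2"] x2(2) by (auto simp: trap_def occ_def)
      then have "k < x - 2" using late[of "x - 2"] by (cases "x - 2 \<le> k") auto
      then have "bump k (int (x - 2)) = 0" using k0 by (intro bump_zero) auto
      then show ?thesis unfolding x2 by simp
    qed simp
    then show "pair_mass (exchange \<xi> x (x - 1)) - pair_mass \<xi> = bump k (int x - 2) - bump k (int x)"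
      unfolding pair_mass_def pair_sum_left_move[OF jump] by simp
  }
qed

lemma pair_mass_drift:
  assumes \<xi>: "\<xi> \<in> Omega N k" and k: "20 \<le> k" "k < N"
  shows "- 60 / (real k)\<^sup>2 * pair_mass \<xi> \<le>
    (\<Sum>x=2..N-1. run_drift (full N \<xi>) (bump k) x)"
proof -
  let ?\<alpha> = "full N \<xi>" and ?\<phi> = "bump k"
  let ?g = "\<lambda>i. ?\<phi> (int i + 2) - ?\<phi> (int i + 1) - ?\<phi> (int i) + ?\<phi> (int i - 1)"
  \<comment> \<open>both boundary terms of the summation by parts vanish\<close>
  have sym: "?\<phi> (-1) = ?\<phi> 1" by (simp add: bump_def)
  have far: "?\<phi> (int N + 1) = 0" "?\<phi> (int N - 1) = 0"
    using k by (auto intro!: bump_zero)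
  have N2: "2 \<le> N" using n_pos N_eq by simp
  have f: "pair_mass \<xi> = (\<Sum>i<N. ?\<alpha> i * ?\<phi> (int i))"
    unfolding pair_mass_def pair_sum_def lessThan_Suc_atMost[symmetric] by simp
  have f': "pair_mass \<xi> = (\<Sum>i<N. ?\<alpha> (Suc i) * ?\<phi> (int i + 1))"
    unfolding pair_mass_def pair_sum_def by (subst sum.atMost_shift) (simp add: add.commute)
  have "- 60 / (real k)\<^sup>2 * pair_mass \<xi> = (\<Sum>i<N. - 30 / (real k)\<^sup>2 * (?\<alpha> i * ?\<phi> (int i)) + - 30 / (real k)\<^sup>2 * (?\<alpha> (Suc i) * ?\<phi> (int i + 1)))"
    unfolding sum.distrib sum_distrib_left[symmetric] f[symmetric] f'[symmetric] by simp
  also have "\<dots> \<le> (\<Sum>i<N. ?g i * (?\<alpha> i + ?\<alpha> (Suc i) - ?\<alpha> i * ?\<alpha> (Suc i)))"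
  proof (rule sum_mono)
    fix i assume "i \<in> {..<N}"
    have s: "- 30 / (real k)\<^sup>2 * ?\<phi> (int i) \<le> ?g i" "- 30 / (real k)\<^sup>2 * ?\<phi> (int i + 1) \<le> ?g i"
      using bump_subsolution[of "int i" k "int i"] bump_subsolution[of "int i" k "int i + 1"] k by auto
    have z: "- 30 / (real k)\<^sup>2 * ?\<phi> (int i) \<le> 0" "- 30 / (real k)\<^sup>2 * ?\<phi> (int i + 1) \<le> 0"
      using bump_nonneg by auto
    show "- 30 / (real k)\<^sup>2 * (?\<alpha> i * ?\<phi> (int i)) + - 30 / (real k)\<^sup>2 * (?\<alpha> (Suc i) * ?\<phi> (int i + 1))
        \<le> ?g i * (?\<alpha> i + ?\<alpha> (Suc i) - ?\<alpha> i * ?\<alpha> (Suc i))"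
      using full_cases[OF \<xi>, of i] full_cases[OF \<xi>, of "Suc i"]
    proof (elim disjE)
      assume a: "?\<alpha> i = 0" "?\<alpha> (Suc i) = 0"
      show ?thesis unfolding a by simp
    next
      assume a: "?\<alpha> i = 0" "?\<alpha> (Suc i) = 1"
      show ?thesis unfolding a using s(2) by simp
    next
      assume a: "?\<alpha> i = 1" "?\<alpha> (Suc i) = 0"
      show ?thesis unfolding a using s(1) by simp
    next
      assume a: "?\<alpha> i = 1" "?\<alpha> (Suc i) = 1"
      show ?thesis unfolding a using s(1) z(2) by simp
    qed
  qed
  finally show ?thesis
    using run_sum_interior[of N ?\<alpha> ?\<phi>] N2 unfolding sym far by simp
qed

text \<open>Markov's inequality for this function shows that the mass is unlikely to be small. The shift by
\<open>sqrt N\<close> is the size of the fluctuations of the mass and keeps the second-order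
term under control when the mass itself is smaller than that.\<close>

definition inverse_mass :: "config \<Rightarrow> real" where
  "inverse_mass \<xi> = 1 / (pair_mass \<xi> + sqrt (real N))"

text \<open>The first-order part of the drift is at most \<open>30 / k\<^sup>2\<close> times the function, since the
mass decays at rate at most \<open>60 / (2 k\<^sup>2)\<close>. A jump changes the mass by at most \<open>8 / k\<close>
and there are at most \<open>N\<close> possible jumps, each at rate \<open>1/2\<close>, so the second-order part is at most \<open>32 N / k\<^sup>2\<close> over \<open>M\<^sup>2 sqrt N\<close>, where
\<open>M \<ge> sqrt N\<close> is the shifted mass; this is at most \<open>32 / k\<^sup>2\<close> times \<open>1 / M\<close>.\<close>

lemma inverse_mass_drift:
  assumes l: "\<xi> \<in> late_traps" and k: "20 \<le> k" "k < N"
  shows "F.gen inverse_mass \<xi> \<le> 62 / (real k)\<^sup>2 * inverse_mass \<xi>"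
proof -
  have \<xi>: "\<xi> \<in> Omega N k" using l by (simp add: late_traps_def)
  let ?\<phi> = "bump k" and ?B = "sqrt (real N)" and ?r = "right_rate (full N \<xi>)" and ?l = "left_rate (full N \<xi>)"
  let ?\<Delta>r = "\<lambda>x. ?\<phi> (int x + 1) - ?\<phi> (int x - 1)" and ?\<Delta>l = "\<lambda>x. ?\<phi> (int x - 2) - ?\<phi> (int x)"
  define f where "f = pair_mass \<xi>"
  define M where "M = f + ?B"
  define w where "w = 64 / (real k)\<^sup>2 / (M\<^sup>2 * ?B)"
  have k0: "0 < real k" and N0: "0 < real N" and B: "0 < ?B" using k by auto
  have f0: "0 \<le> f" unfolding f_def by (rule pair_mass_nonneg[OF \<xi>])
  have M: "0 < M" "?B \<le> M" "f \<le> M" unfolding M_def using f0 B by linarith+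
  have change: "inverse_mass \<zeta> - inverse_mass \<xi> \<le> - \<Delta> / M\<^sup>2 + w"
    if \<zeta>: "\<zeta> \<in> Omega N k" and d: "pair_mass \<zeta> - pair_mass \<xi> = \<Delta>" "\<bar>\<Delta>\<bar> \<le> 8 / real k" for \<zeta> \<Delta>
  proof -
    have "inverse_mass \<zeta> - inverse_mass \<xi> \<le> - \<Delta> / M\<^sup>2 + \<Delta>\<^sup>2 / (M\<^sup>2 * ?B)"
      using inverse_shift_bound[OF B f0 pair_mass_nonneg[OF \<zeta>]] d(1)
      unfolding inverse_mass_def f_def M_def by simp
    also have "\<Delta>\<^sup>2 / (M\<^sup>2 * ?B) \<le> w"
    proof -
      have "\<bar>\<Delta>\<bar>\<^sup>2 \<le> (8 / real k)\<^sup>2" using d(2) by (intro power_mono) auto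
      then have "\<Delta>\<^sup>2 \<le> 64 / (real k)\<^sup>2" by (simp add: power_divide)
      then show ?thesis unfolding w_def using B by (intro divide_right_mono) auto
    qed
    finally show ?thesis by simp
  qed
  have "F.gen inverse_mass \<xi> \<le> 1/2 * (\<Sum>x=2..N-1. ?r x * (- ?\<Delta>r x / M\<^sup>2 + w) + ?l x * (- ?\<Delta>l x / M\<^sup>2 + w))"
    unfolding fep_generator_jump_gen[symmetric]
  proof (rule fep_generator_le[OF \<xi>])
    fix x assume jump: "right_jump N \<xi> x"
    note x = right_jumpD(1)[OF jump] and v = right_jumpD(2-4)[OF jump]
    show "inverse_mass (exchange \<xi> x (x + 1)) - inverse_mass \<xi> \<le> - ?\<Delta>r x / M\<^sup>2 + w"
    proof (rule change)
      show "exchange \<xi> x (x + 1) \<in> Omega N k" by (rule jump_Omega(1)[OF \<xi> jump])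
      show "pair_mass (exchange \<xi> x (x + 1)) - pair_mass \<xi> = ?\<Delta>r x"
        by (rule pair_mass_changes(1)[OF l jump])
      show "\<bar>?\<Delta>r x\<bar> \<le> 8 / real k"
        using bump_lipschitz[of "int x - 1" k] x k by (simp add: algebra_simps)
    qed
  next
    fix x assume jump: "left_jump N \<xi> x"
    note x = left_jumpD(1)[OF jump] and v = left_jumpD(2-4)[OF jump]
    show "inverse_mass (exchange \<xi> x (x - 1)) - inverse_mass \<xi> \<le> - ?\<Delta>l x / M\<^sup>2 + w"
    proof (rule change)
      show "exchange \<xi> x (x - 1) \<in> Omega N k" by (rule jump_Omega(2)[OF \<xi> jump])
      show "pair_mass (exchange \<xi> x (x - 1)) - pair_mass \<xi> = ?\<Delta>l x"
        by (rule pair_mass_changes(2)[OF l jump])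
      show "\<bar>?\<Delta>l x\<bar> \<le> 8 / real k"
        using bump_lipschitz[of "int x - 2" k] x k by (simp add: abs_minus_commute)
    qed
  qed
  also have "(\<Sum>x=2..N-1. ?r x * (- ?\<Delta>r x / M\<^sup>2 + w) + ?l x * (- ?\<Delta>l x / M\<^sup>2 + w))
     = - (\<Sum>x=2..N-1. ?r x * ?\<Delta>r x + ?l x * ?\<Delta>l x) / M\<^sup>2 + w * (\<Sum>x=2..N-1. ?r x + ?l x)"
  proof -
    have "?r x * (- ?\<Delta>r x / M\<^sup>2 + w) + ?l x * (- ?\<Delta>l x / M\<^sup>2 + w)
      = - (?r x * ?\<Delta>r x + ?l x * ?\<Delta>l x) / M\<^sup>2 + w * (?r x + ?l x)" for x
      by (simp add: diff_divide_distrib add_divide_distrib algebra_simps)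
    then have "(\<Sum>x=2..N-1. ?r x * (- ?\<Delta>r x / M\<^sup>2 + w) + ?l x * (- ?\<Delta>l x / M\<^sup>2 + w))
      = (\<Sum>x=2..N-1. - (?r x * ?\<Delta>r x + ?l x * ?\<Delta>l x) / M\<^sup>2 + w * (?r x + ?l x))"
      by (intro sum.cong refl)
    then show ?thesis
      unfolding sum_distrib_left sum_negf[symmetric] sum_divide_distrib sum.distrib[symmetric] .
  qed
  also have "\<dots> \<le> (60 / (real k)\<^sup>2 * M) / M\<^sup>2 + w * real N"
  proof (intro add_mono divide_right_mono mult_left_mono)
    have "- (\<Sum>x=2..N-1. ?r x * ?\<Delta>r x + ?l x * ?\<Delta>l x) \<le> 60 / (real k)\<^sup>2 * f"
      using pair_mass_drift[OF \<xi> k] by (simp add: f_def run_drift_def)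
    also have "\<dots> \<le> 60 / (real k)\<^sup>2 * M" using M by (intro mult_left_mono) auto
    finally show "- (\<Sum>x=2..N-1. ?r x * ?\<Delta>r x + ?l x * ?\<Delta>l x) \<le> 60 / (real k)\<^sup>2 * M" .
    have "?r x + ?l x \<le> 1" for x
      using full_cases[OF \<xi>, of x] full_cases[OF \<xi>, of "x - 1"] by (auto simp: right_rate_def left_rate_def)
    then have "(\<Sum>x=2..N-1. ?r x + ?l x) \<le> (\<Sum>x=2..N-1. 1)" by (intro sum_mono)
    also have "\<dots> \<le> real N" by simp
    finally show "(\<Sum>x=2..N-1. ?r x + ?l x) \<le> real N" .
    show "0 \<le> w" using B by (simp add: w_def)
  qed simp
  also have "(60 / (real k)\<^sup>2 * M) / M\<^sup>2 + w * real N \<le> 60 / (real k)\<^sup>2 * (1 / M) + 64 / (real k)\<^sup>2 * (1 / M)"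
  proof (rule add_mono)
    show "(60 / (real k)\<^sup>2 * M) / M\<^sup>2 \<le> 60 / (real k)\<^sup>2 * (1 / M)"
      using M(1) by (simp add: power2_eq_square)
    have "real N / (M\<^sup>2 * ?B) = ?B / M\<^sup>2"
    proof -
      have "real N = ?B * ?B" by simp
      then have "real N / (M\<^sup>2 * ?B) = (?B * ?B) / (M\<^sup>2 * ?B)" by (rule arg_cong[where f = "\<lambda>x. x / (M\<^sup>2 * ?B)"])
      also have "(?B * ?B) / (M\<^sup>2 * ?B) = ?B / M\<^sup>2"
        by (rule nonzero_mult_divide_mult_cancel_right) (use B in linarith)
      finally show ?thesis .
    qed
    also have "\<dots> \<le> M / M\<^sup>2" using M by (intro divide_right_mono) auto
    also have "\<dots> = 1 / M" using M(1) by (simp add: power2_eq_square)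
    finally have "64 / (real k)\<^sup>2 * (real N / (M\<^sup>2 * ?B)) \<le> 64 / (real k)\<^sup>2 * (1 / M)"
      by (intro mult_left_mono) auto
    then show "w * real N \<le> 64 / (real k)\<^sup>2 * (1 / M)" by (simp add: w_def)
  qed
  finally have "F.gen inverse_mass \<xi> \<le> 1/2 * (60 / (real k)\<^sup>2 * (1 / M) + 64 / (real k)\<^sup>2 * (1 / M))" by simp
  also have "\<dots> = 62 / (real k)\<^sup>2 * (1 / M)" by (simp add: algebra_simps)
  finally show ?thesis by (simp add: inverse_mass_def M_def f_def)
qed

definition packed :: config where
  "packed = (\<lambda>x\<in>{1..N}. if x \<le> k then 1 else 0)"

lemma packed_occ: "k \<le> N \<Longrightarrow> occ N packed x = of_bool (x \<in> {1..k})"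
  by (auto simp: packed_def occ_def)

lemma packed_late: "packed \<in> late_traps"
proof -
  have kN: "k \<le> N" by (simp add: k_eq N_eq)
  have "(\<Sum>x=1..N. packed x) = (\<Sum>x\<in>{1..k}. 1)"
    using kN by (intro sum.mono_neutral_cong_right) (auto simp: packed_def)
  then have "packed \<in> Omega N k"
    by (auto simp: Omega_def packed_def)
  moreover have "trap N packed j = 0" if "j \<le> k" for j
    using that packed_occ[OF kN, of j] packed_occ[OF kN, of "j + 1"] k_eq by (auto simp: trap_def)
  ultimately show ?thesis by (simp add: late_traps_def)
qed

lemma packed_mass:
  assumes "20 \<le> k"
  shows "real N / 16 \<le> pair_mass packed"
proof -
  have kN: "k \<le> N" "N \<le> 2 * k" using m_le by (auto simp: k_eq N_eq)
  have "(\<Sum>a\<in>{1..k div 2}. 1/2) \<le> (\<Sum>a\<in>{1..k div 2}. full N packed a * bump k (int a))"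
  proof (rule sum_mono)
    fix a assume a: "a \<in> {1..k div 2}"
    have "full N packed a = 1"
      using a packed_occ[OF kN(1), of a] packed_occ[OF kN(1), of "a + 1"] assms by (auto simp: full_def)
    moreover have "1/2 \<le> bump k (int a)"
    proof -
      have "2 * a \<le> k" using a by auto
      then have "real (2 * a) \<le> real k" by (simp only: of_nat_le_iff)
      then have "real a / real k \<le> 1/2" using assms by (simp add: field_simps)
      then have "(real a / real k)\<^sup>2 \<le> (1/2)\<^sup>2" by (intro power_mono) auto
      moreover have "(1/2 :: real)\<^sup>2 = 1/4" by (simp add: power2_eq_square)
      ultimately have h: "3/4 \<le> max 0 (1 - (of_int (int a) / real k)\<^sup>2)"
        unfolding of_int_of_nat_eq by linarith
      have "(3/4)\<^sup>2 \<le> bump k (int a)" unfolding bump_def by (rule power_mono[OF h]) simp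
      then show ?thesis by (simp add: power2_eq_square)
    qed
    ultimately show "1/2 \<le> full N packed a * bump k (int a)" by simp
  qed
  also have "\<dots> \<le> pair_mass packed"
  proof -
    have "packed \<in> Omega N k" using packed_late by (simp add: late_traps_def)
    then have "0 \<le> full N packed a * bump k (int a)" for a
      using full_cases[of packed N k a] bump_nonneg[of k "int a"] by auto
    then show ?thesis
      unfolding pair_mass_def pair_sum_def using kN by (intro sum_mono2) auto
  qed
  finally have "real (k div 2) / 2 \<le> pair_mass packed" by simp
  moreover have "real N / 16 \<le> real (k div 2) / 2"
  proof -
    have "N \<le> 8 * (k div 2)" using kN assms by linarith
    then have "real N \<le> real (8 * (k div 2))" by (simp only: of_nat_le_iff)
    then show ?thesis by simp
  qed
  ultimately show ?thesis by linarith
qed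

lemma ergodic_mass:
  assumes "\<xi> \<in> E"
  shows "pair_mass \<xi> \<le> real (n - m)"
proof -
  have \<xi>: "\<xi> \<in> Omega N k" using assms E_subset by auto
  have "pair_mass \<xi> \<le> (\<Sum>a\<le>N. full N \<xi> a)"
    unfolding pair_mass_def pair_sum_def
  proof (rule sum_mono)
    show "full N \<xi> a * bump k (int a) \<le> full N \<xi> a" for a
      using full_cases[OF \<xi>, of a] bump_le_1[of k "int a"] by auto
  qed
  moreover have "(\<Sum>x\<le>N. trap N \<xi> x) = 0"
    using ergodic_iff_no_trap[OF \<xi>] assms N_eq by simp
  ultimately show ?thesis
    using sum_full_minus_trap[OF \<xi>] m_le by (simp add: N_eq k_eq of_nat_diff)
qed

lemma equi_prob_E: "equi_prob E = 1"
  using card_X_pos by (simp add: equi_prob_def card_E)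

text \<open>On the ergodic component there are exactly \<open>n - m\<close> full bonds, so \<open>inverse_mass\<close> is large there.
Started from the packed configuration it is initially of order \<open>1 / N\<close> and grows at rate at most
\<open>62 / k\<^sup>2 \<le> 248 / N\<^sup>2\<close>.\<close>

lemma worst_dist_transient:
  assumes m: "1 \<le> m" and k: "20 \<le> k" and t: "0 \<le> t"
  shows "1 - 16 * (real (n - m) + sqrt (real N)) / real N * exp (248 * t / (real N)\<^sup>2) \<le> worst_dist N k t"
proof -
  interpret G: jump_chain late_traps "fep_moves N" fep_rate fep_move "real N"
    by (rule late_traps_chain)
  let ?D = "real (n - m) + sqrt (real N)"
  have kN: "k < N" using m by (simp add: k_eq N_eq)
  have N0: "0 < real N" using kN by simp
  have B: "0 < sqrt (real N)" using N0 by simp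
  have O: "packed \<in> Omega N k" using packed_late by (simp add: late_traps_def)
  have "F.P t (\<lambda>\<zeta>. of_bool (\<zeta> \<in> E)) packed \<le> F.P t (\<lambda>\<zeta>. ?D * inverse_mass \<zeta>) packed"
  proof (rule F.P_mono[OF _ O t])
    fix \<zeta> assume \<zeta>: "\<zeta> \<in> Omega N k"
    have p: "0 < pair_mass \<zeta> + sqrt (real N)" using pair_mass_nonneg[OF \<zeta>] B by linarith
    show "of_bool (\<zeta> \<in> E) \<le> ?D * inverse_mass \<zeta>"
      using ergodic_mass[of \<zeta>] p by (auto simp: inverse_mass_def le_divide_eq)
  qed
  also have "\<dots> = ?D * F.P t inverse_mass packed" by (rule F.P_scale[OF O])
  also have "\<dots> \<le> ?D * (exp (248 * t / (real N)\<^sup>2) * (16 / real N))"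
  proof (rule mult_left_mono)
    have "F.P t inverse_mass packed \<le> exp (62 / (real k)\<^sup>2 * t) * inverse_mass packed"
    proof (rule G.P_lyapunov[OF _ _ packed_late t])
      have "0 \<le> 62 / (real k)\<^sup>2" by simp
      then show "- real N \<le> 62 / (real k)\<^sup>2" using N0 by linarith
    qed (rule inverse_mass_drift[OF _ k kN])
    also have "\<dots> \<le> exp (248 * t / (real N)\<^sup>2) * (16 / real N)"
    proof (rule mult_mono)
      have "real N \<le> 2 * real k" using m_le by (simp add: k_eq N_eq)
      then have "(real N)\<^sup>2 \<le> (2 * real k)\<^sup>2" by (intro power_mono) auto
      then have "(real N)\<^sup>2 / 4 \<le> (real k)\<^sup>2" by (simp add: power_mult_distrib)
      then have "62 / (real k)\<^sup>2 \<le> 62 / ((real N)\<^sup>2 / 4)"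
        using N0 kN k by (intro divide_left_mono mult_pos_pos) auto
      then have "62 / (real k)\<^sup>2 * t \<le> 62 / ((real N)\<^sup>2 / 4) * t" using t by (rule mult_right_mono)
      then show "exp (62 / (real k)\<^sup>2 * t) \<le> exp (248 * t / (real N)\<^sup>2)" by simp
      have "1 / (pair_mass packed + sqrt (real N)) \<le> 1 / (real N / 16)"
      proof (rule divide_left_mono)
        show "real N / 16 \<le> pair_mass packed + sqrt (real N)" using packed_mass[OF k] B by linarith
        then show "0 < (pair_mass packed + sqrt (real N)) * (real N / 16)"
          using N0 by (intro mult_pos_pos) linarith+
      qed simp
      then show "inverse_mass packed \<le> 16 / real N" by (simp add: inverse_mass_def)
      show "0 \<le> inverse_mass packed" using pair_mass_nonneg[OF O] by (simp add: inverse_mass_def)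
    qed auto
    finally show "F.P t inverse_mass packed \<le> exp (248 * t / (real N)\<^sup>2) * (16 / real N)" .
  qed simp
  finally have "F.P t (\<lambda>\<zeta>. of_bool (\<zeta> \<in> E)) packed \<le> ?D * (exp (248 * t / (real N)\<^sup>2) * (16 / real N))" .
  note le = this
  have "F.P t (\<lambda>\<zeta>. of_bool (\<zeta> \<in> E)) packed \<le> 16 * ?D / real N * exp (248 * t / (real N)\<^sup>2)"
  proof -
    have "d * (e * (16 / real N)) = 16 * d / real N * e" for d e by simp
    then show ?thesis using le by (simp only:)
  qed
  then show ?thesis
    using worst_dist_ge[OF O E_subset, of t] unfolding equi_prob_E by linarith
qed

end

section \<open>Lower bound from the slowest wave of the exclusion process\<close>

text \<open>A weak form of Jordan's inequality, from \<open>sin x \<ge> x - x ^ 3 / 6\<close> and \<open>x \<le> 2\<close>.\<close>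

lemma sin_ge_third:
  fixes x :: real
  assumes "0 \<le> x" "x \<le> pi / 2"
  shows "x / 3 \<le> sin x"
proof -
  have "\<bar>sin x - (\<Sum>m<3. sin_coeff m * x ^ m)\<bar> \<le> inverse (fact 3) * \<bar>x\<bar> ^ 3"
    by (rule Maclaurin_sin_bound)
  moreover have "(\<Sum>m<3. sin_coeff m * x ^ m) = x"
    by (simp add: numeral_3_eq_3 sin_coeff_def)
  moreover have "inverse (fact 3) * \<bar>x\<bar> ^ 3 = x ^ 3 / 6"
    using assms by (simp add: fact_numeral)
  moreover have "x ^ 3 \<le> 4 * x"
  proof -
    have "x \<le> 2" using assms pi_less_4 by linarith
    then have "x\<^sup>2 \<le> 2\<^sup>2" using assms by (intro power_mono)
    then have "x\<^sup>2 * x \<le> 4 * x" using assms by (intro mult_right_mono) auto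
    then show ?thesis by (simp add: power2_eq_square power3_eq_cube)
  qed
  ultimately show ?thesis by linarith
qed

lemma abs_cos_diff_le: "\<bar>cos x - cos y\<bar> \<le> \<bar>x - y\<bar>" for x y :: real
proof -
  have "\<bar>cos x - cos y\<bar> = 2 * \<bar>sin ((x + y) / 2)\<bar> * \<bar>sin ((y - x) / 2)\<bar>"
    by (simp add: cos_diff_cos abs_mult)
  also have "\<dots> \<le> 2 * 1 * \<bar>(y - x) / 2\<bar>"
    by (intro mult_mono abs_sin_x_le_abs_x) auto
  finally show ?thesis by simp
qed

context fep_chain
begin

text \<open>The wave below is the slowest eigenfunction of a single walker that is reflected at the ends of \<open>{1..n}\<close>.
Summed over the particles, it is an eigenfunction of the exclusion process with the same eigenvalue
\<open>- gap\<close>, because stirring moves each particle as a simple random walk.\<close>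

definition \<theta> :: real where "\<theta> = pi / real n"

definition wave :: "real \<Rightarrow> real" where "wave x = cos (\<theta> * (x - 1/2))"

definition wave_sum :: "nat set \<Rightarrow> real" where "wave_sum S = (\<Sum>s\<in>S. wave (real s))"

definition gap :: real where "gap = 1 - cos \<theta>"

lemma \<theta>_pos: "0 < \<theta>" and \<theta>_n: "\<theta> * real n = pi"
  using n_pos by (simp_all add: \<theta>_def)

lemma gap_sin: "gap = 2 * (sin (\<theta> / 2))\<^sup>2"
  using cos_double_sin[of "\<theta> / 2"] by (simp add: gap_def)

lemma half_\<theta>: "0 \<le> \<theta> / 2" "\<theta> / 2 \<le> pi / 2"
proof -
  show "0 \<le> \<theta> / 2" using \<theta>_pos by simp
  have "\<theta> * 1 \<le> \<theta> * real n" using \<theta>_pos n_pos by (intro mult_left_mono) auto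
  then show "\<theta> / 2 \<le> pi / 2" using \<theta>_n by simp
qed

lemma gap_bounds: "\<theta>\<^sup>2 / 18 \<le> gap" "gap \<le> 8 / (real n)\<^sup>2"
proof -
  have "(\<theta> / 2 / 3)\<^sup>2 \<le> (sin (\<theta> / 2))\<^sup>2"
    using half_\<theta> by (intro power_mono sin_ge_third) auto
  then show "\<theta>\<^sup>2 / 18 \<le> gap" by (simp add: gap_sin power_divide)
  have "0 \<le> sin (\<theta> / 2)" using half_\<theta> by (intro sin_ge_zero) auto
  then have "(sin (\<theta> / 2))\<^sup>2 \<le> (\<theta> / 2)\<^sup>2"
    using half_\<theta> by (intro power_mono sin_x_le_x) auto
  then have "gap \<le> \<theta>\<^sup>2 / 2" by (simp add: gap_sin power_divide)
  also have "\<dots> = pi\<^sup>2 / (2 * (real n)\<^sup>2)" by (simp add: \<theta>_def power_divide)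
  also have "\<dots> \<le> 4\<^sup>2 / (2 * (real n)\<^sup>2)"
    using pi_less_4 pi_ge_zero by (intro divide_right_mono power_mono) auto
  finally show "gap \<le> 8 / (real n)\<^sup>2" by simp
qed

lemma gap_pos: "0 < gap"
proof -
  have "0 < \<theta>\<^sup>2 / 18" using \<theta>_pos by simp
  then show ?thesis using gap_bounds(1) by linarith
qed

lemma wave_second_difference: "wave (x + 1) + wave (x - 1) - 2 * wave x = - 2 * gap * wave x"
proof -
  have e: "\<theta> * (x + 1 - 1/2) = \<theta> * (x - 1/2) + \<theta>" "\<theta> * (x - 1 - 1/2) = \<theta> * (x - 1/2) - \<theta>"
    by (simp_all add: algebra_simps)
  show ?thesis unfolding wave_def gap_def e cos_add cos_diff by (simp add: algebra_simps)
qed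

lemma wave_left: "wave 0 = wave 1"
  by (simp add: wave_def)

lemma wave_right: "wave (real n + 1) = wave (real n)"
proof -
  have e: "\<theta> * (real n + 1 - 1/2) = pi + \<theta> / 2" "\<theta> * (real n - 1/2) = pi - \<theta> / 2"
    using \<theta>_n by (simp_all add: algebra_simps)
  show ?thesis unfolding wave_def e by simp
qed

lemma wave_sum_swap: "wave_sum (swap_at i S) = (\<Sum>s\<in>S. wave (real (transp i s)))"
  unfolding wave_sum_def swap_at_def
  by (subst sum.reindex) (auto intro: inj_on_subset[OF inj_transpose])

lemma wave_moves:
  assumes s: "s \<in> {1..n}"
  shows "(\<Sum>i\<in>{1..<n}. wave (real (transp i s)) - wave (real s)) = - 2 * gap * wave (real s)"
proof -
  let ?u = "wave (real s + 1) - wave (real s)" and ?d = "wave (real s - 1) - wave (real s)"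
  have "(\<Sum>i\<in>{1..<n}. wave (real (transp i s)) - wave (real s))
     = (\<Sum>i\<in>{1..<n}. (if i = s then ?u else 0) + (if i = s - 1 then ?d else 0))"
  proof (rule sum.cong[OF refl])
    fix i assume i: "i \<in> {1..<n}"
    consider "i = s" | "Suc i = s" | "i \<noteq> s" "Suc i \<noteq> s" by blast
    then show "wave (real (transp i s)) - wave (real s)
       = (if i = s then ?u else 0) + (if i = s - 1 then ?d else 0)"
    proof cases
      case 1
      moreover have "s \<noteq> s - 1" using s by auto
      ultimately show ?thesis by (simp add: add.commute)
    next
      case 2
      then have "real s - 1 = real i" "i = s - 1" by auto
      then show ?thesis using 2 by simp
    next
      case 3
      then show ?thesis using s by auto
    qed
  qed
  also have "\<dots> = (if s < n then ?u else 0) + (if 1 < s then ?d else 0)"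
    using s by (auto simp: sum.distrib)
  also have "\<dots> = ?u + ?d"
  proof -
    have "(if s < n then ?u else 0) = ?u"
    proof (cases "s < n")
      case False
      then have "s = n" using s by simp
      then show ?thesis using wave_right by simp
    qed simp
    moreover have "(if 1 < s then ?d else 0) = ?d"
    proof (cases "1 < s")
      case False
      then have "s = 1" using s by simp
      then show ?thesis using wave_left by simp
    qed simp
    ultimately show ?thesis by simp
  qed
  also have "\<dots> = - 2 * gap * wave (real s)"
    using wave_second_difference[of "real s"] by simp
  finally show ?thesis .
qed

lemma wave_sum_eigen:
  assumes S: "S \<in> X"
  shows "ssep_gen n wave_sum S = - gap * wave_sum S"
proof -
  have "ssep_gen n wave_sum S = (\<Sum>i\<in>{1..<n}. \<Sum>s\<in>S. 1/2 * (wave (real (transp i s)) - wave (real s)))"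
    unfolding ssep_gen_sum wave_sum_swap unfolding wave_sum_def
    by (simp only: sum_subtractf sum_distrib_left right_diff_distrib)
  also have "\<dots> = (\<Sum>s\<in>S. 1/2 * (\<Sum>i\<in>{1..<n}. wave (real (transp i s)) - wave (real s)))"
    by (subst sum.swap) (simp only: sum_distrib_left)
  also have "\<dots> = (\<Sum>s\<in>S. - gap * wave (real s))"
    using S wave_moves by (intro sum.cong refl) (auto simp: ssep_states_def)
  finally show ?thesis by (simp add: wave_sum_def sum_distrib_left)
qed

definition minority :: real where "minority = real (min m (n - m))"

text \<open>Each edge in the sum has one end in \<open>S\<close> and one in the complement, and every site has at most two
edges.\<close>

lemma boundary_edges:
  assumes S: "S \<in> X"
  shows "(\<Sum>i\<in>{1..<n}. of_bool ((i \<in> S) \<noteq> (Suc i \<in> S))) \<le> 2 * minority"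
proof -
  have count: "(\<Sum>i\<in>{1..<n}. of_bool (i \<in> U) + of_bool (Suc i \<in> U)) \<le> 2 * real (card U)" if "U \<subseteq> {1..n}" for U
  proof -
    have fin: "finite U" using that finite_subset by blast
    have card: "(\<Sum>i\<in>A. of_bool (i \<in> U)) = real (card (A \<inter> U))" if "finite A" for A :: "nat set"
      using that by (simp add: of_bool_def sum.If_cases)
    have "(\<Sum>i\<in>{1..<n}. of_bool (i \<in> U)) = real (card ({1..<n} \<inter> U))"
      by (intro card) auto
    also have "\<dots> \<le> real (card U)" using fin by (simp add: card_mono)
    finally have a: "(\<Sum>i\<in>{1..<n}. of_bool (i \<in> U)) \<le> real (card U)" .
    have "(\<Sum>i\<in>{1..<n}. of_bool (Suc i \<in> U)) = (\<Sum>i\<in>Suc ` {1..<n}. of_bool (i \<in> U) :: real)"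
      by (subst sum.reindex) auto
    also have "\<dots> = real (card (Suc ` {1..<n} \<inter> U))"
      by (intro card) auto
    also have "\<dots> \<le> real (card U)" unfolding of_nat_le_iff by (intro card_mono fin) auto
    finally show ?thesis using a by (simp add: sum.distrib)
  qed
  have sub: "S \<subseteq> {1..n}" "card S = m" using S by (auto simp: ssep_states_def)
  have c: "card ({1..n} - S) = n - m" using sub by (simp add: card_Diff_subset finite_subset)
  have "(\<Sum>i\<in>{1..<n}. of_bool ((i \<in> S) \<noteq> (Suc i \<in> S))) \<le> (\<Sum>i\<in>{1..<n}. of_bool (i \<in> S) + of_bool (Suc i \<in> S) :: real)"
    by (intro sum_mono) auto
  also have "\<dots> \<le> 2 * real m" using count[OF sub(1)] sub(2) by simp
  finally have 1: "(\<Sum>i\<in>{1..<n}. of_bool ((i \<in> S) \<noteq> (Suc i \<in> S))) \<le> 2 * real m" .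
  have "(\<Sum>i\<in>{1..<n}. of_bool ((i \<in> S) \<noteq> (Suc i \<in> S))) \<le> (\<Sum>i\<in>{1..<n}. of_bool (i \<in> {1..n} - S) + of_bool (Suc i \<in> {1..n} - S) :: real)"
    by (intro sum_mono) auto
  also have "\<dots> \<le> 2 * real (n - m)" using count[of "{1..n} - S"] c by simp
  finally show ?thesis using 1 by (simp add: minority_def)
qed

lemma wave_sum_jump:
  assumes S: "S \<in> X"
  shows "(wave_sum (swap_at i S) - wave_sum S)\<^sup>2 \<le> \<theta>\<^sup>2 * of_bool ((i \<in> S) \<noteq> (Suc i \<in> S))"
proof (cases "(i \<in> S) = (Suc i \<in> S)")
  case True
  then show ?thesis by (simp add: swap_at_id)
next
  case False
  have fin: "finite S" using S finite_subset[of S "{1..n}"] by (auto simp: ssep_states_def)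
  have w: "\<bar>wave (real (Suc i)) - wave (real i)\<bar> \<le> \<theta>"
  proof -
    have "\<bar>wave (real (Suc i)) - wave (real i)\<bar> \<le> \<bar>\<theta> * (real (Suc i) - 1/2) - \<theta> * (real i - 1/2)\<bar>"
      unfolding wave_def by (rule abs_cos_diff_le)
    also have "\<theta> * (real (Suc i) - 1/2) - \<theta> * (real i - 1/2) = \<theta>" by (simp add: algebra_simps)
    finally show ?thesis using \<theta>_pos by simp
  qed
  have "\<bar>wave_sum (swap_at i S) - wave_sum S\<bar> = \<bar>wave (real (Suc i)) - wave (real i)\<bar>"
  proof (cases "i \<in> S")
    case True
    then have "Suc i \<notin> S" using False by simp
    then show ?thesis using True fin by (simp add: swap_at_out wave_sum_def sum_diff1)
  next
    case ni: False
    then have "Suc i \<in> S" using False by simp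
    then show ?thesis using ni fin by (simp add: swap_at_in wave_sum_def sum_diff1 abs_minus_commute)
  qed
  then have "\<bar>wave_sum (swap_at i S) - wave_sum S\<bar>\<^sup>2 \<le> \<theta>\<^sup>2"
    using w by (intro power_mono) auto
  then show ?thesis using False by simp
qed

text \<open>The drift of the square of an eigenfunction is \<open>- 2 gap\<close> times the square plus the sum of the
squared jumps times their rates. At most \<open>2 minority\<close> edges contribute, each at most \<open>\<theta>\<^sup>2 / 2\<close>, and \<open>\<theta>\<^sup>2 \<le> 18 gap\<close>.
Hence the variance of the wave sum stays below \<open>9 minority\<close> at all times and in equilibrium.\<close>

lemma wave_sum_square_drift:
  assumes S: "S \<in> X"
  shows "ssep_gen n (\<lambda>S. (wave_sum S)\<^sup>2 - 9 * minority) S \<le> - 2 * gap * ((wave_sum S)\<^sup>2 - 9 * minority)"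
proof -
  let ?W = wave_sum and ?d = "\<lambda>i. wave_sum (swap_at i S) - wave_sum S"
  have "(?W (swap_at i S))\<^sup>2 - 9 * minority - ((?W S)\<^sup>2 - 9 * minority) = 2 * ?W S * ?d i + (?d i)\<^sup>2" for i
    by (simp add: power2_eq_square algebra_simps)
  then have "ssep_gen n (\<lambda>S. (?W S)\<^sup>2 - 9 * minority) S = (\<Sum>i\<in>{1..<n}. 1/2 * (2 * ?W S * ?d i + (?d i)\<^sup>2))"
    unfolding ssep_gen_sum by (simp only:)
  also have "\<dots> = 2 * ?W S * ssep_gen n ?W S + 1/2 * (\<Sum>i\<in>{1..<n}. (?d i)\<^sup>2)"
    unfolding ssep_gen_sum sum_distrib_left sum.distrib[symmetric]
    by (intro sum.cong refl) (simp add: algebra_simps)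
  also have "(\<Sum>i\<in>{1..<n}. (?d i)\<^sup>2) \<le> (\<Sum>i\<in>{1..<n}. \<theta>\<^sup>2 * of_bool ((i \<in> S) \<noteq> (Suc i \<in> S)))"
    by (intro sum_mono wave_sum_jump S)
  also have "\<dots> \<le> \<theta>\<^sup>2 * (2 * minority)"
    using boundary_edges[OF S] unfolding sum_distrib_left[symmetric] by (intro mult_left_mono) auto
  also have "\<theta>\<^sup>2 * (2 * minority) \<le> 18 * gap * (2 * minority)"
    using gap_bounds(1) by (intro mult_right_mono) (auto simp: minority_def)
  finally show ?thesis unfolding wave_sum_eigen[OF S] by (simp add: power2_eq_square algebra_simps)
qed

text \<open>The sum of the cosines telescopes to \<open>sin (\<theta> m) / (2 sin (\<theta> / 2))\<close>.\<close>

lemma initial_wave_sum: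
  shows "minority / 3 \<le> wave_sum {1..m}"
proof -
  have tele: "2 * sin (\<theta> / 2) * wave_sum {1..l} = sin (\<theta> * real l)" for l
  proof (induction l)
    case (Suc l)
    have "wave_sum {1..Suc l} = wave_sum {1..l} + wave (real l + 1)"
      by (simp add: wave_sum_def add.commute)
    moreover have "2 * sin (\<theta> / 2) * wave (real l + 1) = sin (\<theta> * real (Suc l)) - sin (\<theta> * real l)"
    proof -
      have e: "\<theta> * real (Suc l) = \<theta> * (real l + 1 - 1/2) + \<theta> / 2" "\<theta> * real l = \<theta> * (real l + 1 - 1/2) - \<theta> / 2"
        by (simp_all add: algebra_simps)
      show ?thesis unfolding e sin_add sin_diff wave_def by simp
    qed
    ultimately show ?case using Suc by (simp add: distrib_left)
  qed (simp add: wave_sum_def)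
  have s0: "0 < sin (\<theta> / 2)"
  proof -
    have "\<theta> / 2 / 3 \<le> sin (\<theta> / 2)" using half_\<theta> by (intro sin_ge_third) auto
    then show ?thesis using \<theta>_pos by linarith
  qed
  have low: "\<theta> * minority / 3 \<le> sin (\<theta> * real m)"
  proof (cases "m \<le> n - m")
    case True
    then have "2 * m \<le> n" by linarith
    then have "real (2 * m) \<le> real n" by (simp only: of_nat_le_iff)
    then have "\<theta> * real (2 * m) \<le> \<theta> * real n" using \<theta>_pos by (intro mult_left_mono) auto
    then have "\<theta> * real m \<le> pi / 2" using \<theta>_n by simp
    then show ?thesis
      using sin_ge_third[of "\<theta> * real m"] \<theta>_pos True by (simp add: minority_def)
  next
    case False
    then have "real (n - m) = real n - real m" "2 * (n - m) \<le> n" using m_le by auto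
    then have r: "\<theta> * real (n - m) = pi - \<theta> * real m" using \<theta>_n by (simp add: algebra_simps)
    have "real (2 * (n - m)) \<le> real n" using \<open>2 * (n - m) \<le> n\<close> by (simp only: of_nat_le_iff)
    then have "\<theta> * real (2 * (n - m)) \<le> \<theta> * real n" using \<theta>_pos by (intro mult_left_mono) auto
    then have "\<theta> * real (n - m) \<le> pi / 2" using \<theta>_n by simp
    then have "\<theta> * real (n - m) / 3 \<le> sin (\<theta> * real (n - m))"
      using \<theta>_pos by (intro sin_ge_third) auto
    then show ?thesis unfolding minority_def using False by (simp add: r min_absorb2)
  qed
  have "0 \<le> \<theta> * minority / 3" using \<theta>_pos by (simp add: minority_def)
  then have "0 \<le> 2 * sin (\<theta> / 2) * wave_sum {1..m}" using low tele[of m] by linarith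
  then have w0: "0 \<le> wave_sum {1..m}" using s0 by (simp add: zero_le_mult_iff)
  have "2 * sin (\<theta> / 2) * wave_sum {1..m} \<le> \<theta> * wave_sum {1..m}"
    using sin_x_le_x[OF half_\<theta>(1)] w0 by (intro mult_right_mono) auto
  then have "\<theta> * (minority / 3) \<le> \<theta> * wave_sum {1..m}" using low tele[of m] by simp
  then show ?thesis using \<theta>_pos by simp
qed

lemma law_decode: "S \<in> X \<Longrightarrow> F.P t f (\<Phi> S) = C.P t (\<lambda>S. f (\<Phi> S)) S"
proof -
  assume S: "S \<in> X"
  then have O: "\<Phi> S \<in> Omega N k" using bij_decode E_subset by (auto simp: bij_betw_def)
  show ?thesis unfolding F.P_eq[OF O] C.P_eq[OF S] iter_decode[OF S] ..
qed

text \<open>Chebyshev's inequality, twice. Started from \<open>{1..m}\<close>, the wave sum at time \<open>t\<close> has mean \<open>a\<close> and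
variance at most \<open>K\<close>; in equilibrium its second moment is at most \<open>K\<close>. So the event that it
exceeds \<open>a / 2\<close> separates the two laws as long as \<open>a\<^sup>2\<close> is much larger than \<open>K\<close>.\<close>

lemma worst_dist_wilson:
  assumes N: "4 \<le> N" and M: "1 \<le> minority" and t: "0 \<le> t"
  shows "1 - 648 / minority * exp (144 * t / (real N)\<^sup>2) \<le> worst_dist N k t"
proof -
  define S0 where "S0 = {1..m}"
  define a where "a = exp (- gap * t) * wave_sum S0"
  define K where "K = 9 * minority"
  define G where "G = {S \<in> X. a / 2 < wave_sum S}"
  have S0: "S0 \<in> X" using m_le by (auto simp: S0_def ssep_states_def)
  have w0: "minority / 3 \<le> wave_sum S0" unfolding S0_def by (rule initial_wave_sum)
  have a0: "0 < a" unfolding a_def using w0 M by (intro mult_pos_pos) auto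
  have K0: "0 \<le> K" using M by (simp add: K_def)
  have gap2: "gap \<le> 2" by (simp add: gap_def)
  have Nr: "4 \<le> real N" using N by simp
  have gen: "C.gen = ssep_gen n" by (simp add: ssep_gen_def)
  have mean: "C.P t wave_sum S0 = a"
    unfolding a_def
  proof (rule C.P_eigenfunction[OF _ _ S0 t])
    show "C.gen wave_sum S = - gap * wave_sum S" if "S \<in> X" for S
      unfolding gen by (rule wave_sum_eigen[OF that])
    show "- real N \<le> - gap" using gap2 Nr by linarith
  qed
  have second: "C.P t (\<lambda>S. (wave_sum S)\<^sup>2) S0 \<le> a\<^sup>2 + K"
  proof -
    have "C.P t (\<lambda>S. (wave_sum S)\<^sup>2 - K) S0 \<le> exp (- 2 * gap * t) * ((wave_sum S0)\<^sup>2 - K)"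
    proof (rule C.P_lyapunov[OF _ _ S0 t])
      show "C.gen (\<lambda>S. (wave_sum S)\<^sup>2 - K) S \<le> - 2 * gap * ((wave_sum S)\<^sup>2 - K)" if "S \<in> X" for S
        unfolding gen K_def by (rule wave_sum_square_drift[OF that])
      show "- real N \<le> - 2 * gap" using gap2 Nr by linarith
    qed
    also have "\<dots> \<le> exp (- 2 * gap * t) * (wave_sum S0)\<^sup>2"
      using K0 by (intro mult_left_mono) auto
    also have "\<dots> = a\<^sup>2"
      by (simp add: a_def power_mult_distrib exp_double[symmetric] algebra_simps)
    finally have "C.P t (\<lambda>S. (wave_sum S)\<^sup>2 + (- K)) S0 \<le> a\<^sup>2" by simp
    then show ?thesis unfolding C.P_add[OF S0] C.P_const[OF S0] by linarith
  qed
  have low: "C.P t (\<lambda>S. of_bool (\<not> a / 2 < wave_sum S)) S0 \<le> 4 * K / a\<^sup>2"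
  proof -
    have "C.P t (\<lambda>S. of_bool (\<not> a / 2 < wave_sum S)) S0
       \<le> C.P t (\<lambda>S. 4 / a\<^sup>2 * ((wave_sum S)\<^sup>2 + (- (2 * a) * wave_sum S + a\<^sup>2))) S0"
    proof (rule C.P_mono[OF _ S0 t])
      fix S
      have sq: "(wave_sum S)\<^sup>2 + (- (2 * a) * wave_sum S + a\<^sup>2) = (a - wave_sum S)\<^sup>2"
        by (simp add: power2_eq_square algebra_simps)
      show "of_bool (\<not> a / 2 < wave_sum S) \<le> 4 / a\<^sup>2 * ((wave_sum S)\<^sup>2 + (- (2 * a) * wave_sum S + a\<^sup>2))"
      proof (cases "a / 2 < wave_sum S")
        case True
        then show ?thesis unfolding sq by simp
      next
        case False
        then have "(a / 2)\<^sup>2 \<le> (a - wave_sum S)\<^sup>2" using a0 by (intro power_mono) auto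
        then show ?thesis unfolding sq using False a0 by (simp add: power_divide field_simps)
      qed
    qed
    also have "\<dots> = 4 / a\<^sup>2 * (C.P t (\<lambda>S. (wave_sum S)\<^sup>2) S0 + (- (2 * a) * a + a\<^sup>2))"
      by (simp only: C.P_scale[OF S0] C.P_add[OF S0] C.P_const[OF S0] mean)
    also have "\<dots> \<le> 4 / a\<^sup>2 * K"
      using second by (intro mult_left_mono) (auto simp: power2_eq_square)
    finally show ?thesis by simp
  qed
  have equi_prob_second: "(\<Sum>S\<in>X. (wave_sum S)\<^sup>2) \<le> real (card X) * K"
  proof -
    have "0 = (\<Sum>S\<in>X. ssep_gen n (\<lambda>S. (wave_sum S)\<^sup>2 - K) S)"
      by (simp add: ssep_gen_invariant)
    also have "\<dots> \<le> (\<Sum>S\<in>X. - 2 * gap * ((wave_sum S)\<^sup>2 - K))"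
      unfolding K_def by (intro sum_mono wave_sum_square_drift)
    also have "\<dots> = - 2 * gap * ((\<Sum>S\<in>X. (wave_sum S)\<^sup>2) - real (card X) * K)"
      by (simp only: sum_distrib_left[symmetric] sum_subtractf sum_constant)
    finally have "2 * gap * ((\<Sum>S\<in>X. (wave_sum S)\<^sup>2) - real (card X) * K) \<le> 0" by simp
    then show ?thesis using gap_pos by (simp add: mult_le_0_iff)
  qed
  have inj: "\<Phi> S \<in> \<Phi> ` G \<longleftrightarrow> a / 2 < wave_sum S" if "S \<in> X" for S
    using that bij_decode by (auto simp: G_def bij_betw_def inj_on_def)
  have eq: "equi_prob (\<Phi> ` G) \<le> 4 * K / a\<^sup>2"
  proof -
    have "(\<Sum>S\<in>X. of_bool (\<Phi> S \<in> \<Phi> ` G)) \<le> (\<Sum>S\<in>X. 4 / a\<^sup>2 * (wave_sum S)\<^sup>2)"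
    proof (rule sum_mono)
      fix S assume S: "S \<in> X"
      show "of_bool (\<Phi> S \<in> \<Phi> ` G) \<le> 4 / a\<^sup>2 * (wave_sum S)\<^sup>2"
      proof (cases "a / 2 < wave_sum S")
        case True
        then have "(a / 2)\<^sup>2 \<le> (wave_sum S)\<^sup>2" using a0 by (intro power_mono) auto
        then show ?thesis using True a0 by (simp add: inj[OF S] power_divide field_simps)
      qed (simp add: inj[OF S])
    qed
    also have "\<dots> = 4 / a\<^sup>2 * (\<Sum>S\<in>X. (wave_sum S)\<^sup>2)" by (simp add: sum_distrib_left)
    also have "\<dots> \<le> 4 / a\<^sup>2 * (real (card X) * K)"
      using equi_prob_second by (intro mult_left_mono) auto
    finally have "(\<Sum>S\<in>X. of_bool (\<Phi> S \<in> \<Phi> ` G)) / real (card X) \<le> (4 / a\<^sup>2 * (real (card X) * K)) / real (card X)"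
      by (intro divide_right_mono) auto
    then show ?thesis unfolding equi_prob_eq using card_X_pos by simp
  qed
  have \<xi>0: "\<Phi> S0 \<in> Omega N k" using S0 bij_decode E_subset by (auto simp: bij_betw_def)
  have sub: "\<Phi> ` G \<subseteq> Omega N k" using bij_decode E_subset by (auto simp: G_def bij_betw_def)
  have "F.P t (\<lambda>\<zeta>. of_bool (\<zeta> \<in> - \<Phi> ` G)) (\<Phi> S0) = C.P t (\<lambda>S. of_bool (\<Phi> S \<in> - \<Phi> ` G)) S0"
    by (rule law_decode[OF S0])
  also have "\<dots> \<le> C.P t (\<lambda>S. of_bool (\<not> a / 2 < wave_sum S)) S0"
    using inj by (intro C.P_mono S0 t) auto
  finally have "1 - F.P t (\<lambda>\<zeta>. of_bool (\<zeta> \<in> \<Phi> ` G)) (\<Phi> S0) \<le> 4 * K / a\<^sup>2"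
    unfolding P_compl[OF \<xi>0] using low by linarith
  then have "1 - 8 * K / a\<^sup>2 \<le> worst_dist N k t"
    using worst_dist_ge[OF \<xi>0 sub, of t] eq by linarith
  moreover have "8 * K / a\<^sup>2 \<le> 648 / minority * exp (144 * t / (real N)\<^sup>2)"
  proof -
    have "N \<le> 3 * n" using n_pos m_le N_eq by linarith
    then have "real N \<le> real (3 * n)" by (simp only: of_nat_le_iff)
    then have "(real N)\<^sup>2 \<le> (3 * real n)\<^sup>2" by (intro power_mono) auto
    then have N9: "(real N)\<^sup>2 / 9 \<le> (real n)\<^sup>2" by (simp add: power_mult_distrib)
    have "gap \<le> 8 / (real n)\<^sup>2" by (rule gap_bounds)
    also have "\<dots> \<le> 8 / ((real N)\<^sup>2 / 9)"
      using N9 Nr n_pos by (intro divide_left_mono mult_pos_pos) auto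
    finally have "gap \<le> 72 / (real N)\<^sup>2" by simp
    then have "2 * (gap * t) \<le> 2 * (72 / (real N)\<^sup>2 * t)" using t by (intro mult_left_mono mult_right_mono) auto
    then have g: "2 * (gap * t) \<le> 144 * t / (real N)\<^sup>2" by simp
    have aa: "a\<^sup>2 = (wave_sum S0)\<^sup>2 / exp (2 * (gap * t))"
      by (simp add: a_def power_mult_distrib exp_double[symmetric] exp_minus divide_inverse mult.commute power_inverse)
    have "8 * K / a\<^sup>2 = 72 * minority * exp (2 * (gap * t)) / (wave_sum S0)\<^sup>2"
      unfolding aa by (simp add: K_def)
    also have "\<dots> \<le> 72 * minority * exp (2 * (gap * t)) / (minority / 3)\<^sup>2"
    proof (rule divide_left_mono)
      show "(minority / 3)\<^sup>2 \<le> (wave_sum S0)\<^sup>2" using w0 M by (intro power_mono) auto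
      have "0 < wave_sum S0" using w0 M by linarith
      then show "0 < (wave_sum S0)\<^sup>2 * (minority / 3)\<^sup>2" using M by (intro mult_pos_pos zero_less_power) auto
    qed (use M in auto)
    also have "\<dots> = 648 / minority * exp (2 * (gap * t))"
      using M by (simp add: power2_eq_square)
    also have "\<dots> \<le> 648 / minority * exp (144 * t / (real N)\<^sup>2)"
      using g M by (intro mult_left_mono) auto
    finally show ?thesis .
  qed
  ultimately show ?thesis by linarith
qed

end

section \<open>The mixing time\<close>

context fep_chain
begin

text \<open>The threshold \<open>sqrt N\<close> for \<open>n - m\<close> serves both cases: below it the transient bound has a factor
\<open>32 / sqrt N\<close>, above it \<open>minority \<ge> sqrt m\<close>. In both cases the exponential costs at
most the power \<open>1/8\<close>, which leaves \<open>- 1/2 + 1/8 = - 3/8\<close>.\<close>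

lemma worst_dist_small_time:
  assumes n: "20 \<le> n" and m: "1 \<le> m"
    and t: "0 \<le> t" "t \<le> (1/2000) * ((real N)\<^sup>2 * ln (real m))"
  shows "1 - 648 * exp (- 3/8 * ln (real m)) \<le> worst_dist N k t"
proof -
  have N: "20 \<le> N" "m \<le> N" using n by (auto simp: N_eq)
  have N0: "0 < real N" using N by simp
  have lnm: "0 \<le> ln (real m)" using m by simp
  have lnN: "ln (real m) \<le> ln (real N)" using m N by simp
  have tN: "t / (real N)\<^sup>2 \<le> ln (real m) / 2000"
    using t(2) N0 by (simp add: divide_le_eq mult.commute)
  have sqrtN: "sqrt (real N) = exp (ln (real N) / 2)"
    using N0 by (simp add: ln_sqrt[symmetric])
  have eN: "exp (ln (real N)) = real N" using N0 by simp
  show ?thesis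
  proof (cases "real (n - m) \<le> sqrt (real N)")
    case True
    have "16 * (real (n - m) + sqrt (real N)) / real N * exp (248 * t / (real N)\<^sup>2)
       \<le> 32 * sqrt (real N) / real N * exp (ln (real N) / 8)"
    proof (rule mult_mono)
      have "16 * (real (n - m) + sqrt (real N)) \<le> 32 * sqrt (real N)"
        using True by (simp add: algebra_simps)
      then show "16 * (real (n - m) + sqrt (real N)) / real N \<le> 32 * sqrt (real N) / real N"
        by (rule divide_right_mono) simp
      \<comment> \<open>\<open>248 / 2000 < 1 / 8\<close>\<close>
      have "248 * t / (real N)\<^sup>2 \<le> ln (real N) / 8" using tN lnm lnN by simp
      then show "exp (248 * t / (real N)\<^sup>2) \<le> exp (ln (real N) / 8)" by simp
    qed (use True N0 in auto)
    also have "\<dots> = 32 * (exp (ln (real N) / 2) / exp (ln (real N)) * exp (ln (real N) / 8))"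
      unfolding sqrtN eN by simp
    also have "\<dots> = 32 * exp (- 3/8 * ln (real N))"
      by (simp flip: exp_add exp_diff)
    also have "\<dots> \<le> 648 * exp (- 3/8 * ln (real m))"
      using lnN by (intro mult_mono) auto
    finally show ?thesis
      using worst_dist_transient[OF m _ t(1)] n by (simp add: k_eq)
  next
    case False
    have M: "exp (ln (real m) / 2) \<le> minority"
    proof -
      have s: "exp (ln (real m) / 2) = sqrt (real m)" using m by (simp add: ln_sqrt[symmetric])
      have "sqrt (real m) \<le> sqrt (real N)" using N by simp
      then have "sqrt (real m) \<le> real (n - m)" using False by linarith
      moreover have "sqrt (real m) \<le> real m"
      proof -
        have "sqrt (real m) * 1 \<le> sqrt (real m) * sqrt (real m)" using m by (intro mult_left_mono) auto
        then show ?thesis by simp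
      qed
      ultimately show ?thesis by (simp add: s minority_def min_def)
    qed
    have M1: "1 \<le> minority" using M lnm one_le_exp_iff[of "ln (real m) / 2"] by linarith
    have "648 / minority * exp (144 * t / (real N)\<^sup>2) \<le> 648 / exp (ln (real m) / 2) * exp (ln (real m) / 8)"
    proof (intro mult_mono divide_left_mono mult_pos_pos)
      have "144 * t / (real N)\<^sup>2 \<le> ln (real m) / 8" using tN lnm by simp
      then show "exp (144 * t / (real N)\<^sup>2) \<le> exp (ln (real m) / 8)" by simp
    qed (use M M1 in auto)
    also have "\<dots> = 648 * (exp (ln (real m) / 8) / exp (ln (real m) / 2))" by simp
    also have "\<dots> = 648 * exp (- 3/8 * ln (real m))" by (simp flip: exp_diff)
    finally show ?thesis
      using worst_dist_wilson[OF _ M1 t(1)] N by simp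
  qed
qed

text \<open>With \<open>(N + 1)\<^sup>2 \<le> 4 N\<^sup>2\<close> the exponential is at most \<open>m\<close> to the power \<open>- 3\<close>, and the prefactor is quadratic in \<open>m\<close>.\<close>

lemma worst_dist_large_time:
  assumes m: "1 \<le> m"
  shows "worst_dist N k (24 * ((real N)\<^sup>2 * ln (real m))) \<le> 20 / real m"
proof -
  let ?t = "24 * ((real N)\<^sup>2 * ln (real m))"
  have N1: "1 \<le> real N" by (simp add: N_eq)
  have lnm: "0 \<le> ln (real m)" using m by simp
  have m1: "1 \<le> real m" using m by simp
  have "(real N + 1)\<^sup>2 \<le> (2 * real N)\<^sup>2" using N1 by (intro power_mono) auto
  then have N4: "(real N + 1)\<^sup>2 \<le> 4 * (real N)\<^sup>2" by (simp add: power_mult_distrib)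
  have e: "3 * ln (real m) \<le> ?t / (2 * (real N + 1)\<^sup>2)"
  proof -
    have "3 * ln (real m) * (2 * (real N + 1)\<^sup>2) \<le> 3 * ln (real m) * (2 * (4 * (real N)\<^sup>2))"
      using N4 lnm by (intro mult_left_mono) auto
    then show ?thesis using N1 by (simp add: le_divide_eq mult_ac)
  qed
  have "worst_dist N k ?t \<le> (4 * real m + 4 * (real m + 1)\<^sup>2) * exp (- ?t / (2 * (real N + 1)\<^sup>2))"
    using lnm by (intro worst_dist_le) auto
  also have "\<dots> \<le> (20 * (real m)\<^sup>2) * exp (- (3 * ln (real m)))"
  proof (intro mult_mono)
    have "real m * 1 \<le> real m * real m" using m1 by (intro mult_left_mono) auto
    moreover have "(real m + 1)\<^sup>2 \<le> (2 * real m)\<^sup>2" using m1 by (intro power_mono) auto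
    ultimately show "4 * real m + 4 * (real m + 1)\<^sup>2 \<le> 20 * (real m)\<^sup>2" by (simp add: power2_eq_square)
    show "exp (- ?t / (2 * (real N + 1)\<^sup>2)) \<le> exp (- (3 * ln (real m)))" using e by simp
  qed auto
  also have "exp (- (3 * ln (real m))) = 1 / (real m) ^ 3"
  proof -
    have "exp (3 * ln (real m)) = (real m) ^ 3" using m by (simp add: exp_of_nat_mult[of 3, simplified])
    then show ?thesis by (simp add: exp_minus inverse_eq_divide)
  qed
  also have "20 * (real m)\<^sup>2 * (1 / (real m) ^ 3) = 20 / real m"
    using m by (simp add: power2_eq_square power3_eq_cube)
  finally show ?thesis .
qed

lemma T_seg_ratio:
  assumes n: "20 \<le> n" and m: "2 \<le> m"
    and large: "20 / real m \<le> \<epsilon>" "648 * exp (- 3/8 * ln (real m)) < 1 - \<epsilon>"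
  shows "ereal (1/2000) \<le> T_seg N k \<epsilon> / ereal ((real N)\<^sup>2 * ln (real m))"
    and "T_seg N k \<epsilon> / ereal ((real N)\<^sup>2 * ln (real m)) \<le> ereal 24"
proof -
  define L where "L = (real N)\<^sup>2 * ln (real m)"
  have "0 < ln (real m)" using m by simp
  then have L: "0 < L" unfolding L_def by (intro mult_pos_pos) (simp_all add: N_eq)
  have "ereal (1/2000 * L) \<le> T_seg N k \<epsilon>"
    unfolding T_seg_def
  proof (rule INF_greatest)
    fix t assume t: "t \<in> {t. 0 \<le> t \<and> worst_dist N k t \<le> \<epsilon>}"
    show "ereal (1/2000 * L) \<le> ereal t"
    proof (rule ccontr)
      assume "\<not> ?thesis"
      then have "t \<le> 1/2000 * L" by simp
      then have "1 - 648 * exp (- 3/8 * ln (real m)) \<le> worst_dist N k t"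
        using n m t unfolding L_def by (intro worst_dist_small_time) auto
      then show False using t large(2) by simp
    qed
  qed
  then show "ereal (1/2000) \<le> T_seg N k \<epsilon> / ereal ((real N)\<^sup>2 * ln (real m))"
    unfolding L_def[symmetric] using L by (subst ereal_le_divide_pos) (auto simp: mult.commute)
  have "T_seg N k \<epsilon> \<le> ereal (24 * L)"
    unfolding T_seg_def
  proof (rule INF_lower)
    have "worst_dist N k (24 * L) \<le> 20 / real m"
      unfolding L_def using m by (intro worst_dist_large_time) auto
    then show "24 * L \<in> {t. 0 \<le> t \<and> worst_dist N k t \<le> \<epsilon>}" using large(1) L by auto
  qed
  then show "T_seg N k \<epsilon> / ereal ((real N)\<^sup>2 * ln (real m)) \<le> ereal 24"
    unfolding L_def[symmetric] using L by (subst ereal_divide_le_pos) (auto simp: mult.commute)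
qed

end

theorem theorem2p1:
  fixes k :: "nat \<Rightarrow> nat"
  assumes "\<forall>\<^sub>F N in sequentially. real N / 2 < real (k N) \<and> k N < N"
    and "filterlim (\<lambda>N. real N - real (k N)) at_top sequentially"
    and "filterlim (\<lambda>N. real (k N) - real N / 2) at_top sequentially"
  shows "\<exists>C1 C2 :: real. 0 < C1 \<and> C1 < C2 \<and>
    (\<forall>\<epsilon>\<in>{0<..<1}.
       ereal C1 \<le> liminf (\<lambda>N. T_seg N (k N) \<epsilon> / ereal ((real N)\<^sup>2 * ln (real N - real (k N)))) \<and>
       liminf (\<lambda>N. T_seg N (k N) \<epsilon> / ereal ((real N)\<^sup>2 * ln (real N - real (k N))))
         \<le> limsup (\<lambda>N. T_seg N (k N) \<epsilon> / ereal ((real N)\<^sup>2 * ln (real N - real (k N)))) \<and>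
       limsup (\<lambda>N. T_seg N (k N) \<epsilon> / ereal ((real N)\<^sup>2 * ln (real N - real (k N)))) \<le> ereal C2)"
proof (rule exI[of _ "1/2000"], rule exI[of _ 24], intro conjI ballI)
  fix \<epsilon> :: real assume \<epsilon>: "\<epsilon> \<in> {0<..<1}"
  let ?Q = "\<lambda>N. T_seg N (k N) \<epsilon> / ereal ((real N)\<^sup>2 * ln (real N - real (k N)))"
  have "filterlim (\<lambda>x. 20 / x) (nhds 0) (at_top :: real filter)" by real_asymp
  then have "\<forall>\<^sub>F x in at_top. 20 / x < \<epsilon>" using \<epsilon> by (intro order_tendstoD) auto
  moreover have "filterlim (\<lambda>x. 648 * exp (- 3/8 * ln x)) (nhds 0) (at_top :: real filter)" by real_asymp
  then have "\<forall>\<^sub>F x in at_top. 648 * exp (- 3/8 * ln x) < 1 - \<epsilon>" using \<epsilon> by (intro order_tendstoD) auto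
  ultimately have large: "\<forall>\<^sub>F x in at_top. 20 / x < \<epsilon> \<and> 648 * exp (- 3/8 * ln x) < 1 - \<epsilon> \<and> 2 \<le> x"
    by (intro eventually_conj eventually_ge_at_top)
  have "\<forall>\<^sub>F N in sequentially. ereal (1/2000) \<le> ?Q N \<and> ?Q N \<le> ereal 24"
    using assms(1) eventually_compose_filterlim[OF large assms(2)] eventually_ge_at_top[of 50]
  proof eventually_elim
    case (elim N)
    define m where "m = N - k N"
    define n where "n = k N - 1"
    have kN: "N < 2 * k N" "k N < N" using elim by linarith+
    have m: "real N - real (k N) = real m" using kN by (simp add: m_def of_nat_diff)
    interpret fep_chain n m N "k N"
      using kN elim by unfold_locales (auto simp: n_def m_def)
    have "20 \<le> n" using kN elim by (simp add: n_def)
    moreover have "2 \<le> m" using elim unfolding m by simp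
    ultimately show ?case
      using T_seg_ratio[of \<epsilon>] elim \<epsilon> unfolding m by auto
  qed
  then have ev: "\<forall>\<^sub>F N in sequentially. ereal (1/2000) \<le> ?Q N" "\<forall>\<^sub>F N in sequentially. ?Q N \<le> ereal 24"
    by (auto elim: eventually_mono)
  show "ereal (1/2000) \<le> liminf ?Q" by (rule Liminf_bounded[OF ev(1)])
  show "liminf ?Q \<le> limsup ?Q" by (rule Liminf_le_Limsup) simp
  show "limsup ?Q \<le> ereal 24" by (rule Limsup_bounded[OF ev(2)])
qed auto

end
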